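(* Let $k\ge4$ be an even integer, $b=(k-2)/4$, and $\varepsilon>0$. For each $n$ let $\mathbf v_0=\mathbf v_0(n)\in\mathbb S^{n-1}$ and $\beta=\beta_n$, and let $$\widetilde{\mathbf X}=\beta\,\mathbf v_0^{\otimes k}+\frac1{\sqrt n}\mathbf G,$$ where $\mathbf G\in\bigotimes^k\mathbb R^n$ has i.i.d. $\mathsf N(0,1)$ entries (no symmetrization). Let $\widehat{\mathbf v}$ be the estimate obtained from $\widetilde{\mathbf X}$ by two-step recursive unfolding (defined in the context). If $\beta\ge(1+\varepsilon)n^b$ for all $n$, then almost surely $$\lim_{n\to\infty}\mathrm{Loss}(\widehat{\mathbf v},\mathbf v_0)=0.$$
   Context: $\mathbb S^{n-1}$ is the unit sphere of $\mathbb R^n$; $\mathbf v^{\otimes k}$ has entries $\mathbf v_{i_1}\cdots\mathbf v_{i_k}$. For $k$ even, $\mathsf{Mat}(\mathbf X)\in\mathbb R^{n^{k/2}\times n^{k/2}}$ is the unfolding with entries $[\mathsf{Mat}(\mathbf X)]_{a,c}=\mathbf X_{i_1,\dots,i_k}$, where $a=1+\sum_{j=1}^{k/2}(i_j-1)n^{j-1}$ and $c=1+\sum_{j=k/2+1}^{k}(i_j-1)n^{j-k/2-1}$. Two-step recursive unfolding: (1) let $\mathbf w\in\mathbb R^{n^{k/2}}=\mathbb R^{n^{2b+1}}$ be the top (unit-norm) right singular vector of $\mathsf{Mat}(\widetilde{\mathbf X})$; (2) form the matrix $\mathsf{Mat}_1(\mathbf w)\in\mathbb R^{n\times n^{2b}}$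 with entries $\mathsf{Mat}_1(\mathbf w)_{i,j}=\mathbf w_{i+(j-1)n}$ for $i\in[n]$, $j\in[n^{2b}]$, and let $\widehat{\mathbf v}\in\mathbb S^{n-1}$ be its top (unit-norm) left singular vector. For unit vectors, $\mathrm{Loss}(\widehat{\mathbf v},\mathbf v_0)=\min(\|\widehat{\mathbf v}-\mathbf v_0\|_2^2,\|\widehat{\mathbf v}+\mathbf v_0\|_2^2)=2-2|\langle\widehat{\mathbf v},\mathbf v_0\rangle|$. *)

theory Defs
  imports "HOL-Probability.Probability" "Jordan_Normal_Form.Matrix"
begin

unbundle no vec_syntax

text \<open>Dimensions vary with \<open>n\<close>, so vectors and matrices are the carrier-based ones of
  \<^theory>\<open>Jordan_Normal_Form.Matrix\<close>. All indices are 0-based: an index \<open>i \<in> {1..n}\<close> of the usual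
  convention is \<open>i - 1\<close> here. A tensor of order \<open>k\<close> over \<open>\<real>\<^sup>n\<close> is a function on multi-indices, i.e.
  lists of length \<open>k\<close> with entries below \<open>n\<close>; its values elsewhere are irrelevant.\<close>

type_synonym tensor = "nat list \<Rightarrow> real"

definition multi_indices :: "nat \<Rightarrow> nat \<Rightarrow> nat list set" where
  "multi_indices n k = {is. set is \<subseteq> {..<n} \<and> length is = k}"

definition tensor_power :: "nat \<Rightarrow> real vec \<Rightarrow> tensor" where
  "tensor_power k v = (\<lambda>is. \<Prod>j<k. v $ (is ! j))"

definition spiked_tensor :: "nat \<Rightarrow> nat \<Rightarrow> real \<Rightarrow> real vec \<Rightarrow> tensor \<Rightarrow> tensor" where
  "spiked_tensor n k \<beta> v G = (\<lambda>is. \<beta> * tensor_power k v is + 1 / sqrt (real n) * G is)"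

text \<open>The \<open>m\<close> base-\<open>n\<close> digits of \<open>a\<close>, least significant first, so that
  \<open>a = (\<Sum>j<m. digits n m a ! j * n ^ j)\<close> for \<open>a < n ^ m\<close>.\<close>

definition digits :: "nat \<Rightarrow> nat \<Rightarrow> nat \<Rightarrow> nat list" where
  "digits n m a = map (\<lambda>j. a div n ^ j mod n) [0..<m]"

definition Mat :: "nat \<Rightarrow> nat \<Rightarrow> tensor \<Rightarrow> real mat" where
  "Mat n k X = mat (n ^ (k div 2)) (n ^ (k div 2))
     (\<lambda>(a, c). X (digits n (k div 2) a @ digits n (k div 2) c))"

definition Mat1 :: "nat \<Rightarrow> nat \<Rightarrow> real vec \<Rightarrow> real mat" where
  "Mat1 n m w = mat n m (\<lambda>(i, j). w $ (i + j * n))"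

definition vec_norm :: "real vec \<Rightarrow> real" where
  "vec_norm v = sqrt (v \<bullet> v)"

definition singular_triple :: "real mat \<Rightarrow> real \<Rightarrow> real vec \<Rightarrow> real vec \<Rightarrow> bool" where
  "singular_triple A \<sigma> u v \<longleftrightarrow>
     \<sigma> \<ge> 0 \<and> u \<in> carrier_vec (dim_row A) \<and> v \<in> carrier_vec (dim_col A) \<and>
     vec_norm u = 1 \<and> vec_norm v = 1 \<and>
     A *\<^sub>v v = \<sigma> \<cdot>\<^sub>v u \<and> transpose_mat A *\<^sub>v u = \<sigma> \<cdot>\<^sub>v v"

definition top_singular_triple :: "real mat \<Rightarrow> real \<Rightarrow> real vec \<Rightarrow> real vec \<Rightarrow> bool" where
  "top_singular_triple A \<sigma> u v \<longleftrightarrow>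
     singular_triple A \<sigma> u v \<and> (\<forall>\<sigma>' u' v'. singular_triple A \<sigma>' u' v' \<longrightarrow> \<sigma>' \<le> \<sigma>)"

definition top_left_singular_vector :: "real mat \<Rightarrow> real vec \<Rightarrow> bool" where
  "top_left_singular_vector A u \<longleftrightarrow> (\<exists>\<sigma> v. top_singular_triple A \<sigma> u v)"

definition top_right_singular_vector :: "real mat \<Rightarrow> real vec \<Rightarrow> bool" where
  "top_right_singular_vector A v \<longleftrightarrow> (\<exists>\<sigma> u. top_singular_triple A \<sigma> u v)"

text \<open>A relation rather than a function, because singular vectors are unique at best up to sign.
  The number of columns in the second step is \<open>n ^ (2 * b) = n ^ (k div 2 - 1)\<close>
  for \<open>b = (k - 2) / 4\<close>.\<close>

definition recursive_unfolding_estimate :: "nat \<Rightarrow> nat \<Rightarrow> tensor \<Rightarrow> real vec \<Rightarrow> bool" where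
  "recursive_unfolding_estimate n k X v \<longleftrightarrow>
     (\<exists>w. top_right_singular_vector (Mat n k X) w \<and>
          top_left_singular_vector (Mat1 n (n ^ (k div 2 - 1)) w) v)"

definition Loss :: "real vec \<Rightarrow> real vec \<Rightarrow> real" where
  "Loss v u = min ((vec_norm (v - u))\<^sup>2) ((vec_norm (v + u))\<^sup>2)"

text \<open>The unfolding has its usual entrywise description.\<close>

lemma digits_Suc: "digits n (Suc m) a = (a mod n) # digits n m (a div n)"
proof -
  have "[0..<Suc m] = 0 # map Suc [0..<m]"
    by (simp only: map_Suc_upt upt_conv_Cons[of 0 "Suc m"] zero_less_Suc if_True)
  then show ?thesis
    by (simp add: digits_def div_mult2_eq del: upt_Suc)
qed

lemma digits_encode:
  assumes "is \<in> multi_indices n m"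
  shows "digits n m (\<Sum>j<m. is ! j * n ^ j) = is"
  using assms
proof (induction m arbitrary: "is")
  case 0
  then show ?case by (simp add: digits_def multi_indices_def)
next
  case (Suc m)
  then obtain i js where is_eq: "is = i # js" and i: "i < n" and js: "js \<in> multi_indices n m"
    by (auto simp: multi_indices_def length_Suc_conv)
  have "(\<Sum>j<Suc m. is ! j * n ^ j) = i + n * (\<Sum>j<m. js ! j * n ^ j)"
    by (subst sum.lessThan_Suc_shift) (simp add: is_eq sum_distrib_left algebra_simps)
  then show ?case
    using i Suc.IH[OF js] by (simp add: digits_Suc is_eq)
qed

lemma encode_less:
  assumes "is \<in> multi_indices n m"
  shows "(\<Sum>j<m. is ! j * n ^ j) < n ^ m"
  using assms
proof (induction m arbitrary: "is")
  case 0
  then show ?case by simp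
next
  case (Suc m)
  then obtain i js where is_eq: "is = i # js" and i: "i < n" and js: "js \<in> multi_indices n m"
    by (auto simp: multi_indices_def length_Suc_conv)
  have "(\<Sum>j<Suc m. is ! j * n ^ j) = i + n * (\<Sum>j<m. js ! j * n ^ j)"
    by (subst sum.lessThan_Suc_shift) (simp add: is_eq sum_distrib_left algebra_simps)
  also have "\<dots> < n * Suc (\<Sum>j<m. js ! j * n ^ j)" using i by simp
  also have "\<dots> \<le> n * n ^ m" using Suc.IH[OF js] by (intro mult_le_mono2) simp
  finally show ?case by simp
qed

lemma Mat_entry:
  assumes "even k" and "is \<in> multi_indices n k"
  shows "Mat n k X $$ (\<Sum>j<k div 2. is ! j * n ^ j, \<Sum>j<k div 2. is ! (k div 2 + j) * n ^ j) = X is"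
proof -
  define h where "h = k div 2"
  have k: "k = h + h" using assms(1) by (auto simp: h_def)
  have l: "take h is \<in> multi_indices n h" and r: "drop h is \<in> multi_indices n h"
    using assms(2) set_take_subset[of h "is"] set_drop_subset[of h "is"]
    by (auto simp: multi_indices_def k)
  have L: "(\<Sum>j<h. is ! j * n ^ j) = (\<Sum>j<h. take h is ! j * n ^ j)"
    by simp
  have R: "(\<Sum>j<h. is ! (h + j) * n ^ j) = (\<Sum>j<h. drop h is ! j * n ^ j)"
    using assms(2) by (intro sum.cong) (auto simp: multi_indices_def k)
  show ?thesis
    unfolding h_def[symmetric] Mat_def L R
    using encode_less[OF l] encode_less[OF r]
    by (simp add: digits_encode[OF l] digits_encode[OF r] del: nth_take nth_drop)
qed

end

theory Submission
  imports Defs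
begin

text \<open>
  Up to the factor \<open>sqrt n\<close>, the unfolding is \<open>A = l sqrt N e e\<^sup>T + g\<close>, where \<open>N = n ^ (k div 2)\<close>,
  \<open>e\<close> is the unfolded tensor power of \<open>v\<^sub>0\<close>, \<open>g\<close> is an \<open>N \<times> N\<close> Gaussian matrix and \<open>l \<ge> 1 + \<epsilon>\<close>.

  All the probabilistic input comes from the invariance of the Gaussian measure under Householder
  reflections and from chi-square tails. Tridiagonalization by reflections shows that, outside an event of
  exponentially small probability, \<open>\<parallel>g\<parallel> \<le> (2 + \<kappa>) sqrt N\<close>, while the top singular value of \<open>A\<close> is at least
  \<open>(2 + 2 \<kappa>) sqrt N\<close> and its right singular vector \<open>w\<close> satisfies \<open>\<bar>\<langle>e, w\<rangle>\<bar> \<ge> c > 0\<close>.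

  The overlap need not tend to \<open>1\<close>, so it has to be shown that the part of \<open>w\<close> orthogonal to \<open>e\<close> is
  invisible to the second step. By the spectral gap, the orthogonal part of \<open>w\<close> is close to a multiple of that
  of \<open>(A\<^sup>T A) ^ n e\<close>. The law of the latter is invariant under all reflections that fix \<open>e\<close>, so its direction
  behaves like that of a Gaussian vector, and the \<open>n \<times> n ^ (k div 2 - 1)\<close> matricization of a Gaussian vector
  has norm of order \<open>1 / sqrt n\<close> relative to its length. Hence the matrix of the second step is a small
  perturbation of a rank-one matrix with left factor \<open>v\<^sub>0\<close>. The failure probabilities are \<open>O (1 / n\<^sup>2)\<close>, and
  the Borel-Cantelli lemma gives almost sure convergence.
\<close>

section \<open>Householder reflections and the Gaussian measure\<close>

text \<open>The threshold \<open>1 + \<epsilon>\<close> leaves no constant to waste. For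
  \<open>l\<close> slightly above 1 the spike \<open>l sqrt N\<close> alone is weaker than the
  noise, whose norm is about \<open>2 sqrt N\<close>; only spike and noise together reach
  \<open>(l + 1 / l) sqrt N\<close>. An estimate of the noise norm up to a constant factor, as nets
  give it, is therefore useless. Tridiagonalization yields both sharp constants from one
  decomposition, provided that the reflections on either side keep the direction of the spike, which
  then stays in the corner; this is why the reduced form is tridiagonal and not bidiagonal. The
  obstacle of the second step is that \<open>w\<close> depends on the noise and is an arbitrary,
  possibly non-measurable choice of singular vector, so no symmetry can be applied to it. All events
  are therefore sets of noise matrices on which something holds for every top pair, and symmetry is
  applied to a vector that is a polynomial in the noise. The strength \<open>l\<close> may vary with
  \<open>n\<close> without bound; the constants must not depend on it.\<close>

definition ip :: "'i set \<Rightarrow> ('i \<Rightarrow> real) \<Rightarrow> ('i \<Rightarrow> real) \<Rightarrow> real" where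
  "ip I x y = (\<Sum>i\<in>I. x i * y i)"

text \<open>All rotations of the proof are built from reflections, which are explicit, measurable in
  their axis and involutive. The restriction makes them maps of \<open>extensional I\<close>, the
  space of the product measure.\<close>

definition householder :: "'i set \<Rightarrow> ('i \<Rightarrow> real) \<Rightarrow> ('i \<Rightarrow> real) \<Rightarrow> ('i \<Rightarrow> real)" where
  "householder I a x = (\<lambda>i\<in>I. x i - 2 * ip I a x / ip I a a * a i)"

definition std_normal :: "real measure" where
  "std_normal = density lborel (\<lambda>x. ennreal (std_normal_density x))"

definition gauss :: "'i set \<Rightarrow> ('i \<Rightarrow> real) measure" where
  "gauss I = PiM I (\<lambda>_. std_normal)"

lemma ip_commute: "ip I x y = ip I y x"
  by (simp add: ip_def mult.commute)

lemma ip_nonneg [simp]: "0 \<le> ip I x x"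
  by (simp add: ip_def sum_nonneg)

lemma ip_add_left: "ip I (\<lambda>i. x i + y i) z = ip I x z + ip I y z"
  by (simp add: ip_def algebra_simps sum.distrib)

lemma ip_diff_left: "ip I (\<lambda>i. x i - y i) z = ip I x z - ip I y z"
  by (simp add: ip_def algebra_simps sum_subtractf)

lemma ip_scale_left: "ip I (\<lambda>i. c * x i) z = c * ip I x z"
  by (simp add: ip_def algebra_simps sum_distrib_left)

lemma ip_add_right: "ip I z (\<lambda>i. x i + y i) = ip I z x + ip I z y"
  by (simp add: ip_def algebra_simps sum.distrib)

lemma ip_diff_right: "ip I z (\<lambda>i. x i - y i) = ip I z x - ip I z y"
  by (simp add: ip_def algebra_simps sum_subtractf)

lemma ip_scale_right: "ip I z (\<lambda>i. c * x i) = c * ip I z x"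
  by (simp add: ip_def algebra_simps sum_distrib_left)

lemmas ip_simps = ip_add_left ip_diff_left ip_scale_left ip_add_right ip_diff_right ip_scale_right

lemma ip_cong: "(\<And>i. i \<in> I \<Longrightarrow> x i = x' i) \<Longrightarrow> (\<And>i. i \<in> I \<Longrightarrow> y i = y' i) \<Longrightarrow> ip I x y = ip I x' y'"
  by (simp add: ip_def)

lemma ip_self_L2: "ip I x x = (L2_set x I)\<^sup>2"
  by (simp add: ip_def L2_set_def sum_nonneg power2_eq_square)

lemma L2_eq_sqrt_ip: "L2_set x I = sqrt (ip I x x)"
  by (simp add: ip_def L2_set_def power2_eq_square)

lemma abs_ip_le: "\<bar>ip I x y\<bar> \<le> L2_set x I * L2_set y I"
proof -
  have "\<bar>ip I x y\<bar> \<le> (\<Sum>i\<in>I. \<bar>x i\<bar> * \<bar>y i\<bar>)"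
    unfolding ip_def by (rule order_trans[OF sum_abs]) (simp add: abs_mult)
  then show ?thesis using L2_set_mult_ineq[of x y I] by linarith
qed

lemma ip_self_eq_0: "finite I \<Longrightarrow> ip I x x = 0 \<longleftrightarrow> (\<forall>i\<in>I. x i = 0)"
  by (simp add: ip_self_L2 L2_set_eq_0_iff)

lemma ip_householder_left:
  "ip I (householder I a x) y = ip I x y - 2 * ip I a x * ip I a y / ip I a a"
proof -
  have "ip I (householder I a x) y = ip I (\<lambda>i. x i - (2 * ip I a x / ip I a a) * a i) y"
    by (rule ip_cong) (auto simp: householder_def)
  then show ?thesis unfolding ip_diff_left ip_scale_left by simp
qed

lemma ip_householder_right:
  "ip I y (householder I a x) = ip I y x - 2 * ip I a x * ip I a y / ip I a a"
  by (simp add: ip_commute[of I y] ip_householder_left)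

lemma ip_householder_sym: "ip I (householder I a x) y = ip I x (householder I a y)"
  by (simp add: ip_householder_left ip_householder_right ip_commute)

lemma ip_householder_householder [simp]: "ip I (householder I a x) (householder I a y) = ip I x y"
  by (cases "ip I a a = 0")
     (simp_all add: ip_householder_left ip_householder_right field_simps)

lemma householder_cong:
  "(\<And>i. i \<in> I \<Longrightarrow> x i = y i) \<Longrightarrow> householder I a x = householder I a y"
  using ip_cong[of I a a x y] by (auto simp: householder_def fun_eq_iff)

lemma householder_involution: "i \<in> I \<Longrightarrow> householder I a (householder I a x) i = x i"
  by (cases "ip I a a = 0") (simp_all add: householder_def[of I a "householder I a x"]
       ip_householder_right, simp_all add: householder_def field_simps)

text \<open>Also valid for \<open>x = y\<close>: then \<open>a = 0\<close> and the reflection is the identity, by \<open>t / 0 = 0\<close>.\<close>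

lemma householder_swap:
  assumes "finite I" "ip I x x = ip I y y" "i \<in> I"
  shows "householder I (\<lambda>i. x i - y i) x i = y i"
proof -
  let ?a = "\<lambda>i. x i - y i"
  have *: "ip I ?a ?a = 2 * ip I ?a x"
    using assms(2) by (simp add: ip_simps ip_commute)
  show ?thesis
  proof (cases "ip I ?a ?a = 0")
    case True
    then have "x i = y i" using assms(1,3) by (simp add: ip_self_eq_0)
    then show ?thesis using assms(3) by (simp add: householder_def)
  next
    case False
    then have "2 * ip I ?a x / ip I ?a ?a = 1" using * by simp
    then show ?thesis using assms(3) unfolding householder_def by simp
  qed
qed

lemma L2_householder [simp]: "L2_set (householder I a x) I = L2_set x I"
  by (simp add: L2_eq_sqrt_ip)

section \<open>Products of the standard normal measure\<close>

lemma sets_std_normal [measurable_cong, simp]: "sets std_normal = sets borel"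
  by (simp add: std_normal_def)

lemma space_std_normal [simp]: "space std_normal = UNIV"
  by (simp add: std_normal_def)

lemma prob_space_std_normal: "prob_space std_normal"
  unfolding std_normal_def by (rule prob_space_normal_density) simp

interpretation std_normal: prob_space std_normal
  by (rule prob_space_std_normal)

interpretation std_normals: product_sigma_finite "\<lambda>_. std_normal"
  by standard

lemma prob_space_gauss: "prob_space (gauss I)"
  unfolding gauss_def by (intro prob_space_PiM prob_space_std_normal)

lemma sets_gauss [measurable_cong]: "sets (gauss I) = sets (PiM I (\<lambda>_. borel))"
  unfolding gauss_def by (intro sets_PiM_cong) auto

lemma space_gauss: "space (gauss I) = extensional I"
  unfolding gauss_def by (simp add: space_PiM PiE_def)

section \<open>Lebesgue measure under reflections\<close>

interpretation lborels: product_sigma_finite "\<lambda>_. lborel :: real measure"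
  by standard

text \<open>Phrased with integrals and not with image measures: composition is then immediate, and
  Fubini's theorem applies one coordinate at a time.\<close>

definition leb_invariant :: "'i set \<Rightarrow> (('i \<Rightarrow> real) \<Rightarrow> ('i \<Rightarrow> real)) \<Rightarrow> bool" where
  "leb_invariant I T \<longleftrightarrow> T \<in> measurable (PiM I (\<lambda>_. lborel)) (PiM I (\<lambda>_. lborel)) \<and>
     (\<forall>F\<in>borel_measurable (PiM I (\<lambda>_. lborel)).
        (\<integral>\<^sup>+x. F (T x) \<partial>PiM I (\<lambda>_. lborel)) = (\<integral>\<^sup>+x. F x \<partial>PiM I (\<lambda>_. lborel)))"

lemma leb_invariant_comp:
  assumes "leb_invariant I T" "leb_invariant I S"
  shows "leb_invariant I (\<lambda>x. T (S x))"
proof -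
  have [measurable]: "T \<in> measurable (PiM I (\<lambda>_. lborel)) (PiM I (\<lambda>_. lborel))"
    "S \<in> measurable (PiM I (\<lambda>_. lborel)) (PiM I (\<lambda>_. lborel))"
    using assms by (auto simp: leb_invariant_def)
  show ?thesis
    unfolding leb_invariant_def
  proof safe
    fix F :: "('a \<Rightarrow> real) \<Rightarrow> ennreal"
    assume F [measurable]: "F \<in> borel_measurable (PiM I (\<lambda>_. lborel))"
    have "(\<integral>\<^sup>+x. F (T (S x)) \<partial>PiM I (\<lambda>_. lborel)) = (\<integral>\<^sup>+x. F (T x) \<partial>PiM I (\<lambda>_. lborel))"
      using assms(2) unfolding leb_invariant_def by (auto dest!: bspec[of _ _ "\<lambda>x. F (T x)"])
    also have "\<dots> = (\<integral>\<^sup>+x. F x \<partial>PiM I (\<lambda>_. lborel))"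
      using assms(1) F unfolding leb_invariant_def by auto
    finally show "(\<integral>\<^sup>+x. F (T (S x)) \<partial>PiM I (\<lambda>_. lborel)) = (\<integral>\<^sup>+x. F x \<partial>PiM I (\<lambda>_. lborel))" .
  qed measurable
qed

text \<open>Integrate over coordinate \<open>i\<close> first: with the others fixed,
  \<open>f\<close> is a constant by \<open>f_upd\<close>, and an affine map of the line with slope 1
  or -1 preserves length. Slope 1 gives the shears and slope -1 the sign change from which
  reflections are assembled.\<close>

lemma leb_invariant_update:
  assumes I: "finite I" "i \<in> I" and s: "\<bar>s\<bar> = 1"
    and f [measurable]: "f \<in> borel_measurable (PiM I (\<lambda>_. lborel))"
    and f_upd: "\<And>x y. f (x(i := y)) = f x"
  shows "leb_invariant I (\<lambda>x. x(i := s * x i + f x))"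
  unfolding leb_invariant_def
proof safe
  let ?L = "PiM I (\<lambda>_. lborel :: real measure)"
  have "(\<lambda>x. x(i := s * x i + f x)) \<in> measurable (PiM I (\<lambda>_. borel)) (PiM I (\<lambda>_. borel))"
  proof (rule measurable_PiM_single')
    fix j assume "j \<in> I"
    then show "(\<lambda>x. (x(i := s * x i + f x)) j) \<in> borel_measurable (PiM I (\<lambda>_. borel))"
      using I by (cases "j = i") auto
  qed (use I in \<open>auto simp: space_PiM PiE_def extensional_def\<close>)
  moreover have eq: "sets ?L = sets (PiM I (\<lambda>_. borel))" by (intro sets_PiM_cong) auto
  ultimately show m [measurable]: "(\<lambda>x. x(i := s * x i + f x)) \<in> measurable ?L ?L"
    by (simp only: measurable_cong_sets[OF eq eq])
  fix F :: "('a \<Rightarrow> real) \<Rightarrow> ennreal"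
  assume F [measurable]: "F \<in> borel_measurable ?L"
  have ins: "insert i (I - {i}) = I" using I by auto
  have fin: "finite (I - {i})" "i \<notin> I - {i}" using I by auto
  have s0: "s \<noteq> 0" using s by auto
  have "(\<integral>\<^sup>+x. F (x(i := s * x i + f x)) \<partial>?L) =
     (\<integral>\<^sup>+x. (\<integral>\<^sup>+y. F (x(i := s * y + f (x(i := y)))) \<partial>lborel) \<partial>PiM (I - {i}) (\<lambda>_. lborel))"
    using lborels.product_nn_integral_insert[OF fin, of "\<lambda>x. F (x(i := s * x i + f x))"]
    by (simp add: insert_absorb I(2))
  also have "\<dots> = (\<integral>\<^sup>+x. (\<integral>\<^sup>+y. F (x(i := y)) \<partial>lborel) \<partial>PiM (I - {i}) (\<lambda>_. lborel))"
  proof (rule nn_integral_cong)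
    fix x :: "'a \<Rightarrow> real" assume x: "x \<in> space (PiM (I - {i}) (\<lambda>_. lborel :: real measure))"
    have "(\<lambda>y. x(i := y)) \<in> measurable lborel (PiM (insert i (I - {i})) (\<lambda>_. lborel))"
      using measurable_component_update[OF x fin(2)] by simp
    then have [measurable]: "(\<lambda>y. x(i := y)) \<in> measurable lborel ?L"
      by (simp only: ins)
    have [measurable]: "(\<lambda>y. F (x(i := y))) \<in> borel_measurable borel"
      by simp
    show "(\<integral>\<^sup>+y. F (x(i := s * y + f (x(i := y)))) \<partial>lborel) = (\<integral>\<^sup>+y. F (x(i := y)) \<partial>lborel)"
      by (subst nn_integral_real_affine[of "\<lambda>y. F (x(i := y))" s "f x"])
         (simp_all add: f_upd s s0 add.commute)
  qed
  also have "\<dots> = (\<integral>\<^sup>+x. F x \<partial>?L)"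
    using lborels.product_nn_integral_insert[OF fin, of F] by (simp add: insert_absorb I(2))
  finally show "(\<integral>\<^sup>+x. F (x(i := s * x i + f x)) \<partial>?L) = (\<integral>\<^sup>+x. F x \<partial>?L)" .
qed

lemma leb_invariant_column_shear:
  assumes I: "finite I" "i \<in> I" and J: "J \<subseteq> I - {i}"
  shows "leb_invariant I (\<lambda>x j. if j \<in> J then x j + b j * x i else x j)"
proof -
  have "finite J" using J I finite_subset by blast
  then show ?thesis using J
  proof (induction J rule: finite_induct)
    case empty
    then show ?case by (simp add: leb_invariant_def)
  next
    case (insert k J)
    have "leb_invariant I (\<lambda>x. x(k := 1 * x k + b k * x i))"
      using I insert by (intro leb_invariant_update) auto
    from leb_invariant_comp[OF this insert.IH] insert.prems
    have "leb_invariant I (\<lambda>x. (\<lambda>j. if j \<in> J then x j + b j * x i else x j)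
      (k := 1 * (if k \<in> J then x k + b k * x i else x k) + b k * (if i \<in> J then x i + b i * x i else x i)))"
      by auto
    also have "(\<lambda>x. (\<lambda>j. if j \<in> J then x j + b j * x i else x j)
      (k := 1 * (if k \<in> J then x k + b k * x i else x k) + b k * (if i \<in> J then x i + b i * x i else x i)))
      = (\<lambda>x j. if j \<in> insert k J then x j + b j * x i else x j)"
      using insert.prems insert.hyps by (auto simp: fun_eq_iff)
    finally show ?case .
  qed
qed

lemma measurable_ip [measurable]:
  assumes "\<And>i. i \<in> I \<Longrightarrow> (\<lambda>w. f w i) \<in> borel_measurable M" "\<And>i. i \<in> I \<Longrightarrow> (\<lambda>w. g w i) \<in> borel_measurable M"
  shows "(\<lambda>w. ip I (f w) (g w)) \<in> borel_measurable M"
  unfolding ip_def using assms by measurable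

lemma measurable_householder:
  assumes "\<And>i. i \<in> I \<Longrightarrow> (\<lambda>w. f w i) \<in> borel_measurable M" "\<And>i. i \<in> I \<Longrightarrow> (\<lambda>w. g w i) \<in> borel_measurable M"
  shows "(\<lambda>w. householder I (f w) (g w)) \<in> measurable M (PiM I (\<lambda>_. borel))"
proof -
  note [measurable] = assms
  show ?thesis unfolding householder_def by (rule measurable_restrict) measurable
qed

text \<open>The reflection along \<open>a\<close> is conjugate to the sign change of a coordinate \<open>i\<close> with \<open>a i \<noteq> 0\<close>,
  by shears that map \<open>e\<^sub>i\<close> to the line of \<open>a\<close> and the hyperplane \<open>x i = 0\<close> to that orthogonal to \<open>a\<close>.\<close>

lemma householder_leb_invariant:
  assumes I: "finite I"
  shows "leb_invariant I (\<lambda>x. if x \<in> extensional I then householder I a x else x)"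
proof (cases "\<exists>i\<in>I. a i \<noteq> 0")
  case False
  have "householder I a x = x" if "x \<in> extensional I" for x
    using False that by (auto simp: householder_def restrict_def extensional_def fun_eq_iff)
  then have "(\<lambda>x. if x \<in> extensional I then householder I a x else x) = (\<lambda>x. x)" by auto
  then show ?thesis by (simp add: leb_invariant_def)
next
  case True
  then obtain i where i: "i \<in> I" "a i \<noteq> 0" by auto
  define K where "K = I - {i}"
  define n where "n = ip I a a"
  have n: "n \<noteq> 0" unfolding n_def using i I by (simp add: ip_self_eq_0) blast
  \<comment> \<open>\<open>C (-1)\<close> sends \<open>a\<close> to a multiple of the unit vector at
    \<open>i\<close>, \<open>R\<close> shears coordinate \<open>i\<close> by the others, and
    \<open>F\<close> flips its sign. \<open>C 1\<close> inverts \<open>C (-1)\<close> and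
    \<open>R (-1)\<close> inverts \<open>R 1\<close>, so the composite below is a conjugate of
    \<open>F\<close>.\<close>
  define C where "C c x = (\<lambda>j. if j \<in> K then x j + c * (a j / a i) * x i else x j)" for c x
  define R where "R c x = x(i := 1 * x i + c * (a i / n) * (\<Sum>j\<in>K. a j * x j))" for c x
  define F where "F x = x(i := -1 * x i + (0::real))" for x :: "'a \<Rightarrow> real"
  have C: "leb_invariant I (C c)" for c
    using leb_invariant_column_shear[of I i K "\<lambda>j. c * (a j / a i)"] I i by (simp add: C_def[abs_def] K_def)
  have R: "leb_invariant I (R c)" for c
  proof -
    define f where "f x = c * (a i / n) * (\<Sum>j\<in>K. a j * x j)" for x
    have "(\<lambda>x. x j) \<in> borel_measurable (PiM I (\<lambda>_. lborel :: real measure))" if "j \<in> K" for j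
    proof -
      have "j \<in> I" using that by (simp add: K_def)
      then show ?thesis by measurable
    qed
    then have "(\<lambda>x. ip K a x) \<in> borel_measurable (PiM I (\<lambda>_. lborel))"
      by (intro measurable_ip) simp_all
    then have fm: "f \<in> borel_measurable (PiM I (\<lambda>_. lborel))"
      unfolding f_def ip_def by (rule borel_measurable_times[OF borel_measurable_const])
    have fu: "f (x(i := y)) = f x" for x y
      by (simp add: f_def K_def)
    have "leb_invariant I (\<lambda>x. x(i := 1 * x i + f x))"
      by (rule leb_invariant_update[OF I i(1) _ fm fu]) simp
    then show ?thesis unfolding R_def[abs_def] f_def .
  qed
  have F: "leb_invariant I F"
    unfolding F_def[abs_def] by (rule leb_invariant_update[OF I i(1)]) simp_all
  have "leb_invariant I (\<lambda>x. C 1 (R (-1) (F (R 1 (C (-1) x)))))"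
    by (intro leb_invariant_comp[OF C] leb_invariant_comp[OF R] leb_invariant_comp[OF F] C)
  moreover have "C 1 (R (-1) (F (R 1 (C (-1) x)))) = householder I a x" if x: "x \<in> extensional I" for x
  proof
    fix j
    have sumK: "(\<Sum>j\<in>K. a j * f j) = ip I a f - a i * f i" for f
      unfolding K_def ip_def using I i by (subst sum_diff1) auto
    have "(\<Sum>j\<in>K. a j * C (-1) x j) = (\<Sum>j\<in>K. a j * (x j - a j / a i * x i))"
      by (rule sum.cong) (auto simp: C_def)
    also have "\<dots> = (\<Sum>j\<in>K. a j * x j) - x i / a i * (\<Sum>j\<in>K. a j * a j)"
      by (simp add: algebra_simps sum_subtractf sum_distrib_left)
    also have "\<dots> = ip I a x - n * x i / a i"
      unfolding sumK n_def using i by (simp add: field_simps)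
    finally have s: "(\<Sum>j\<in>K. a j * C (-1) x j) = ip I a x - n * x i / a i" .
    have iK: "i \<notin> K" by (simp add: K_def)
    have Ci: "C (-1) x i = x i" using iK by (simp add: C_def)
    \<comment> \<open>Coordinate \<open>i\<close> now is that of the orthogonal projection of
      \<open>x\<close> to the line of \<open>a\<close>, the part of \<open>x\<close> that the
      reflection negates.\<close>
    have R1: "R 1 (C (-1) x) = (C (-1) x)(i := a i * ip I a x / n)"
      unfolding R_def s Ci using i n by (simp add: field_simps)
    have F1: "F (R 1 (C (-1) x)) = (C (-1) x)(i := - (a i * ip I a x / n))"
      unfolding R1 F_def by simp
    have s': "(\<Sum>j\<in>K. a j * ((C (-1) x)(i := y)) j) = ip I a x - n * x i / a i" for y
      unfolding s[symmetric] by (rule sum.cong) (use iK in auto)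
    have R2: "R (-1) (F (R 1 (C (-1) x))) = (C (-1) x)(i := x i - 2 * a i * ip I a x / n)"
    proof -
      have e: "1 * (- (a i * ip I a x / n)) + (-1) * (a i / n) * (ip I a x - n * x i / a i) =
        x i - 2 * a i * ip I a x / n"
        using i n by (simp add: right_diff_distrib)
      show ?thesis
        unfolding F1 by (subst R_def, subst s', subst fun_upd_same, subst e) simp
    qed
    show "C 1 (R (-1) (F (R 1 (C (-1) x)))) j = householder I a x j"
      unfolding R2 using i n x iK
      by (auto simp: C_def K_def householder_def n_def[symmetric] extensional_def field_simps)
  qed
  ultimately have inv: "leb_invariant I (\<lambda>x. C 1 (R (-1) (F (R 1 (C (-1) x)))))"
    and eq: "\<And>x. x \<in> extensional I \<Longrightarrow> C 1 (R (-1) (F (R 1 (C (-1) x)))) = householder I a x" by auto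
  let ?L = "PiM I (\<lambda>_. lborel :: real measure)"
  have sp: "space ?L = extensional I" by (simp add: space_PiM PiE_def)
  show ?thesis
    unfolding leb_invariant_def
  proof (intro conjI ballI)
    show "(\<lambda>x. if x \<in> extensional I then householder I a x else x) \<in> measurable ?L ?L"
      using inv unfolding leb_invariant_def
      by (subst measurable_cong[where g="\<lambda>x. C 1 (R (-1) (F (R 1 (C (-1) x))))"]) (auto simp: sp eq)
    fix G :: "('a \<Rightarrow> real) \<Rightarrow> ennreal" assume "G \<in> borel_measurable ?L"
    then have "(\<integral>\<^sup>+x. G (C 1 (R (-1) (F (R 1 (C (-1) x))))) \<partial>?L) = (\<integral>\<^sup>+x. G x \<partial>?L)"
      using inv unfolding leb_invariant_def by auto
    then show "(\<integral>\<^sup>+x. G (if x \<in> extensional I then householder I a x else x) \<partial>?L) = (\<integral>\<^sup>+x. G x \<partial>?L)"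
      by (subst nn_integral_cong[where v="\<lambda>x. G (C 1 (R (-1) (F (R 1 (C (-1) x)))))"]) (auto simp: sp eq)
  qed
qed

lemma gauss_eq_density:
  assumes "finite I"
  shows "gauss I = density (PiM I (\<lambda>_. lborel)) (\<lambda>x. (\<Prod>i\<in>I. ennreal (std_normal_density (x i))))"
  unfolding gauss_def
proof (rule std_normals.PiM_eqI[symmetric])
  show "finite I" by fact
  show "sets (density (PiM I (\<lambda>_. lborel)) (\<lambda>x. \<Prod>i\<in>I. ennreal (std_normal_density (x i)))) =
    sets (PiM I (\<lambda>_. std_normal))"
    by (simp add: sets_PiM_cong[of I I "\<lambda>_. lborel :: real measure" "\<lambda>_. std_normal"])
  fix A assume A: "\<And>i. i \<in> I \<Longrightarrow> A i \<in> sets std_normal"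
  then have A' [measurable]: "\<And>i. i \<in> I \<Longrightarrow> A i \<in> sets borel" by simp
  let ?L = "PiM I (\<lambda>_. lborel :: real measure)"
  have S: "PiE I A \<in> sets ?L" by (rule sets_PiM_I_finite) (use assms A' in auto)
  have "emeasure (density ?L (\<lambda>x. \<Prod>i\<in>I. ennreal (std_normal_density (x i)))) (PiE I A) =
    (\<integral>\<^sup>+x. (\<Prod>i\<in>I. ennreal (std_normal_density (x i))) * indicator (PiE I A) x \<partial>?L)"
    by (rule emeasure_density) (use S in auto)
  also have "\<dots> = (\<integral>\<^sup>+x. (\<Prod>i\<in>I. ennreal (std_normal_density (x i)) * indicator (A i) (x i)) \<partial>?L)"
  proof (rule nn_integral_cong)
    fix x :: "'a \<Rightarrow> real" assume "x \<in> space ?L"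
    then have "(indicator (PiE I A) x :: ennreal) = (\<Prod>i\<in>I. indicator (A i) (x i))"
      using assms by (auto simp: indicator_def space_PiM PiE_def Pi_def extensional_def prod_zero_iff)
    then show "(\<Prod>i\<in>I. ennreal (std_normal_density (x i))) * indicator (PiE I A) x =
      (\<Prod>i\<in>I. ennreal (std_normal_density (x i)) * indicator (A i) (x i))"
      by (simp add: prod.distrib)
  qed
  also have "\<dots> = (\<Prod>i\<in>I. \<integral>\<^sup>+x. ennreal (std_normal_density x) * indicator (A i) x \<partial>lborel)"
    by (rule lborels.product_nn_integral_prod) (use assms in auto)
  also have "\<dots> = (\<Prod>i\<in>I. emeasure std_normal (A i))"
    by (rule prod.cong) (auto simp: std_normal_def emeasure_density)
  finally show "emeasure (density ?L (\<lambda>x. \<Prod>i\<in>I. ennreal (std_normal_density (x i)))) (PiE I A) =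
    (\<Prod>i\<in>I. emeasure std_normal (A i))" .
qed

text \<open>The joint density depends on \<open>x\<close> only through \<open>ip I x x\<close>,
  which reflections preserve; with the invariance of Lebesgue measure this gives that of
  \<open>gauss I\<close>.\<close>

lemma prod_std_normal_density:
  assumes "finite I"
  shows "(\<Prod>i\<in>I. ennreal (std_normal_density (x i))) =
    ennreal ((1 / sqrt (2 * pi)) ^ card I * exp (- ip I x x / 2))"
proof -
  have "(\<Prod>i\<in>I. std_normal_density (x i)) = (1 / sqrt (2 * pi)) ^ card I * (\<Prod>i\<in>I. exp (- (x i)\<^sup>2 / 2))"
    unfolding std_normal_density_def prod.distrib by simp
  also have "(\<Prod>i\<in>I. exp (- (x i)\<^sup>2 / 2)) = exp (- ip I x x / 2)"
    by (simp add: exp_sum[OF assms, symmetric] ip_def sum_negf sum_divide_distrib power2_eq_square)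
  finally show ?thesis by (simp add: prod_ennreal)
qed

definition gauss_invariant :: "'i set \<Rightarrow> (('i \<Rightarrow> real) \<Rightarrow> ('i \<Rightarrow> real)) \<Rightarrow> bool" where
  "gauss_invariant I T \<longleftrightarrow> T \<in> measurable (gauss I) (gauss I) \<and> distr (gauss I) (gauss I) T = gauss I"

lemma gauss_invariant_comp:
  assumes "gauss_invariant I T" "gauss_invariant I S"
  shows "gauss_invariant I (\<lambda>x. T (S x))"
proof -
  have [measurable]: "T \<in> measurable (gauss I) (gauss I)" "S \<in> measurable (gauss I) (gauss I)"
    using assms by (auto simp: gauss_invariant_def)
  have "distr (gauss I) (gauss I) (\<lambda>x. T (S x)) = distr (distr (gauss I) (gauss I) S) (gauss I) T"
    by (simp add: distr_distr comp_def)
  then show ?thesis using assms by (simp add: gauss_invariant_def)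
qed

lemma gauss_invariant_cong:
  assumes "gauss_invariant I T" "\<And>x. x \<in> extensional I \<Longrightarrow> T x = S x"
  shows "gauss_invariant I S"
proof -
  have "S \<in> measurable (gauss I) (gauss I) \<longleftrightarrow> T \<in> measurable (gauss I) (gauss I)"
    by (rule measurable_cong) (use assms in \<open>auto simp: space_gauss\<close>)
  moreover have "distr (gauss I) (gauss I) S = distr (gauss I) (gauss I) T"
    by (rule distr_cong) (use assms in \<open>auto simp: space_gauss\<close>)
  ultimately show ?thesis using assms(1) by (simp add: gauss_invariant_def)
qed

lemma gauss_invariant_nn_integral:
  assumes "gauss_invariant I T" and [measurable]: "F \<in> borel_measurable (gauss I)"
  shows "(\<integral>\<^sup>+x. F (T x) \<partial>gauss I) = (\<integral>\<^sup>+x. F x \<partial>gauss I)"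
proof -
  have [measurable]: "T \<in> measurable (gauss I) (gauss I)" using assms by (auto simp: gauss_invariant_def)
  have "(\<integral>\<^sup>+x. F (T x) \<partial>gauss I) = (\<integral>\<^sup>+x. F x \<partial>distr (gauss I) (gauss I) T)"
    by (simp add: nn_integral_distr)
  then show ?thesis using assms by (simp add: gauss_invariant_def)
qed

lemma gauss_invariant_emeasure:
  assumes "gauss_invariant I T" "A \<in> sets (gauss I)"
  shows "emeasure (gauss I) {x \<in> space (gauss I). T x \<in> A} = emeasure (gauss I) A"
proof -
  have [measurable]: "T \<in> measurable (gauss I) (gauss I)" using assms by (auto simp: gauss_invariant_def)
  have "emeasure (distr (gauss I) (gauss I) T) A = emeasure (gauss I) (T -` A \<inter> space (gauss I))"
    by (rule emeasure_distr) (use assms in auto)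
  moreover have "T -` A \<inter> space (gauss I) = {x \<in> space (gauss I). T x \<in> A}" by auto
  ultimately show ?thesis using assms(1) by (simp add: gauss_invariant_def)
qed

lemma householder_gauss_invariant:
  assumes I: "finite I"
  shows "gauss_invariant I (householder I a)"
proof -
  let ?L = "PiM I (\<lambda>_. lborel :: real measure)"
  define T where "T x = (if x \<in> extensional I then householder I a x else x)" for x
  have inv: "leb_invariant I T" unfolding T_def by (rule householder_leb_invariant[OF I])
  have sp: "space ?L = extensional I" by (simp add: space_PiM PiE_def)
  have sg: "sets (gauss I) = sets ?L" unfolding gauss_def by (intro sets_PiM_cong) auto
  have T: "T \<in> measurable ?L ?L" using inv by (simp add: leb_invariant_def)
  have T' [measurable]: "T \<in> measurable (gauss I) (gauss I)"
    using T by (simp add: measurable_cong_sets[OF sg sg])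
  let ?d = "\<lambda>x. (\<Prod>i\<in>I. ennreal (std_normal_density (x i)))"
  have dT: "?d (T x) = ?d x" for x
    by (simp only: prod_std_normal_density[OF I]) (simp add: T_def)
  have "distr (gauss I) (gauss I) T = gauss I"
  proof (rule measure_eqI)
    fix A assume "A \<in> sets (distr (gauss I) (gauss I) T)"
    then have A: "A \<in> sets (gauss I)" "A \<in> sets ?L" by (auto simp: sg)
    have TA: "T -` A \<inter> space (gauss I) \<in> sets ?L"
      using measurable_sets[OF T' A(1)] by (simp add: sg)
    have "emeasure (distr (gauss I) (gauss I) T) A = emeasure (gauss I) (T -` A \<inter> space (gauss I))"
      by (rule emeasure_distr) (use A in auto)
    also have "\<dots> = (\<integral>\<^sup>+x. ?d x * indicator (T -` A \<inter> space (gauss I)) x \<partial>?L)"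
      by (subst gauss_eq_density[OF I], rule emeasure_density) (use TA in auto)
    also have "\<dots> = (\<integral>\<^sup>+x. ?d (T x) * indicator A (T x) \<partial>?L)"
      by (rule nn_integral_cong) (simp only: dT, auto simp: indicator_def space_gauss sp)
    also have "\<dots> = (\<integral>\<^sup>+x. ?d x * indicator A x \<partial>?L)"
    proof -
      have "(\<lambda>x. ?d x * indicator A x) \<in> borel_measurable ?L" using A by measurable
      then show ?thesis using inv[unfolded leb_invariant_def, THEN conjunct2, rule_format,
          of "\<lambda>x. ?d x * indicator A x"] by simp
    qed
    also have "\<dots> = emeasure (gauss I) A"
      by (subst gauss_eq_density[OF I], rule emeasure_density[symmetric]) (use A in auto)
    finally show "emeasure (distr (gauss I) (gauss I) T) A = emeasure (gauss I) A" .
  qed simp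
  then have "gauss_invariant I T" by (simp add: gauss_invariant_def)
  then show ?thesis by (rule gauss_invariant_cong) (simp add: T_def)
qed

lemma gauss_invariant_id: "gauss_invariant I (\<lambda>x. x)"
  by (simp add: gauss_invariant_def distr_id)

text \<open>Reflects every fibre of \<open>P \<cong> I \<times> K\<close>; a composition of commuting reflections of \<open>\<real>\<^sup>P\<close>, one for each
  fibre. The two instances used are multiplication of a matrix by a reflection from the left and
  from the right.\<close>

lemma fibrewise_householder_gauss_invariant:
  assumes fin: "finite I" "finite K"
    and pr: "\<And>i k. i \<in> I \<Longrightarrow> k \<in> K \<Longrightarrow> pr i k \<in> P \<and> fi (pr i k) = i \<and> fk (pr i k) = k"
    and P: "\<And>p. p \<in> P \<Longrightarrow> fi p \<in> I \<and> fk p \<in> K \<and> pr (fi p) (fk p) = p"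
  shows "gauss_invariant P (\<lambda>B. \<lambda>p\<in>P. householder I a (\<lambda>i. B (pr i (fk p))) (fi p))"
proof -
  have "P = (\<lambda>(i, k). pr i k) ` (I \<times> K)"
    using pr P by (auto simp: image_iff) (metis)
  then have finP: "finite P" using fin by simp
  define T where "T J B = (\<lambda>p\<in>P. if fk p \<in> J then householder I a (\<lambda>i. B (pr i (fk p))) (fi p) else B p)"
    for J and B :: "'c \<Rightarrow> real"
  have "gauss_invariant P (T J)" if "J \<subseteq> K" for J
  proof -
    have "finite J" using that fin finite_subset by blast
    then show ?thesis using that
    proof (induction J rule: finite_induct)
      case empty
      show ?case
        by (rule gauss_invariant_cong[OF gauss_invariant_id])
           (auto simp: T_def extensional_def fun_eq_iff restrict_def)
    next
      case (insert k J)
      \<comment> \<open>The axis \<open>a\<close> placed in the fibre over \<open>k\<close> and zero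
        elsewhere: reflecting all of \<open>P\<close> along it acts on this fibre only.\<close>
      define e where "e p = (if fk p = k then a (fi p) else 0)" for p
      have sum_e: "(\<Sum>p\<in>P. e p * f p) = (\<Sum>i\<in>I. a i * f (pr i k))" for f
      proof -
        have "(\<Sum>p\<in>P. e p * f p) = (\<Sum>p\<in>(\<lambda>i. pr i k) ` I. e p * f p)"
        proof (rule sum.mono_neutral_right[OF finP])
          show "(\<lambda>i. pr i k) ` I \<subseteq> P" using pr insert.prems by auto
          have "p \<in> (\<lambda>i. pr i k) ` I" if "p \<in> P" "fk p = k" for p
            using P[OF that(1)] that(2) by (metis image_eqI)
          then show "\<forall>p\<in>P - (\<lambda>i. pr i k) ` I. e p * f p = 0" by (auto simp: e_def)
        qed
        also have "\<dots> = (\<Sum>i\<in>I. e (pr i k) * f (pr i k))"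
          by (rule sum.reindex_cong[of "\<lambda>i. pr i k"])
             (use pr insert.prems in \<open>auto simp: inj_on_def dest!: arg_cong[where f=fi]\<close>)
        also have "\<dots> = (\<Sum>i\<in>I. a i * f (pr i k))"
          by (rule sum.cong) (use pr insert.prems in \<open>auto simp: e_def\<close>)
        finally show ?thesis .
      qed
      have ee: "ip P e e = ip I a a"
        unfolding ip_def sum_e by (rule sum.cong) (use pr insert.prems in \<open>auto simp: e_def\<close>)
      have "gauss_invariant P (\<lambda>B. householder P e (T J B))"
        by (intro gauss_invariant_comp[OF householder_gauss_invariant insert.IH] finP)
           (use insert.prems in auto)
      then show ?case
      proof (rule gauss_invariant_cong)
        fix B :: "'c \<Rightarrow> real" assume "B \<in> extensional P"
        have eT: "ip P e (T J B) = ip I a (\<lambda>i. B (pr i k))"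
          unfolding ip_def sum_e
          by (rule sum.cong) (use pr insert in \<open>auto simp: T_def\<close>)
        show "householder P e (T J B) = T (insert k J) B"
        proof
          fix p
          show "householder P e (T J B) p = T (insert k J) B p"
          proof (cases "p \<in> P \<and> fk p = k")
            case False
            then show ?thesis by (auto simp: householder_def T_def e_def)
          next
            case True
            have "T J B p = B p" using True insert.hyps by (simp add: T_def)
            moreover have "fi p \<in> I" "pr (fi p) k = p" using P[of p] True by auto
            ultimately show ?thesis
              using True unfolding householder_def[of P] eT ee
              by (simp add: T_def e_def householder_def)
          qed
        qed
      qed
    qed
  qed
  from this[of K] show ?thesis
    by (rule gauss_invariant_cong) (use P in \<open>auto simp: T_def restrict_def fun_eq_iff\<close>)
qed

section \<open>Row and column reflections of a Gaussian matrix\<close>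

definition refl_left :: "'i set \<Rightarrow> 'j set \<Rightarrow> ('i \<Rightarrow> real) \<Rightarrow> ('i \<times> 'j \<Rightarrow> real) \<Rightarrow> ('i \<times> 'j \<Rightarrow> real)" where
  "refl_left I J a B = (\<lambda>p\<in>I \<times> J. householder I a (\<lambda>i. B (i, snd p)) (fst p))"

definition refl_right :: "'i set \<Rightarrow> 'j set \<Rightarrow> ('j \<Rightarrow> real) \<Rightarrow> ('i \<times> 'j \<Rightarrow> real) \<Rightarrow> ('i \<times> 'j \<Rightarrow> real)" where
  "refl_right I J b B = (\<lambda>p\<in>I \<times> J. householder J b (\<lambda>j. B (fst p, j)) (snd p))"

lemma refl_left_gauss_invariant:
  "finite I \<Longrightarrow> finite J \<Longrightarrow> gauss_invariant (I \<times> J) (refl_left I J a)"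
  using fibrewise_householder_gauss_invariant[of I J Pair "I \<times> J" fst snd a]
  by (auto simp: refl_left_def[abs_def])

lemma refl_right_gauss_invariant:
  "finite I \<Longrightarrow> finite J \<Longrightarrow> gauss_invariant (I \<times> J) (refl_right I J b)"
  using fibrewise_householder_gauss_invariant[of J I "\<lambda>j i. (i, j)" "I \<times> J" snd fst b]
  by (auto simp: refl_right_def[abs_def])

definition bil :: "'i set \<Rightarrow> 'j set \<Rightarrow> ('i \<times> 'j \<Rightarrow> real) \<Rightarrow> ('i \<Rightarrow> real) \<Rightarrow> ('j \<Rightarrow> real) \<Rightarrow> real" where
  "bil I J B x y = ip I x (\<lambda>i. ip J (\<lambda>j. B (i, j)) y)"

lemma bil_alt: "bil I J B x y = ip J (\<lambda>j. ip I x (\<lambda>i. B (i, j))) y"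
  unfolding bil_def ip_def by (simp add: sum_distrib_left sum_distrib_right mult.assoc) (rule sum.swap)

lemma bil_refl_left: "bil I J (refl_left I J a B) x y = bil I J B (householder I a x) y"
  unfolding bil_alt
proof (rule ip_cong)
  fix j assume j: "j \<in> J"
  have "ip I x (\<lambda>i. refl_left I J a B (i, j)) = ip I x (householder I a (\<lambda>i. B (i, j)))"
    by (rule ip_cong) (use j in \<open>auto simp: refl_left_def\<close>)
  then show "ip I x (\<lambda>i. refl_left I J a B (i, j)) = ip I (householder I a x) (\<lambda>i. B (i, j))"
    by (simp add: ip_householder_sym)
qed simp

lemma bil_refl_right: "bil I J (refl_right I J b B) x y = bil I J B x (householder J b y)"
  unfolding bil_def
proof (rule ip_cong)
  fix i assume i: "i \<in> I"
  have "ip J (\<lambda>j. refl_right I J b B (i, j)) y = ip J (householder J b (\<lambda>j. B (i, j))) y"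
    by (rule ip_cong) (use i in \<open>auto simp: refl_right_def\<close>)
  then show "ip J (\<lambda>j. refl_right I J b B (i, j)) y = ip J (\<lambda>j. B (i, j)) (householder J b y)"
    by (simp add: ip_householder_sym)
qed simp

section \<open>Subfamilies of Gaussian coordinates\<close>

lemma gauss_reindex:
  assumes "inj_on f I" "f ` I \<subseteq> K"
  shows "distr (gauss K) (gauss I) (\<lambda>\<omega>. \<lambda>i\<in>I. \<omega> (f i)) = gauss I"
  using distr_PiM_reindex[of K "\<lambda>_. std_normal" f I] assms prob_space_std_normal
  unfolding gauss_def by auto

lemma measurable_gauss_reindex:
  assumes "f ` I \<subseteq> K"
  shows "(\<lambda>\<omega>. \<lambda>i\<in>I. \<omega> (f i)) \<in> measurable (gauss K) (gauss I)"
  unfolding gauss_def by (rule measurable_restrict) (use assms in auto)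

lemma emeasure_gauss_reindex:
  assumes "inj_on f I" "f ` I \<subseteq> K" "A \<in> sets (gauss I)"
  shows "emeasure (gauss K) {\<omega> \<in> space (gauss K). (\<lambda>i\<in>I. \<omega> (f i)) \<in> A} = emeasure (gauss I) A"
proof -
  have "emeasure (distr (gauss K) (gauss I) (\<lambda>\<omega>. \<lambda>i\<in>I. \<omega> (f i))) A
    = emeasure (gauss K) ((\<lambda>\<omega>. \<lambda>i\<in>I. \<omega> (f i)) -` A \<inter> space (gauss K))"
    by (rule emeasure_distr[OF measurable_gauss_reindex[OF assms(2)] assms(3)])
  then show ?thesis
    unfolding gauss_reindex[OF assms(1,2)] by (simp add: vimage_def Int_def conj_commute)
qed

section \<open>Chi-square tails\<close>

lemma std_normal_mgf_square:
  assumes "\<theta> < 1/2"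
  shows "(\<integral>\<^sup>+x. ennreal (exp (\<theta> * x\<^sup>2)) \<partial>std_normal) = ennreal (1 / sqrt (1 - 2 * \<theta>))"
proof -
  \<comment> \<open>\<theta> x^2 - x^2 / 2 is the exponent of the centred normal density with this
    standard deviation.\<close>
  define \<sigma> where "\<sigma> = 1 / sqrt (1 - 2 * \<theta>)"
  have s: "\<sigma> > 0" using assms by (simp add: \<sigma>_def)
  have s2: "\<sigma>\<^sup>2 = 1 / (1 - 2 * \<theta>)" using assms by (simp add: \<sigma>_def power_divide)
  have eq: "std_normal_density x * exp (\<theta> * x\<^sup>2) = \<sigma> * normal_density 0 \<sigma> x" for x
  proof -
    have "exp (- x\<^sup>2 / 2) * exp (\<theta> * x\<^sup>2) = exp (- (x - 0)\<^sup>2 / (2 * \<sigma>\<^sup>2))"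
      unfolding s2 exp_add[symmetric] by (simp add: field_simps)
    moreover have "sqrt (2 * pi * \<sigma>\<^sup>2) = sqrt (2 * pi) * \<sigma>"
      using s by (simp add: real_sqrt_mult)
    ultimately show ?thesis
      using s by (simp add: std_normal_density_def normal_density_def)
  qed
  interpret N: prob_space "density lborel (normal_density 0 \<sigma>)"
    using s by (rule prob_space_normal_density)
  have one: "(\<integral>\<^sup>+x. ennreal (normal_density 0 \<sigma> x) \<partial>lborel) = 1"
    using N.emeasure_space_1 by (simp add: emeasure_density)
  have "(\<integral>\<^sup>+x. ennreal (exp (\<theta> * x\<^sup>2)) \<partial>std_normal) =
    (\<integral>\<^sup>+x. ennreal \<sigma> * ennreal (normal_density 0 \<sigma> x) \<partial>lborel)"
    unfolding std_normal_def using s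
    by (subst nn_integral_density) (auto simp: ennreal_mult'[symmetric] eq)
  also have "\<dots> = ennreal \<sigma>" by (subst nn_integral_cmult) (auto simp: one)
  finally show ?thesis by (simp add: \<sigma>_def)
qed

text \<open>Half of the bound ln (1 - t) \<ge> - t - 2 t^2 at t = 2 \<theta>. The linear term is
  exact, so it cancels against the mean in the Chernoff bound.\<close>

lemma inverse_sqrt_le_exp:
  fixes \<theta> :: real
  assumes "\<bar>\<theta>\<bar> \<le> 1/8"
  shows "1 / sqrt (1 - 2 * \<theta>) \<le> exp (\<theta> + 4 * \<theta>\<^sup>2)"
proof -
  have "- 2 * \<theta> - 8 * \<theta>\<^sup>2 \<le> ln (1 - 2 * \<theta>)"
  proof (cases "\<theta> \<ge> 0")
    case True
    then show ?thesis
      using ln_one_minus_pos_lower_bound[of "2 * \<theta>"] assms by (simp add: power_mult_distrib)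
  next
    case False
    then have "- 2 * \<theta> - (- 2 * \<theta>)\<^sup>2 \<le> ln (1 + (- 2 * \<theta>))"
      using assms by (intro ln_one_plus_pos_lower_bound) auto
    then have "- 2 * \<theta> - 4 * \<theta>\<^sup>2 \<le> ln (1 - 2 * \<theta>)"
      by (simp add: power_mult_distrib)
    then show ?thesis using zero_le_power2[of \<theta>] by linarith
  qed
  moreover have "1 - 2 * \<theta> > 0" using assms by linarith
  ultimately have "exp (- 2 * \<theta> - 8 * \<theta>\<^sup>2) \<le> 1 - 2 * \<theta>"
    by (simp only: ln_ge_iff)
  moreover have "exp (- 2 * \<theta> - 8 * \<theta>\<^sup>2) = (exp (- \<theta> - 4 * \<theta>\<^sup>2))\<^sup>2"
    by (simp add: power2_eq_square exp_add[symmetric])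
  ultimately have "exp (- \<theta> - 4 * \<theta>\<^sup>2) \<le> sqrt (1 - 2 * \<theta>)"
    by (intro real_le_rsqrt) simp
  moreover have "sqrt (1 - 2 * \<theta>) > 0" using \<open>1 - 2 * \<theta> > 0\<close> by simp
  moreover have "exp (- \<theta> - 4 * \<theta>\<^sup>2) * exp (\<theta> + 4 * \<theta>\<^sup>2) = 1"
    by (simp add: exp_add[symmetric])
  ultimately have "1 \<le> sqrt (1 - 2 * \<theta>) * exp (\<theta> + 4 * \<theta>\<^sup>2)"
    by (metis exp_ge_zero mult_right_mono)
  then show ?thesis using \<open>sqrt (1 - 2 * \<theta>) > 0\<close> by (simp add: field_simps)
qed

lemma gauss_mgf_square_le:
  assumes "finite J" "\<bar>\<theta>\<bar> \<le> 1/8"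
  shows "(\<integral>\<^sup>+x. ennreal (exp (\<theta> * ip J x x)) \<partial>gauss J) \<le> ennreal (exp (real (card J) * (\<theta> + 4 * \<theta>\<^sup>2)))"
proof -
  have "(\<integral>\<^sup>+x. ennreal (exp (\<theta> * ip J x x)) \<partial>gauss J) =
    (\<integral>\<^sup>+x. (\<Prod>i\<in>J. ennreal (exp (\<theta> * (x i)\<^sup>2))) \<partial>gauss J)"
    by (intro nn_integral_cong)
       (simp add: ip_def sum_distrib_left exp_sum[OF assms(1)] prod_ennreal power2_eq_square)
  also have "\<dots> = (\<Prod>i\<in>J. ennreal (1 / sqrt (1 - 2 * \<theta>)))"
    unfolding gauss_def using assms
    by (subst std_normals.product_nn_integral_prod) (measurable, auto simp: std_normal_mgf_square)
  also have "\<dots> = ennreal ((1 / sqrt (1 - 2 * \<theta>)) ^ card J)"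
    using assms by (subst prod_ennreal) auto
  also have "\<dots> \<le> ennreal (exp (\<theta> + 4 * \<theta>\<^sup>2) ^ card J)"
    using assms by (intro ennreal_leI power_mono inverse_sqrt_le_exp) auto
  also have "exp (\<theta> + 4 * \<theta>\<^sup>2) ^ card J = exp (real (card J) * (\<theta> + 4 * \<theta>\<^sup>2))"
    by (simp add: exp_of_nat_mult)
  finally show ?thesis .
qed

lemma exp_markov:
  assumes [measurable]: "f \<in> borel_measurable M"
  shows "emeasure M {x \<in> space M. t \<le> f x} \<le> ennreal (exp (- t)) * (\<integral>\<^sup>+x. ennreal (exp (f x)) \<partial>M)"
proof -
  have "emeasure M {x \<in> space M. t \<le> f x} = (\<integral>\<^sup>+x. indicator {x \<in> space M. t \<le> f x} x \<partial>M)"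
    by (rule nn_integral_indicator[symmetric]) measurable
  also have "\<dots> \<le> (\<integral>\<^sup>+x. ennreal (exp (- t)) * ennreal (exp (f x)) \<partial>M)"
    by (intro nn_integral_mono)
       (auto simp: indicator_def ennreal_mult'[symmetric] exp_add[symmetric] simp flip: ennreal_1 intro!: ennreal_leI)
  also have "\<dots> = ennreal (exp (- t)) * (\<integral>\<^sup>+x. ennreal (exp (f x)) \<partial>M)"
    by (rule nn_integral_cmult) simp
  finally show ?thesis .
qed

text \<open>Chernoff bound in both directions. The deviation is measured against an upper bound
  \<open>N\<close> of the number of coordinates, so that one scale serves all the shrinking rows and
  columns met during tridiagonalization.\<close>

lemma gauss_chi_square_tail:
  assumes J: "finite J" "real (card J) \<le> N" and \<delta>: "0 \<le> \<delta>" "\<delta> \<le> 1"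
  shows "emeasure (gauss J) {x \<in> space (gauss J). \<not> \<bar>ip J x x - real (card J)\<bar> \<le> \<delta> * N}
    \<le> ennreal (2 * exp (- (\<delta>\<^sup>2 * N / 16)))"
proof -
  \<comment> \<open>The sign of \<open>\<theta>\<close> selects the tail. With
    \<open>\<bar>\<theta>\<bar> = \<delta> / 8\<close> the exponent is at most (1/16 - 1/8)
    \<delta>^2 N.\<close>
  have tail: "emeasure (gauss J) {x \<in> space (gauss J). \<theta> * real (card J) + \<delta>\<^sup>2 / 8 * N \<le> \<theta> * ip J x x}
    \<le> ennreal (exp (- (\<delta>\<^sup>2 * N / 16)))" if \<theta>: "\<bar>\<theta>\<bar> = \<delta> / 8" for \<theta>
  proof -
    have "\<theta>\<^sup>2 = \<bar>\<theta>\<bar>\<^sup>2" by simp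
    then have t2: "\<theta>\<^sup>2 = \<delta>\<^sup>2 / 64" unfolding \<theta> by (simp add: power2_eq_square)
    have [measurable]: "(\<lambda>x. \<theta> * ip J x x) \<in> borel_measurable (gauss J)" by measurable
    have "emeasure (gauss J) {x \<in> space (gauss J). \<theta> * real (card J) + \<delta>\<^sup>2 / 8 * N \<le> \<theta> * ip J x x}
      \<le> ennreal (exp (- (\<theta> * real (card J) + \<delta>\<^sup>2 / 8 * N))) * (\<integral>\<^sup>+x. ennreal (exp (\<theta> * ip J x x)) \<partial>gauss J)"
      by (rule exp_markov) simp
    also have "\<dots> \<le> ennreal (exp (- (\<theta> * real (card J) + \<delta>\<^sup>2 / 8 * N))) *
        ennreal (exp (real (card J) * (\<theta> + 4 * \<theta>\<^sup>2)))"
      by (intro mult_left_mono gauss_mgf_square_le J) (use \<theta> \<delta> in auto)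
    also have "\<dots> = ennreal (exp (4 * \<theta>\<^sup>2 * real (card J) - \<delta>\<^sup>2 / 8 * N))"
      by (simp add: ennreal_mult'[symmetric] exp_add[symmetric] algebra_simps)
    also have "\<dots> \<le> ennreal (exp (- (\<delta>\<^sup>2 * N / 16)))"
    proof -
      have "4 * \<theta>\<^sup>2 * real (card J) \<le> \<delta>\<^sup>2 / 16 * N"
        unfolding t2 using mult_left_mono[OF J(2), of "\<delta>\<^sup>2 / 16"] by simp
      then show ?thesis by (intro ennreal_leI) simp
    qed
    finally show ?thesis .
  qed
  let ?A = "\<lambda>\<theta>. {x \<in> space (gauss J). \<theta> * real (card J) + \<delta>\<^sup>2 / 8 * N \<le> \<theta> * ip J x x}"
  have m: "?A \<theta> \<in> sets (gauss J)" for \<theta> by measurable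
  have "{x \<in> space (gauss J). \<not> \<bar>ip J x x - real (card J)\<bar> \<le> \<delta> * N} \<subseteq> ?A (\<delta> / 8) \<union> ?A (- (\<delta> / 8))"
  proof
    fix x assume x: "x \<in> {x \<in> space (gauss J). \<not> \<bar>ip J x x - real (card J)\<bar> \<le> \<delta> * N}"
    then consider "ip J x x - real (card J) \<ge> \<delta> * N" | "real (card J) - ip J x x \<ge> \<delta> * N" by force
    then show "x \<in> ?A (\<delta> / 8) \<union> ?A (- (\<delta> / 8))"
    proof cases
      case 1
      then have "\<delta> / 8 * (\<delta> * N) \<le> \<delta> / 8 * (ip J x x - real (card J))"
        using \<delta> by (intro mult_left_mono) auto
      then show ?thesis using x by (simp add: algebra_simps power2_eq_square)
    next
      case 2
      then have "\<delta> / 8 * (\<delta> * N) \<le> \<delta> / 8 * (real (card J) - ip J x x)"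
        using \<delta> by (intro mult_left_mono) auto
      then show ?thesis using x by (simp add: algebra_simps power2_eq_square)
    qed
  qed
  then have "emeasure (gauss J) {x \<in> space (gauss J). \<not> \<bar>ip J x x - real (card J)\<bar> \<le> \<delta> * N}
    \<le> emeasure (gauss J) (?A (\<delta> / 8) \<union> ?A (- (\<delta> / 8)))"
    by (rule emeasure_mono) (use m in auto)
  also have "\<dots> \<le> emeasure (gauss J) (?A (\<delta> / 8)) + emeasure (gauss J) (?A (- (\<delta> / 8)))"
    by (rule emeasure_subadditive) (use m in auto)
  also have "\<dots> \<le> ennreal (exp (- (\<delta>\<^sup>2 * N / 16))) + ennreal (exp (- (\<delta>\<^sup>2 * N / 16)))"
    by (intro add_mono tail) (use \<delta> in auto)
  also have "\<dots> = ennreal (2 * exp (- (\<delta>\<^sup>2 * N / 16)))"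
    by (simp add: ennreal_plus[symmetric] del: ennreal_plus)
  finally show ?thesis .
qed

text \<open>Fubini: for frozen coordinates \<open>\<rho>\<close> in \<open>K\<close>, the map
  \<open>T \<rho>\<close> preserves the law of the block \<open>P\<close>. The transformed block is
  therefore again Gaussian and independent of \<open>K\<close>, although the map was chosen by
  looking at \<open>K\<close>. This justifies adaptive reflections.\<close>

lemma gauss_peel:
  fixes T :: "('i \<Rightarrow> real) \<Rightarrow> ('i \<Rightarrow> real) \<Rightarrow> ('i \<Rightarrow> real)"
  assumes fin: "finite K" "finite P" and disj: "K \<inter> P = {}"
    and S [measurable]: "S \<in> sets (gauss K)" and E [measurable]: "E \<in> sets (gauss P)"
    and T: "\<And>\<rho>. gauss_invariant P (T \<rho>)"
    and Tm: "(\<lambda>\<omega>. T (restrict \<omega> K) (restrict \<omega> P)) \<in> measurable (gauss (K \<union> P)) (gauss P)"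
  defines "E1 \<equiv> {\<omega> \<in> space (gauss (K \<union> P)). restrict \<omega> K \<in> S \<and> T (restrict \<omega> K) (restrict \<omega> P) \<in> E}"
  shows "E1 \<in> sets (gauss (K \<union> P))" "measure (gauss (K \<union> P)) E1 = measure (gauss K) S * measure (gauss P) E"
proof -
  have [measurable]: "(\<lambda>\<omega>. restrict \<omega> K) \<in> measurable (gauss (K \<union> P)) (gauss K)"
    unfolding gauss_def by (rule measurable_restrict_subset) auto
  note Tm [measurable]
  show E1: "E1 \<in> sets (gauss (K \<union> P))"
    unfolding E1_def by measurable
  have "emeasure (gauss (K \<union> P)) E1 = (\<integral>\<^sup>+\<rho>. emeasure (gauss P) ((\<lambda>y. merge K P (\<rho>, y)) -` E1 \<inter> space (gauss P)) \<partial>gauss K)"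
    using std_normals.emeasure_fold_integral[OF disj fin E1[unfolded gauss_def]] unfolding gauss_def .
  also have "\<dots> = (\<integral>\<^sup>+\<rho>. emeasure (gauss P) E * indicator S \<rho> \<partial>gauss K)"
  proof (rule nn_integral_cong)
    fix \<rho> :: "'i \<Rightarrow> real" assume \<rho>: "\<rho> \<in> space (gauss K)"
    have "(\<lambda>y. merge K P (\<rho>, y)) -` E1 \<inter> space (gauss P) =
      (if \<rho> \<in> S then {y \<in> space (gauss P). T \<rho> y \<in> E} else {})"
      using \<rho> disj
      by (auto simp: E1_def space_gauss extensional_restrict)
    then show "emeasure (gauss P) ((\<lambda>y. merge K P (\<rho>, y)) -` E1 \<inter> space (gauss P)) =
        emeasure (gauss P) E * indicator S \<rho>"
      using gauss_invariant_emeasure[OF T E] by simp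
  qed
  also have "\<dots> = emeasure (gauss P) E * emeasure (gauss K) S"
    by (rule nn_integral_cmult_indicator[OF S])
  finally show "measure (gauss (K \<union> P)) E1 = measure (gauss K) S * measure (gauss P) E"
    by (simp add: measure_def enn2real_mult mult.commute)
qed

section \<open>Tridiagonalization of Gaussian matrices\<close>

text \<open>\<open>B\<close>, restricted to rows \<open>{j..<N\<^sub>1}\<close> and columns \<open>{j..<N\<^sub>2}\<close>, is tridiagonal in suitable
  orthonormal bases whose first vectors are \<open>e\<^sub>j\<close>; the entries \<open>p\<close> and \<open>q\<close> off the diagonal are close to
  the square roots of the remaining dimensions.\<close>

definition frame_map :: "nat \<Rightarrow> nat \<Rightarrow> ((nat \<Rightarrow> real) \<Rightarrow> nat \<Rightarrow> real) \<Rightarrow> bool" where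
  "frame_map j N U \<longleftrightarrow> (\<forall>x. ip {j..<N} (U x) (U x) = ip {j..<N} x x) \<and> (j < N \<longrightarrow> (\<forall>x. U x j = x j)) \<and>
     (\<forall>x. U (restrict x {j..<N}) = U x) \<and> (\<forall>z. \<exists>x. \<forall>i\<in>{j..<N}. U x i = z i)"

definition tridiagonal_form where
  "tridiagonal_form n U V d p q x y =
     (\<Sum>i\<in>n. d i * U x i * V y i + p i * U x (Suc i) * V y i + q i * U x i * V y (Suc i) :: real)"

text \<open>The last two clauses matter at the end of the range: there \<open>Suc i\<close> may lie
  outside the frame, and the zero coefficient removes a value of \<open>U x\<close> or
  \<open>V y\<close> that \<open>frame_map\<close> does not control.\<close>

definition tridiagonal_bounds ::
  "real \<Rightarrow> nat \<Rightarrow> nat \<Rightarrow> (nat \<Rightarrow> real) \<Rightarrow> (nat \<Rightarrow> real) \<Rightarrow> (nat \<Rightarrow> real) \<Rightarrow> nat \<Rightarrow> bool" where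
  "tridiagonal_bounds s N1 N2 d p q i \<longleftrightarrow> (d i)\<^sup>2 \<le> 1 + s \<and> p i \<ge> 0 \<and> q i \<ge> 0 \<and>
     \<bar>(p i)\<^sup>2 - real (card {Suc i..<N1})\<bar> \<le> s \<and> \<bar>(q i)\<^sup>2 - real (card {Suc i..<N2})\<bar> \<le> s \<and>
     (Suc i \<ge> N1 \<longrightarrow> p i = 0) \<and> (Suc i \<ge> N2 \<longrightarrow> q i = 0)"

definition tridiagonalizable :: "real \<Rightarrow> nat \<Rightarrow> nat \<Rightarrow> nat \<Rightarrow> (nat \<times> nat \<Rightarrow> real) \<Rightarrow> bool" where
  "tridiagonalizable s N1 N2 j B \<longleftrightarrow> (\<exists>U V d p q. frame_map j N1 U \<and> frame_map j N2 V \<and>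
     (\<forall>x y. bil {j..<N1} {j..<N2} B x y = tridiagonal_form {j..<min N1 N2} U V d p q x y) \<and>
     (\<forall>i\<in>{j..<min N1 N2}. tridiagonal_bounds s N1 N2 d p q i))"

text \<open>The reflection along \<open>reflector I j c\<close> maps \<open>c\<close> to a multiple of \<open>e\<^sub>j\<close>.\<close>

definition reflector :: "nat set \<Rightarrow> nat \<Rightarrow> (nat \<Rightarrow> real) \<Rightarrow> (nat \<Rightarrow> real)" where
  "reflector I j c = (\<lambda>i. c i - (if i = j then L2_set c I else 0))"

lemma ip_unit_vec: "finite I \<Longrightarrow> j \<in> I \<Longrightarrow> ip I (\<lambda>i. if i = j then t else 0) x = t * x j"
  by (simp add: ip_def if_distrib[of "\<lambda>a. a * _"] sum.delta cong: if_cong)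

lemma ip_via_reflector:
  assumes "finite I" "I \<noteq> {} \<Longrightarrow> j \<in> I"
  shows "ip I c x = L2_set c I * householder I (reflector I j c) x j"
proof (cases "I = {}")
  case True
  then show ?thesis by (simp add: ip_def)
next
  case False
  then have j: "j \<in> I" using assms by auto
  let ?e = "\<lambda>i. if i = j then L2_set c I else 0"
  have "ip I c c = ip I ?e ?e"
    using ip_unit_vec[OF assms(1) j, of "L2_set c I" ?e] by (simp add: ip_self_L2[of I c] power2_eq_square)
  then have h: "householder I (reflector I j c) c i = ?e i" if "i \<in> I" for i
    unfolding reflector_def using householder_swap[of I c ?e i] assms(1) that by simp
  have "ip I c x = ip I (householder I (reflector I j c) c) (householder I (reflector I j c) x)"
    by simp
  also have "\<dots> = ip I ?e (householder I (reflector I j c) x)"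
    by (rule ip_cong) (use h in auto)
  finally show ?thesis using assms(1) j by (simp add: ip_unit_vec)
qed

lemma bil_split_corner:
  assumes "finite I'" "finite J'" "j \<notin> I'" "j \<notin> J'" 
  shows "bil (insert j I') (insert j J') B x y =
    B (j, j) * x j * y j + ip I' (\<lambda>i. B (i, j)) x * y j + x j * ip J' (\<lambda>k. B (j, k)) y + bil I' J' B x y"
  using assms
  by (simp add: bil_def ip_def sum.distrib algebra_simps sum_distrib_left sum_distrib_right)

lemma bil_cong:
  assumes "\<And>i. i \<in> I \<Longrightarrow> x i = x' i" "\<And>j. j \<in> J \<Longrightarrow> y j = y' j"
    "\<And>i j. i \<in> I \<Longrightarrow> j \<in> J \<Longrightarrow> B (i, j) = B' (i, j)"
  shows "bil I J B x y = bil I J B' x' y'"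
  unfolding bil_def by (intro ip_cong assms) auto

lemma frame_map_extend:
  assumes U: "frame_map (Suc j) N U" and j: "j < N"
  shows "frame_map j N (\<lambda>x i. if i = j then x j else U (householder {Suc j..<N} a x) i)"
proof -
  define I where "I = {Suc j..<N}"
  have I: "finite I" "j \<notin> I" "{j..<N} = insert j I" using j by (auto simp: I_def)
  have U1: "ip I (U x) (U x) = ip I x x" and U2: "U (restrict x I) = U x"
    and U3: "\<exists>x. \<forall>i\<in>I. U x i = z i" for x z
    using U unfolding frame_map_def I_def by auto
  define U' where "U' = (\<lambda>x i. if i = j then x j else U (householder I a x) i)"
  have "ip (insert j I) (U' x) (U' x) = ip (insert j I) x x" for x
  proof -
    have "ip I (U' x) (U' x) = ip I (U (householder I a x)) (U (householder I a x))"
      by (rule ip_cong) (use I in \<open>auto simp: U'_def\<close>)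
    then have "ip I (U' x) (U' x) = ip I x x" using U1 by simp
    then show ?thesis using I by (simp add: ip_def U'_def)
  qed
  moreover have "U' (restrict x (insert j I)) = U' x" for x
  proof -
    have h: "householder I a (restrict x (insert j I)) = householder I a x"
      by (rule householder_cong) simp
    show ?thesis by (rule ext) (auto simp: U'_def h)
  qed
  moreover have "\<exists>x. \<forall>i\<in>insert j I. U' x i = z i" for z
  proof -
    obtain x where x: "\<forall>i\<in>I. U x i = z i" using U3 by blast
    \<comment> \<open>The reflection is an involution, so the reflected preimage is mapped back to
      the preimage; coordinate \<open>j\<close> is set by hand, since it lies outside
      \<open>I\<close>.\<close>
    define w where "w = (householder I a x)(j := z j)"
    have "householder I a w = householder I a (householder I a x)"
      by (rule householder_cong) (use I in \<open>auto simp: w_def\<close>)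
    also have "\<dots> = restrict x I"
      by (rule ext) (metis householder_def householder_involution restrict_apply)
    finally have "U (householder I a w) = U x" using U2 by simp
    then have "U' w i = z i" if "i \<in> insert j I" for i
      using that x by (auto simp: U'_def w_def)
    then show ?thesis by blast
  qed
  ultimately show ?thesis
    unfolding frame_map_def I(3) U'_def[symmetric] I_def[symmetric] by (simp add: U'_def)
qed

text \<open>One step of Householder's reduction. The first column and the first row without the
  corner act as linear forms; a reflection beyond index \<open>j\<close> turns each into its length
  times a single coordinate, and these lengths are \<open>p j\<close> and \<open>q j\<close>. Index
  \<open>j\<close> itself is never touched, so the corner, and later the spike in it, stays in
  place.\<close>

lemma tridiagonalizable_step:
  fixes B :: "nat \<times> nat \<Rightarrow> real"
  assumes j: "j < N1" "j < N2"
  defines "I \<equiv> {Suc j..<N1}" and "J \<equiv> {Suc j..<N2}"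
  defines "c \<equiv> \<lambda>i. B (i, j)" and "r \<equiv> \<lambda>k. B (j, k)"
  assumes B': "tridiagonalizable s N1 N2 (Suc j)
      (refl_left I J (reflector I (Suc j) c) (refl_right I J (reflector J (Suc j) r) B))"
    and diag: "(B (j, j))\<^sup>2 \<le> 1 + s"
    and col: "\<bar>ip I c c - real (card I)\<bar> \<le> s" and row: "\<bar>ip J r r - real (card J)\<bar> \<le> s"
  shows "tridiagonalizable s N1 N2 j B"
proof -
  define a where "a = reflector I (Suc j) c"
  define b where "b = reflector J (Suc j) r"
  define B' where "B' = refl_left I J a (refl_right I J b B)"
  have I: "finite I" "j \<notin> I" "{j..<N1} = insert j I" "I \<noteq> {} \<Longrightarrow> Suc j \<in> I" "I = {} \<longleftrightarrow> Suc j \<ge> N1"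
    and J: "finite J" "j \<notin> J" "{j..<N2} = insert j J" "J \<noteq> {} \<Longrightarrow> Suc j \<in> J" "J = {} \<longleftrightarrow> Suc j \<ge> N2"
    using j by (auto simp: I_def J_def)
  obtain U V d p q where U: "frame_map (Suc j) N1 U" and V: "frame_map (Suc j) N2 V"
    and form: "\<forall>x y. bil I J B' x y = tridiagonal_form {Suc j..<min N1 N2} U V d p q x y"
    and bnd: "\<forall>i\<in>{Suc j..<min N1 N2}. tridiagonal_bounds s N1 N2 d p q i"
    using B' unfolding tridiagonalizable_def I_def[symmetric] J_def[symmetric]
      a_def[symmetric] b_def[symmetric] B'_def[symmetric] by blast
  define U' where "U' = (\<lambda>x i. if i = j then x j else U (householder I a x) i)"
  define V' where "V' = (\<lambda>y i. if i = j then y j else V (householder J b y) i)"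
  define d' where "d' = d(j := B (j, j))"
  define p' where "p' = p(j := L2_set c I)"
  define q' where "q' = q(j := L2_set r J)"
  have fU: "frame_map j N1 U'" and fV: "frame_map j N2 V'"
    unfolding U'_def V'_def I_def J_def by (intro frame_map_extend U V j)+
  have bil_B': "bil I J B x y = bil I J B' (householder I a x) (householder J b y)" for x y
    unfolding B'_def bil_refl_left bil_refl_right
    by (rule bil_cong) (auto simp: householder_involution)
  have cx: "ip I c x = p' j * U' x (Suc j)" for x
  proof (cases "I = {}")
    case True
    then show ?thesis by (simp add: p'_def ip_def)
  next
    case False
    then have "U' x (Suc j) = householder I a x (Suc j)"
      using U I(5) by (simp add: U'_def frame_map_def)
    then show ?thesis using ip_via_reflector[OF I(1,4), of c x] by (simp add: p'_def a_def)
  qed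
  have ry: "ip J r y = q' j * V' y (Suc j)" for y
  proof (cases "J = {}")
    case True
    then show ?thesis by (simp add: q'_def ip_def)
  next
    case False
    then have "V' y (Suc j) = householder J b y (Suc j)"
      using V J(5) by (simp add: V'_def frame_map_def)
    then show ?thesis using ip_via_reflector[OF J(1,4), of r y] by (simp add: q'_def b_def)
  qed
  have ins: "{j..<min N1 N2} = insert j {Suc j..<min N1 N2}" using j by auto
  have "bil {j..<N1} {j..<N2} B x y = tridiagonal_form {j..<min N1 N2} U' V' d' p' q' x y" for x y
  proof -
    have rest: "bil I J B x y = tridiagonal_form {Suc j..<min N1 N2} U' V' d' p' q' x y"
      unfolding bil_B' form[rule_format] tridiagonal_form_def
      by (rule sum.cong) (auto simp: U'_def V'_def d'_def p'_def q'_def)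
    have "bil {j..<N1} {j..<N2} B x y =
      B (j, j) * x j * y j + ip I c x * y j + x j * ip J r y + bil I J B x y"
      unfolding I(3) J(3) c_def r_def by (rule bil_split_corner) (use I J in auto)
    moreover have "U' x j = x j" "V' y j = y j" "d' j = B (j, j)" by (auto simp: U'_def V'_def d'_def)
    ultimately show ?thesis
      unfolding rest unfolding cx ry ins tridiagonal_form_def by (simp add: algebra_simps)
  qed
  moreover have "tridiagonal_bounds s N1 N2 d' p' q' i" if "i \<in> {j..<min N1 N2}" for i
  proof (cases "i = j")
    case True
    then show ?thesis
      using diag col row I(5) J(5)
      by (auto simp: tridiagonal_bounds_def d'_def p'_def q'_def ip_self_L2 I_def[symmetric] J_def[symmetric])
  next
    case False
    then have "i \<in> {Suc j..<min N1 N2}" using that by auto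
    then show ?thesis
      using bnd False by (auto simp: tridiagonal_bounds_def d'_def p'_def q'_def)
  qed
  ultimately show ?thesis
    unfolding tridiagonalizable_def using fU fV by blast
qed

lemma tridiagonalizable_base:
  assumes "min N1 N2 \<le> j" "s \<ge> 0"
  shows "tridiagonalizable s N1 N2 j B"
proof -
  have id: "frame_map j N (\<lambda>x. restrict x {j..<N})" for N
    unfolding frame_map_def by (auto simp: ip_def)
  have "{j..<N1} = {} \<or> {j..<N2} = {}" using assms by auto
  then have b: "bil {j..<N1} {j..<N2} B x y = 0" for x y by (auto simp: bil_def ip_def)
  have e: "{j..<min N1 N2} = {}" using assms by auto
  show ?thesis
    unfolding tridiagonalizable_def
    by (rule exI[of _ "\<lambda>x. restrict x {j..<N1}"], rule exI[of _ "\<lambda>x. restrict x {j..<N2}"],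
        rule exI[of _ "\<lambda>_. 0"], rule exI[of _ "\<lambda>_. 0"], rule exI[of _ "\<lambda>_. 0"])
       (simp only: e b, simp add: tridiagonal_form_def id)
qed

section \<open>Tridiagonalization of Gaussian matrices with high probability\<close>

lemma emeasure_gauss_subvector:
  assumes "finite J" "inj_on f J" "f ` J \<subseteq> K" "real (card J) \<le> N" "0 \<le> \<delta>" "\<delta> \<le> 1"
  shows "{\<omega> \<in> space (gauss K). \<not> \<bar>ip J (\<lambda>i. \<omega> (f i)) (\<lambda>i. \<omega> (f i)) - real (card J)\<bar> \<le> \<delta> * N} \<in> sets (gauss K)"
    "measure (gauss K) {\<omega> \<in> space (gauss K). \<not> \<bar>ip J (\<lambda>i. \<omega> (f i)) (\<lambda>i. \<omega> (f i)) - real (card J)\<bar> \<le> \<delta> * N}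
      \<le> 2 * exp (- (\<delta>\<^sup>2 * N / 16))"
proof -
  interpret K: prob_space "gauss K" by (rule prob_space_gauss)
  let ?A = "{x \<in> space (gauss J). \<not> \<bar>ip J x x - real (card J)\<bar> \<le> \<delta> * N}"
  let ?B = "{\<omega> \<in> space (gauss K). \<not> \<bar>ip J (\<lambda>i. \<omega> (f i)) (\<lambda>i. \<omega> (f i)) - real (card J)\<bar> \<le> \<delta> * N}"
  have A: "?A \<in> sets (gauss J)" by measurable
  have eq: "?B = {\<omega> \<in> space (gauss K). (\<lambda>i\<in>J. \<omega> (f i)) \<in> ?A}"
  proof -
    have "ip J (\<lambda>i\<in>J. \<omega> (f i)) (\<lambda>i\<in>J. \<omega> (f i)) = ip J (\<lambda>i. \<omega> (f i)) (\<lambda>i. \<omega> (f i))" for \<omega>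
      by (rule ip_cong) auto
    then show ?thesis by (auto simp: space_gauss)
  qed
  have "{\<omega> \<in> space (gauss K). (\<lambda>i\<in>J. \<omega> (f i)) \<in> ?A} = (\<lambda>\<omega>. \<lambda>i\<in>J. \<omega> (f i)) -` ?A \<inter> space (gauss K)"
    by auto
  then show "?B \<in> sets (gauss K)"
    unfolding eq using measurable_sets[OF measurable_gauss_reindex[OF assms(3)] A] by simp
  have "emeasure (gauss K) ?B \<le> ennreal (2 * exp (- (\<delta>\<^sup>2 * N / 16)))"
    unfolding eq emeasure_gauss_reindex[OF assms(2,3) A]
    by (rule gauss_chi_square_tail) (use assms in auto)
  then show "measure (gauss K) ?B \<le> 2 * exp (- (\<delta>\<^sup>2 * N / 16))"
    by (simp add: K.emeasure_eq_measure)
qed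

lemma householder_cong_both:
  "(\<And>i. i \<in> I \<Longrightarrow> a i = b i) \<Longrightarrow> (\<And>i. i \<in> I \<Longrightarrow> x i = y i) \<Longrightarrow> householder I a x = householder I b y"
  using ip_cong[of I a b x y] ip_cong[of I a b a b] by (auto simp: householder_def fun_eq_iff)

lemma refl_left_cong:
  assumes "\<And>i. i \<in> I \<Longrightarrow> a i = b i" "\<And>i j. i \<in> I \<Longrightarrow> j \<in> J \<Longrightarrow> A (i, j) = B (i, j)"
  shows "refl_left I J a A = refl_left I J b B"
  unfolding refl_left_def
  by (rule restrict_ext) (auto intro!: fun_cong[OF householder_cong_both] assms)

lemma refl_right_cong:
  assumes "\<And>j. j \<in> J \<Longrightarrow> a j = b j" "\<And>i j. i \<in> I \<Longrightarrow> j \<in> J \<Longrightarrow> A (i, j) = B (i, j)"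
  shows "refl_right I J a A = refl_right I J b B"
  unfolding refl_right_def
  by (rule restrict_ext) (auto intro!: fun_cong[OF householder_cong_both] assms)

lemma reflector_cong: "(\<And>i. i \<in> I \<Longrightarrow> c i = d i) \<Longrightarrow> i \<in> I \<Longrightarrow> reflector I j c i = reflector I j d i"
  by (simp add: reflector_def L2_set_def)

lemma measurable_householder_apply:
  assumes "\<And>i. i \<in> I \<Longrightarrow> (\<lambda>w. f w i) \<in> borel_measurable M" "\<And>i. i \<in> I \<Longrightarrow> (\<lambda>w. g w i) \<in> borel_measurable M"
    and i: "i \<in> I"
  shows "(\<lambda>w. householder I (f w) (g w) i) \<in> borel_measurable M"
  using measurable_compose[OF measurable_householder[OF assms(1,2)] measurable_component_singleton[OF i]] .

lemma measurable_reflector: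
  assumes m: "\<And>i. i \<in> I \<Longrightarrow> (\<lambda>w. f w i) \<in> borel_measurable M" and i: "i \<in> I"
  shows "(\<lambda>w. reflector I j (f w) i) \<in> borel_measurable M"
proof -
  have "(\<lambda>w. ip I (f w) (f w)) \<in> borel_measurable M" by (intro measurable_ip m)
  then have "(\<lambda>w. L2_set (f w) I) \<in> borel_measurable M" by (simp add: L2_eq_sqrt_ip)
  then show ?thesis unfolding reflector_def using m[OF i] by simp
qed

lemma measurable_refl_left:
  assumes "\<And>i. i \<in> I \<Longrightarrow> (\<lambda>w. f w i) \<in> borel_measurable M"
    "\<And>i j. i \<in> I \<Longrightarrow> j \<in> J \<Longrightarrow> (\<lambda>w. g w (i, j)) \<in> borel_measurable M"
  shows "(\<lambda>w. refl_left I J (f w) (g w)) \<in> measurable M (gauss (I \<times> J))"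
  unfolding measurable_cong_sets[OF refl sets_gauss] refl_left_def
  by (rule measurable_restrict, rule measurable_householder_apply) (use assms in auto)

lemma measurable_refl_right:
  assumes "\<And>j. j \<in> J \<Longrightarrow> (\<lambda>w. f w j) \<in> borel_measurable M"
    "\<And>i j. i \<in> I \<Longrightarrow> j \<in> J \<Longrightarrow> (\<lambda>w. g w (i, j)) \<in> borel_measurable M"
  shows "(\<lambda>w. refl_right I J (f w) (g w)) \<in> measurable M (gauss (I \<times> J))"
  unfolding measurable_cong_sets[OF refl sets_gauss] refl_right_def
  by (rule measurable_restrict, rule measurable_householder_apply) (use assms in auto)

lemma measurable_gauss_apply: "i \<in> I \<Longrightarrow> (\<lambda>\<omega>. \<omega> i) \<in> borel_measurable (gauss I)"
  unfolding measurable_cong_sets[OF sets_gauss refl] by (rule measurable_component_singleton)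

lemma measurable_into_gauss_apply:
  "f \<in> measurable M (gauss I) \<Longrightarrow> i \<in> I \<Longrightarrow> (\<lambda>w. f w i) \<in> borel_measurable M"
  using measurable_compose[OF _ measurable_gauss_apply] .

text \<open>The reflections are determined by the first row and column, which are independent of the
  remaining minor; by \<open>gauss_peel\<close> the reflected minor is again Gaussian and the
  induction continues with it. A step fails in one of three chi-square events (column, row, diagonal
  entry), each with two tails, whence the factor 6.\<close>

lemma tridiagonalizable_event:
  assumes N: "N1 \<le> N" "N2 \<le> N" and \<delta>: "0 \<le> \<delta>" "\<delta> \<le> 1"
  shows "\<exists>E\<in>sets (gauss ({j..<N1} \<times> {j..<N2})). (\<forall>B\<in>E. tridiagonalizable (\<delta> * real N) N1 N2 j B) \<and>
    measure (gauss ({j..<N1} \<times> {j..<N2})) E \<ge> 1 - real (min N1 N2 - j) * (6 * exp (- (\<delta>\<^sup>2 * real N / 16)))"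
proof (induction "min N1 N2 - j" arbitrary: j)
  case 0
  interpret prob_space "gauss ({j..<N1} \<times> {j..<N2})" by (rule prob_space_gauss)
  have "\<forall>B. tridiagonalizable (\<delta> * real N) N1 N2 j B"
    using 0 \<delta> by (intro allI tridiagonalizable_base) auto
  then show ?case
    using 0 by (intro bexI[of _ "space (gauss ({j..<N1} \<times> {j..<N2}))"]) (auto simp: prob_space)
next
  case (Suc k)
  define \<tau> where "\<tau> = 6 * exp (- (\<delta>\<^sup>2 * real N / 16))"
  have j: "j < N1" "j < N2" using Suc.hyps(2) by auto
  define I where "I = {Suc j..<N1}"
  define J where "J = {Suc j..<N2}"
  \<comment> \<open>The hook of row \<open>j\<close> and column \<open>j\<close>.\<close>
  define K where "K = ({j..<N1} \<times> {j..<N2}) - I \<times> J"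
  have fin: "finite I" "finite J" "finite K" "finite (I \<times> J)" by (auto simp: I_def J_def K_def)
  have KP: "K \<union> I \<times> J = {j..<N1} \<times> {j..<N2}" "K \<inter> I \<times> J = {}"
    by (auto simp: K_def I_def J_def)
  have mem: "(j, j) \<in> K" "\<And>i. i \<in> I \<Longrightarrow> (i, j) \<in> K" "\<And>i. i \<in> J \<Longrightarrow> (j, i) \<in> K"
    using j by (auto simp: K_def I_def J_def)
  interpret K: prob_space "gauss K" by (rule prob_space_gauss)
  have k: "k = min N1 N2 - Suc j" using Suc.hyps(2) by linarith
  obtain E' where E': "E' \<in> sets (gauss (I \<times> J))"
    "\<forall>B\<in>E'. tridiagonalizable (\<delta> * real N) N1 N2 (Suc j) B"
    "measure (gauss (I \<times> J)) E' \<ge> 1 - real (min N1 N2 - Suc j) * \<tau>"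
    using Suc.hyps(1)[OF k] unfolding I_def J_def \<tau>_def by auto
  interpret P: prob_space "gauss (I \<times> J)" by (rule prob_space_gauss)
  define bad where "bad L f = {\<omega> \<in> space (gauss K).
    \<not> \<bar>ip L (\<lambda>i. \<omega> (f i)) (\<lambda>i. \<omega> (f i)) - real (card L)\<bar> \<le> \<delta> * real N}" for L :: "nat set" and f :: "nat \<Rightarrow> nat \<times> nat"
  define col where "col i = (i, j)" for i :: nat
  define row where "row i = (j, i)" for i :: nat
  have bad: "bad L f \<in> sets (gauss K)" "measure (gauss K) (bad L f) \<le> \<tau> / 3"
    if "finite L" "inj_on f L" "f ` L \<subseteq> K" "card L \<le> N" for L f
    using emeasure_gauss_subvector[OF that(1-3) _ \<delta>, of "real N"] that(4) by (auto simp: bad_def \<tau>_def)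
  \<comment> \<open>The diagonal entry is treated as a sum of squares with one term, which is why
    its bound reads \<open>1 + s\<close>.\<close>
  have col: "finite I" "inj_on col I" "col ` I \<subseteq> K" "card I \<le> N"
    and row: "finite J" "inj_on row J" "row ` J \<subseteq> K" "card J \<le> N"
    and diag: "finite {j}" "inj_on col {j}" "col ` {j} \<subseteq> K" "card {j} \<le> N"
    using mem N j by (auto simp: col_def row_def inj_on_def I_def J_def)
  define S where "S = space (gauss K) - (bad I col \<union> bad J row \<union> bad {j} col)"
  have S: "S \<in> sets (gauss K)" unfolding S_def using bad(1)[OF col] bad(1)[OF row] bad(1)[OF diag] by auto
  have "measure (gauss K) (bad I col \<union> bad J row \<union> bad {j} col) \<le>
    measure (gauss K) (bad I col \<union> bad J row) + measure (gauss K) (bad {j} col)"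
    using bad(1)[OF col] bad(1)[OF row] bad(1)[OF diag] by (intro measure_Un_le) auto
  also have "\<dots> \<le> measure (gauss K) (bad I col) + measure (gauss K) (bad J row) + measure (gauss K) (bad {j} col)"
    using bad(1)[OF col] bad(1)[OF row] by (intro add_right_mono measure_Un_le) auto
  also have "\<dots> \<le> \<tau>" using bad(2)[OF col] bad(2)[OF row] bad(2)[OF diag] by linarith
  finally have mS: "measure (gauss K) S \<ge> 1 - \<tau>"
    unfolding S_def using bad(1)[OF col] bad(1)[OF row] bad(1)[OF diag] by (subst K.prob_compl) auto
  define T where "T \<rho> B = refl_left I J (reflector I (Suc j) (\<lambda>i. \<rho> (i, j)))
     (refl_right I J (reflector J (Suc j) (\<lambda>i. \<rho> (j, i))) B)" for \<rho> B :: "nat \<times> nat \<Rightarrow> real"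
  have T: "gauss_invariant (I \<times> J) (T \<rho>)" for \<rho>
    unfolding T_def[abs_def]
    by (intro gauss_invariant_comp[OF refl_left_gauss_invariant refl_right_gauss_invariant] fin)
  have Tm: "(\<lambda>\<omega>. T (restrict \<omega> K) (restrict \<omega> (I \<times> J))) \<in> measurable (gauss (K \<union> I \<times> J)) (gauss (I \<times> J))"
    unfolding T_def
  proof (intro measurable_refl_left measurable_refl_right measurable_reflector
      measurable_into_gauss_apply[OF measurable_refl_right])
    show "(\<lambda>\<omega>. restrict \<omega> K (i, j)) \<in> borel_measurable (gauss (K \<union> I \<times> J))" if "i \<in> I" for i
      using mem(2)[OF that] by (simp add: measurable_gauss_apply)
    show "(\<lambda>\<omega>. restrict \<omega> K (j, i)) \<in> borel_measurable (gauss (K \<union> I \<times> J))" if "i \<in> J" for i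
      using mem(3)[OF that] by (simp add: measurable_gauss_apply)
    show "(\<lambda>\<omega>. restrict \<omega> (I \<times> J) (i, l)) \<in> borel_measurable (gauss (K \<union> I \<times> J))" if "i \<in> I" "l \<in> J" for i l
      using that by (simp add: measurable_gauss_apply)
  qed auto
  define E where "E = {\<omega> \<in> space (gauss (K \<union> I \<times> J)). restrict \<omega> K \<in> S \<and> T (restrict \<omega> K) (restrict \<omega> (I \<times> J)) \<in> E'}"
  have E: "E \<in> sets (gauss (K \<union> I \<times> J))"
    "measure (gauss (K \<union> I \<times> J)) E = measure (gauss K) S * measure (gauss (I \<times> J)) E'"
    unfolding E_def by (rule gauss_peel[OF fin(3,4) KP(2) S E'(1) T Tm])+
  \<comment> \<open>(1 - \<tau>) x \<ge> x - \<tau> for a probability x, so the failure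
    probabilities of successive steps add up.\<close>
  have "(1 - \<tau>) * measure (gauss (I \<times> J)) E' \<le> measure (gauss (K \<union> I \<times> J)) E"
    unfolding E(2) by (intro mult_right_mono mS) simp
  moreover have "\<tau> * measure (gauss (I \<times> J)) E' \<le> \<tau> * 1"
    by (intro mult_left_mono) (auto simp: \<tau>_def)
  ultimately have "measure (gauss (K \<union> I \<times> J)) E \<ge> 1 - real (min N1 N2 - Suc j) * \<tau> - \<tau>"
    using E'(3) by (simp add: algebra_simps)
  moreover have "real (min N1 N2 - j) = real (min N1 N2 - Suc j) + 1"
    using j by simp
  ultimately have "measure (gauss (K \<union> I \<times> J)) E \<ge> 1 - real (min N1 N2 - j) * \<tau>"
    by (simp add: algebra_simps)
  moreover have "tridiagonalizable (\<delta> * real N) N1 N2 j \<omega>" if w: "\<omega> \<in> E" for \<omega>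
  proof (rule tridiagonalizable_step[OF j, folded I_def J_def])
    have eqT: "T (restrict \<omega> K) (restrict \<omega> (I \<times> J)) = refl_left I J (reflector I (Suc j) (\<lambda>i. \<omega> (i, j)))
     (refl_right I J (reflector J (Suc j) (\<lambda>i. \<omega> (j, i))) \<omega>)"
      unfolding T_def
      by (intro refl_left_cong fun_cong[OF refl_right_cong] reflector_cong) (use mem in auto)
    show "tridiagonalizable (\<delta> * real N) N1 N2 (Suc j)
     (refl_left I J (reflector I (Suc j) (\<lambda>i. \<omega> (i, j)))
       (refl_right I J (reflector J (Suc j) (\<lambda>k. \<omega> (j, k))) \<omega>))"
      using w E'(2) unfolding eqT[symmetric] E_def by auto
    have nb: "restrict \<omega> K \<in> space (gauss K)" "restrict \<omega> K \<notin> bad I col" "restrict \<omega> K \<notin> bad J row"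
      "restrict \<omega> K \<notin> bad {j} col"
      using w by (auto simp: E_def S_def)
    have "ip I (\<lambda>i. restrict \<omega> K (i, j)) (\<lambda>i. restrict \<omega> K (i, j)) = ip I (\<lambda>i. \<omega> (i, j)) (\<lambda>i. \<omega> (i, j))"
      by (rule ip_cong) (use mem in auto)
    then show "\<bar>ip I (\<lambda>i. \<omega> (i, j)) (\<lambda>i. \<omega> (i, j)) - real (card I)\<bar> \<le> \<delta> * real N"
      using nb(1,2) by (simp add: bad_def col_def)
    have "ip J (\<lambda>i. restrict \<omega> K (j, i)) (\<lambda>i. restrict \<omega> K (j, i)) = ip J (\<lambda>i. \<omega> (j, i)) (\<lambda>i. \<omega> (j, i))"
      by (rule ip_cong) (use mem in auto)
    then show "\<bar>ip J (\<lambda>k. \<omega> (j, k)) (\<lambda>k. \<omega> (j, k)) - real (card J)\<bar> \<le> \<delta> * real N"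
      using nb(1,3) by (simp add: bad_def row_def)
    show "(\<omega> (j, j))\<^sup>2 \<le> 1 + \<delta> * real N"
      using nb(1,4) mem(1) by (auto simp: bad_def col_def ip_def power2_eq_square)
  qed
  ultimately show ?case
    unfolding KP(1)[symmetric] \<tau>_def[symmetric] using E(1) by blast
qed

section \<open>Norm bounds from the tridiagonal form\<close>

lemma L2_set_reindex_le:
  assumes "finite A" "inj_on f A" "f ` A \<subseteq> I" "finite I"
  shows "L2_set (\<lambda>i. u (f i)) A \<le> L2_set u I"
proof -
  have "(\<Sum>i\<in>A. (u (f i))\<^sup>2) = (\<Sum>i\<in>f ` A. (u i)\<^sup>2)"
    using assms(2) by (simp add: sum.reindex)
  also have "\<dots> \<le> (\<Sum>i\<in>I. (u i)\<^sup>2)"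
    using assms by (intro sum_mono2) auto
  finally show ?thesis by (simp add: L2_set_def)
qed

text \<open>Cauchy-Schwarz along one diagonal, with \<open>f\<close> and \<open>g\<close> giving the
  row and the column. Terms whose indices leave the range have coefficient zero and drop out before
  the inequality is applied.\<close>

lemma abs_weighted_sum_le:
  fixes c :: "'k \<Rightarrow> real"
  assumes fin: "finite K" "finite I" "finite J" and inj: "inj f" "inj g"
    and c: "\<And>k. k \<in> K \<Longrightarrow> \<bar>c k\<bar> \<le> C" "\<And>k. k \<in> K \<Longrightarrow> c k \<noteq> 0 \<Longrightarrow> f k \<in> I \<and> g k \<in> J" and C: "C \<ge> 0"
  shows "\<bar>\<Sum>k\<in>K. c k * u (f k) * v (g k)\<bar> \<le> C * (L2_set u I * L2_set v J)"
proof -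
  define A where "A = {k \<in> K. c k \<noteq> 0}"
  have A: "finite A" "A \<subseteq> K" using fin by (auto simp: A_def)
  have "(\<Sum>k\<in>K. c k * u (f k) * v (g k)) = (\<Sum>k\<in>A. c k * u (f k) * v (g k))"
    using A fin by (intro sum.mono_neutral_right) (auto simp: A_def)
  then have "\<bar>\<Sum>k\<in>K. c k * u (f k) * v (g k)\<bar> \<le> (\<Sum>k\<in>A. \<bar>c k * u (f k) * v (g k)\<bar>)"
    by simp
  also have "\<dots> \<le> (\<Sum>k\<in>A. C * (\<bar>u (f k)\<bar> * \<bar>v (g k)\<bar>))"
    by (rule sum_mono) (use c A in \<open>auto simp: abs_mult mult.assoc intro!: mult_right_mono\<close>)
  also have "\<dots> = C * (\<Sum>k\<in>A. \<bar>u (f k)\<bar> * \<bar>v (g k)\<bar>)"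
    by (simp add: sum_distrib_left)
  also have "\<dots> \<le> C * (L2_set (\<lambda>k. u (f k)) A * L2_set (\<lambda>k. v (g k)) A)"
    by (intro mult_left_mono L2_set_mult_ineq C)
  also have "\<dots> \<le> C * (L2_set u I * L2_set v J)"
  proof (intro mult_left_mono mult_mono C)
    show "L2_set (\<lambda>k. u (f k)) A \<le> L2_set u I" "L2_set (\<lambda>k. v (g k)) A \<le> L2_set v J"
      using A fin inj c(2) by (auto intro!: L2_set_reindex_le simp: A_def intro: inj_on_subset)
  qed auto
  finally show ?thesis .
qed

lemma frame_mapD:
  assumes "frame_map j N U"
  shows "ip {j..<N} (U x) (U x) = ip {j..<N} x x" "L2_set (U x) {j..<N} = L2_set x {j..<N}"
    "j < N \<Longrightarrow> U x j = x j" "\<exists>x. \<forall>i\<in>{j..<N}. U x i = z i"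
  using assms unfolding frame_map_def L2_eq_sqrt_ip by simp_all

text \<open>The norm is at most the sum of the norms of the three diagonals. The main one is
  negligible when \<open>s\<close> is small against \<open>N\<close>, and the other two together
  give the sharp 2 sqrt N.\<close>

lemma tridiagonalizable_bound:
  assumes T: "tridiagonalizable s N1 N2 0 B" and N: "N1 \<le> N" "N2 \<le> N" and s: "s \<ge> 0"
  shows "\<bar>bil {0..<N1} {0..<N2} B x y\<bar> \<le>
    (sqrt (1 + s) + 2 * sqrt (real N + s)) * (L2_set x {0..<N1} * L2_set y {0..<N2})"
proof -
  obtain U V d p q where U: "frame_map 0 N1 U" and V: "frame_map 0 N2 V"
    and form: "bil {0..<N1} {0..<N2} B x y = tridiagonal_form {0..<min N1 N2} U V d p q x y"
    and bnd: "\<And>i. i \<in> {0..<min N1 N2} \<Longrightarrow> tridiagonal_bounds s N1 N2 d p q i"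
    using T unfolding tridiagonalizable_def by blast
  have LU: "L2_set (U x) {0..<N1} = L2_set x {0..<N1}" and LV: "L2_set (V y) {0..<N2} = L2_set y {0..<N2}"
    using frame_mapD(2)[OF U] frame_mapD(2)[OF V] by simp_all
  let ?K = "{0..<min N1 N2}" and ?L = "L2_set x {0..<N1} * L2_set y {0..<N2}"
  have b: "\<bar>d i\<bar> \<le> sqrt (1 + s)" "\<bar>p i\<bar> \<le> sqrt (real N + s)" "\<bar>q i\<bar> \<le> sqrt (real N + s)"
     "p i \<noteq> 0 \<Longrightarrow> Suc i < N1" "q i \<noteq> 0 \<Longrightarrow> Suc i < N2"
    if i: "i \<in> ?K" for i
  proof -
    have *: "(d i)\<^sup>2 \<le> 1 + s" "p i \<ge> 0" "q i \<ge> 0" "\<bar>(p i)\<^sup>2 - real (card {Suc i..<N1})\<bar> \<le> s"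
      "\<bar>(q i)\<^sup>2 - real (card {Suc i..<N2})\<bar> \<le> s" "Suc i \<ge> N1 \<longrightarrow> p i = 0" "Suc i \<ge> N2 \<longrightarrow> q i = 0"
      using bnd[OF i] by (auto simp: tridiagonal_bounds_def)
    have "real (card {Suc i..<N1}) \<le> real N" "real (card {Suc i..<N2}) \<le> real N" using N by auto
    then have "(p i)\<^sup>2 \<le> real N + s" "(q i)\<^sup>2 \<le> real N + s" using *(4,5) by linarith+
    then show "\<bar>d i\<bar> \<le> sqrt (1 + s)" "\<bar>p i\<bar> \<le> sqrt (real N + s)" "\<bar>q i\<bar> \<le> sqrt (real N + s)"
      using *(1) by (auto intro!: real_le_rsqrt)
    show "p i \<noteq> 0 \<Longrightarrow> Suc i < N1" "q i \<noteq> 0 \<Longrightarrow> Suc i < N2" using *(6,7) by force+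
  qed
  have "\<bar>\<Sum>i\<in>?K. d i * U x i * V y i\<bar> \<le> sqrt (1 + s) * ?L"
    unfolding LU[symmetric] LV[symmetric]
    by (rule abs_weighted_sum_le[where f="\<lambda>i. i" and g="\<lambda>i. i"]) (use b(1) s in auto)
  moreover have "\<bar>\<Sum>i\<in>?K. p i * U x (Suc i) * V y i\<bar> \<le> sqrt (real N + s) * ?L"
    unfolding LU[symmetric] LV[symmetric]
    by (rule abs_weighted_sum_le[where f=Suc and g="\<lambda>i. i"]) (use b(2,4) s in auto)
  moreover have "\<bar>\<Sum>i\<in>?K. q i * U x i * V y (Suc i)\<bar> \<le> sqrt (real N + s) * ?L"
    unfolding LU[symmetric] LV[symmetric]
    by (rule abs_weighted_sum_le[where f="\<lambda>i. i" and g=Suc]) (use b(3,5) s in auto)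
  moreover have "(sqrt (1 + s) + 2 * sqrt (real N + s)) * ?L =
      sqrt (1 + s) * ?L + sqrt (real N + s) * ?L + sqrt (real N + s) * ?L"
    by (simp add: algebra_simps)
  ultimately show ?thesis
    unfolding form tridiagonal_form_def sum.distrib by linarith
qed

text \<open>Near the corner the form resembles sqrt N times the Toeplitz form with ones next to the
  diagonal; with a corner entry l > 1 added, the latter has the eigenvector (1, t, t^2, ...) with t
  = 1 / l and eigenvalue l + 1 / l. The vectors \<open>x\<close> and \<open>y\<close> have these
  frame coordinates, cut off at \<open>L\<close>. Since the frames begin with the first unit vector,
  \<open>x 0 = y 0 = 1\<close> and the full spike is seen. The sum \<open>S'\<close> is one term
  shorter because two neighbouring coordinates must lie below \<open>L\<close>.\<close>

lemma tridiagonalizable_test_vectors: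
  assumes T: "tridiagonalizable s N N 0 B" and L: "1 \<le> L" "L < N" "real L + s \<le> real N" and s: "s \<ge> 0" and t: "t \<ge> 0"
  defines "S \<equiv> (\<Sum>i<L. t ^ (2 * i))" and "S' \<equiv> (\<Sum>i<L - 1. t ^ (2 * i))"
  shows "\<exists>x y. x 0 = 1 \<and> y 0 = 1 \<and> ip {0..<N} x x = S \<and> ip {0..<N} y y = S \<and>
    bil {0..<N} {0..<N} B x y \<ge> 2 * sqrt (real N - real L - s) * t * S' - sqrt (1 + s) * S"
proof -
  obtain U V d p q where U: "frame_map 0 N U" and V: "frame_map 0 N V"
    and form: "\<And>x y. bil {0..<N} {0..<N} B x y = tridiagonal_form {0..<N} U V d p q x y"
    and bnd: "\<And>i. i \<in> {0..<N} \<Longrightarrow> tridiagonal_bounds s N N d p q i"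
    using T unfolding tridiagonalizable_def by auto
  have LN: "L \<le> N" using L(2) by simp
  define z where "z i = (if i < L then t ^ i else 0)" for i
  obtain x where x: "\<forall>i\<in>{0..<N}. U x i = z i" using frame_mapD(4)[OF U] by blast
  obtain y where y: "\<forall>i\<in>{0..<N}. V y i = z i" using frame_mapD(4)[OF V] by blast
  have xy0: "x 0 = 1" "y 0 = 1"
    using frame_mapD(3)[OF U, of x] frame_mapD(3)[OF V, of y] x y L by (simp_all add: z_def)
  have zz: "(\<Sum>i\<in>{0..<N}. z i * z i) = S"
  proof -
    have "(\<Sum>i\<in>{0..<N}. z i * z i) = (\<Sum>i\<in>{..<L}. z i * z i)"
      by (rule sum.mono_neutral_right) (use LN in \<open>auto simp: z_def\<close>)
    also have "\<dots> = S" unfolding S_def by (rule sum.cong) (auto simp: z_def power_add[symmetric] mult_2)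
    finally show ?thesis .
  qed
  have xx: "ip {0..<N} x x = S" "ip {0..<N} y y = S"
  proof -
    have "ip {0..<N} (U x) (U x) = S" "ip {0..<N} (V y) (V y) = S"
      using x y by (simp_all add: ip_def zz)
    then show "ip {0..<N} x x = S" "ip {0..<N} y y = S"
      using frame_mapD(1)[OF U] frame_mapD(1)[OF V] by simp_all
  qed
  let ?P = "sqrt (real N - real L - s)"
  have pq: "p i \<ge> ?P" "q i \<ge> ?P" if "i < L - 1" for i
  proof -
    have i: "i \<in> {0..<N}" using that LN by auto
    then have *: "p i \<ge> 0" "q i \<ge> 0" "\<bar>(p i)\<^sup>2 - real (card {Suc i..<N})\<bar> \<le> s" "\<bar>(q i)\<^sup>2 - real (card {Suc i..<N})\<bar> \<le> s"
      using bnd[OF i] by (auto simp: tridiagonal_bounds_def)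
    have "real (card {Suc i..<N}) \<ge> real N - real L" using that LN by auto
    then have "real N - real L - s \<le> (p i)\<^sup>2" "real N - real L - s \<le> (q i)\<^sup>2" using * by linarith+
    then show "p i \<ge> ?P" "q i \<ge> ?P" using *(1,2) by (auto intro: real_le_lsqrt)
  qed
  have d: "- (sqrt (1 + s) * S) \<le> (\<Sum>i\<in>{0..<N}. d i * U x i * V y i)"
  proof -
    have "\<bar>d i\<bar> \<le> sqrt (1 + s)" if "i \<in> {0..<N}" for i
      using bnd[OF that] by (auto simp: tridiagonal_bounds_def intro!: real_le_rsqrt)
    then have "\<bar>\<Sum>i\<in>{0..<N}. d i * U x i * V y i\<bar> \<le> sqrt (1 + s) * (L2_set (U x) {0..<N} * L2_set (V y) {0..<N})"
      by (intro abs_weighted_sum_le[where f="\<lambda>i. i" and g="\<lambda>i. i"]) (use s in auto)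
    moreover have "L2_set (U x) {0..<N} * L2_set (V y) {0..<N} = S"
    proof -
      have "L2_set (U x) {0..<N} = sqrt S" "L2_set (V y) {0..<N} = sqrt S"
        using frame_mapD(2)[OF U] frame_mapD(2)[OF V] xx by (simp_all add: L2_eq_sqrt_ip)
      moreover have "S \<ge> 0" using t by (auto simp: S_def intro: sum_nonneg)
      ultimately show ?thesis by simp
    qed
    ultimately show ?thesis by simp
  qed
  have off: "?P * t * S' \<le> (\<Sum>i\<in>{0..<N}. c i * a (Suc i) * b i)"
    if c: "\<And>i. i < L - 1 \<Longrightarrow> c i \<ge> ?P" and ab: "\<forall>i\<in>{0..<N}. a i = z i" "\<forall>i\<in>{0..<N}. b i = z i"
    for c a b
  proof -
    have "?P * t * S' = (\<Sum>i<L - 1. ?P * z (Suc i) * z i)"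
      unfolding S'_def sum_distrib_left
      by (rule sum.cong) (auto simp: z_def power_add mult_2)
    also have "\<dots> \<le> (\<Sum>i<L - 1. c i * a (Suc i) * b i)"
    proof (rule sum_mono)
      fix i assume i: "i \<in> {..<L - 1}"
      then have "a (Suc i) = z (Suc i)" "b i = z i" using ab LN by auto
      moreover have "z (Suc i) \<ge> 0" "z i \<ge> 0" using t by (auto simp: z_def)
      ultimately show "?P * z (Suc i) * z i \<le> c i * a (Suc i) * b i"
        using c i by (auto intro!: mult_right_mono)
    qed
    also have "\<dots> = (\<Sum>i\<in>{0..<N}. c i * a (Suc i) * b i)"
    proof (rule sum.mono_neutral_left)
      show "{..<L - 1} \<subseteq> {0..<N}" using LN by auto
      show "\<forall>i\<in>{0..<N} - {..<L - 1}. c i * a (Suc i) * b i = 0"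
      proof
        fix i assume i: "i \<in> {0..<N} - {..<L - 1}"
        then have bi: "b i = z i" using ab by auto
        show "c i * a (Suc i) * b i = 0"
        proof (cases "i = L - 1")
          case True
          then have "a (Suc i) = 0" using ab(1) L by (auto simp: z_def)
          then show ?thesis by simp
        next
          case False
          then have "b i = 0" using i bi by (auto simp: z_def)
          then show ?thesis by simp
        qed
      qed
    qed auto
    finally show ?thesis .
  qed
  have "?P * t * S' \<le> (\<Sum>i\<in>{0..<N}. p i * U x (Suc i) * V y i)"
    by (rule off) (use pq x y in auto)
  moreover have "?P * t * S' \<le> (\<Sum>i\<in>{0..<N}. q i * V y (Suc i) * U x i)"
    by (rule off) (use pq x y in auto)
  ultimately have "bil {0..<N} {0..<N} B x y \<ge> 2 * ?P * t * S' - sqrt (1 + s) * S"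
    using d unfolding form tridiagonal_form_def sum.distrib by (simp add: mult.assoc mult.commute mult.left_commute)
  then show ?thesis using xy0 xx by blast
qed

text \<open>At the optimal parameter \<open>t = 1 / l\<close> the test vectors \<open>t\<^sup>i\<close> give the quotient \<open>2 l - l / S\<close>, with limit
  \<open>l + 1 / l\<close>; this exceeds the limit \<open>2\<close> of the norm of the noise.\<close>

lemma spike_constants:
  fixes l0 :: real
  assumes "l0 > 1"
  shows "\<exists>\<delta> L \<kappa> c. 0 < \<delta> \<and> 2 * \<delta> \<le> 1 \<and> 0 < \<kappa> \<and> 0 < c \<and> 1 \<le> L \<and> sqrt (2 * \<delta>) + 2 * sqrt (1 + \<delta>) \<le> 2 + \<kappa> \<and>
    (let t = 1 / l0; S = (\<Sum>i<L. t ^ (2 * i)); S' = (\<Sum>i<L - 1. t ^ (2 * i)) in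
      S > 0 \<and> (\<forall>l\<ge>l0. (l + 2 * sqrt (1 - 2 * \<delta>) * t * S' - sqrt (2 * \<delta>) * S) / S \<ge> 2 + \<kappa> + max \<kappa> (c * l)))"
proof -
  define t where "t = 1 / l0"
  have t: "0 < t" "t < 1" "t * l0 = 1" using assms by (auto simp: t_def)
  define g where "g = l0 + t - 2"
  have g: "g > 0"
  proof -
    have "g * l0 = (l0 - 1)\<^sup>2" using t(3) by (simp add: g_def power2_eq_square algebra_simps)
    then have "0 < g * l0" using assms by simp
    then show ?thesis using zero_less_mult_pos2[of g l0] assms by simp
  qed
  \<comment> \<open>\<open>g\<close> is the room between l + 1 / l and 2 at \<open>l0\<close>.
    Truncation at \<open>L\<close> costs at most \<open>g / 4\<close> and the errors governed by
    \<open>\<delta>\<close> at most \<open>\<kappa>\<close>; the rest exceeds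
    \<open>2 * \<kappa>\<close>. The auxiliary \<open>\<eta>\<close> is
    \<open>sqrt (2 * \<delta>)\<close>.\<close>
  define \<kappa> where "\<kappa> = g / 8"
  define \<eta> where "\<eta> = min (1/2) (\<kappa> / (2 * l0 + 2))"
  define \<delta> where "\<delta> = \<eta>\<^sup>2 / 2"
  have \<kappa>: "\<kappa> > 0" using g by (simp add: \<kappa>_def)
  have \<eta>: "0 < \<eta>" "\<eta> \<le> 1/2" "(2 * l0 + 2) * \<eta> \<le> \<kappa>"
  proof -
    have "\<eta> \<le> \<kappa> / (2 * l0 + 2)" by (simp add: \<eta>_def)
    then show "(2 * l0 + 2) * \<eta> \<le> \<kappa>" using assms by (simp add: field_simps)
    show "\<eta> \<le> 1/2" unfolding \<eta>_def by (rule min.cobounded1)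
  qed (use \<kappa> assms in \<open>auto simp: \<eta>_def\<close>)
  have ee: "\<eta>\<^sup>2 \<le> \<eta> / 2" using \<eta> mult_left_mono[OF \<eta>(2), of \<eta>] by (simp add: power2_eq_square)
  have \<delta>: "0 < \<delta>" "2 * \<delta> \<le> 1" "sqrt (2 * \<delta>) = \<eta>" using \<eta> ee by (auto simp: \<delta>_def)
  have "2 * \<eta> \<le> (2 * l0 + 2) * \<eta>" using \<eta> assms by (intro mult_right_mono) auto
  then have e2: "2 * \<eta> \<le> \<kappa>" using \<eta>(3) by linarith
  have "sqrt (1 + \<delta>) \<le> 1 + \<delta>" using \<delta> by (intro real_le_lsqrt) (auto simp: power2_eq_square algebra_simps)
  then have up: "sqrt (2 * \<delta>) + 2 * sqrt (1 + \<delta>) \<le> 2 + \<kappa>"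
    unfolding \<delta>(3) using e2 ee \<eta> unfolding \<delta>_def by linarith
  have lo: "sqrt (1 - 2 * \<delta>) \<ge> 1 - \<eta>"
  proof (rule real_le_rsqrt)
    have "(1 - \<eta>)\<^sup>2 = 1 - 2 * \<eta> + \<eta>\<^sup>2" by (simp add: power2_eq_square algebra_simps)
    then show "(1 - \<eta>)\<^sup>2 \<le> 1 - 2 * \<delta>" using ee \<eta> by (simp add: \<delta>_def)
  qed
  have t2: "t\<^sup>2 < 1" using t by (simp add: power_less_one_iff abs_square_less_1)
  have "(\<lambda>n. t ^ (2 * n)) sums (1 / (1 - t\<^sup>2))"
    using geometric_sums[of "t\<^sup>2"] t2 by (simp add: power_mult)
  then have "(\<lambda>L. \<Sum>i<L. t ^ (2 * i)) \<longlonglongrightarrow> 1 / (1 - t\<^sup>2)" by (simp add: sums_def)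
  then have "(\<lambda>L. l0 / (\<Sum>i<L. t ^ (2 * i))) \<longlonglongrightarrow> l0 / (1 / (1 - t\<^sup>2))"
    using t2 by (intro tendsto_intros) auto
  moreover have "l0 / (1 / (1 - t\<^sup>2)) < l0 * (1 - t\<^sup>2) + g / 4" using g by simp
  ultimately have "\<forall>\<^sub>F L in sequentially. l0 / (\<Sum>i<L. t ^ (2 * i)) < l0 * (1 - t\<^sup>2) + g / 4"
    by (rule order_tendstoD)
  with eventually_ge_at_top[of 1] have "\<forall>\<^sub>F L in sequentially. 1 \<le> L \<and> l0 / (\<Sum>i<L. t ^ (2 * i)) < l0 * (1 - t\<^sup>2) + g / 4"
    by eventually_elim auto
  then obtain L :: nat where L: "1 \<le> L" and LS: "l0 / (\<Sum>i<L. t ^ (2 * i)) < l0 * (1 - t\<^sup>2) + g / 4"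
    by (auto simp: eventually_sequentially)
  define S where "S = (\<Sum>i<L. t ^ (2 * i))"
  define S' where "S' = (\<Sum>i<L - 1. t ^ (2 * i))"
  \<comment> \<open>Shifting the geometric sum by one term; with \<open>t * l0 = 1\<close> this
    turns the off-diagonal contribution \<open>t * S'\<close> into
    \<open>l0 * (S - 1)\<close>.\<close>
  have "S = 1 + t\<^sup>2 * S'"
  proof -
    have "S = (\<Sum>i<Suc (L - 1). t ^ (2 * i))" using L by (simp add: S_def)
    also have "\<dots> = 1 + t\<^sup>2 * S'"
      by (subst sum.lessThan_Suc_shift) (simp add: S'_def sum_distrib_left power_add[symmetric])
    finally show ?thesis .
  qed
  then have "l0 * (t * (t * S')) = l0 * (S - 1)" by (simp add: power2_eq_square)
  moreover have "l0 * (t * (t * S')) = (t * l0) * (t * S')" by (simp only: mult_ac)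
  ultimately have tS: "t * S' = l0 * (S - 1)" using t(3) by simp
  have S'0: "S' \<ge> 0" using t by (auto simp: S'_def intro: sum_nonneg)
  have S1: "S \<ge> 1" using \<open>S = 1 + t\<^sup>2 * S'\<close> S'0 by simp
  have main: "l0 / S + (2 * sqrt (1 - 2 * \<delta>) * t * S' - sqrt (2 * \<delta>) * S) / S \<ge> 2 + 2 * \<kappa>"
  proof -
    define X where "X = (2 * sqrt (1 - 2 * \<delta>) * t * S' - sqrt (2 * \<delta>) * S) / S"
    define Y where "Y = 2 * (1 - \<eta>) * (l0 - l0 / S)"
    have "(1 - \<eta>) * (t * S') \<le> sqrt (1 - 2 * \<delta>) * (t * S')"
      using lo t S'0 by (intro mult_right_mono) auto
    then have "(2 * (1 - \<eta>) * (l0 * (S - 1)) - \<eta> * S) / S \<le> (2 * sqrt (1 - 2 * \<delta>) * t * S' - sqrt (2 * \<delta>) * S) / S"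
      unfolding \<delta>(3) tS[symmetric] mult.assoc using S1 by (intro divide_right_mono) linarith+
    moreover have "(2 * (1 - \<eta>) * (l0 * (S - 1)) - \<eta> * S) / S = 2 * (1 - \<eta>) * (l0 - l0 / S) - \<eta>"
      using S1 by (simp add: field_simps)
    ultimately have le1: "Y - \<eta> \<le> X" unfolding X_def Y_def by linarith
    have le2: "2 * (1 - \<eta>) * (l0 - l0 / S) \<ge> 2 * (l0 - l0 / S) - 2 * l0 * \<eta>"
    proof -
      have "l0 / S \<ge> 0" using assms S1 by simp
      then have "\<eta> * (l0 - l0 / S) \<le> \<eta> * l0" using \<eta> by (intro mult_left_mono) auto
      moreover have "2 * (1 - \<eta>) * (l0 - l0 / S) = 2 * (l0 - l0 / S) - 2 * (\<eta> * (l0 - l0 / S))"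
        by (simp add: left_diff_distrib)
      moreover have "2 * l0 * \<eta> = 2 * (\<eta> * l0)" by simp
      ultimately show ?thesis by linarith
    qed
    have le3: "l0 / S < l0 - t + g / 4"
    proof -
      have "l0 * (1 - t\<^sup>2) = l0 - t" using t(3) by (simp add: algebra_simps power2_eq_square)
      then show ?thesis using LS by (simp add: S_def)
    qed
    have le4: "2 * (l0 * \<eta>) + \<eta> \<le> \<kappa>" using \<eta> by (simp add: algebra_simps)
    have le5: "2 * (l0 - l0 / S) - 2 * (l0 * \<eta>) \<le> Y" using le2 unfolding Y_def by (simp only: mult.assoc)
    have "2 + 2 * \<kappa> \<le> Q + X"
      if "Y - \<eta> \<le> X" "2 * (l0 - Q) - 2 * E \<le> Y" "Q < l0 - t + g / 4" "2 * E + \<eta> \<le> \<kappa>" for Q E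
    proof -
      have "2 * l0 - 2 * Q - 2 * E \<le> Y" using that(2) by (simp add: right_diff_distrib)
      then have "2 * l0 - 2 * Q - \<kappa> \<le> X" using that(1,4) by linarith
      then have "l0 + t - g / 4 - \<kappa> \<le> Q + X" using that(3) by linarith
      moreover have "l0 + t = g + 2" "g = 8 * \<kappa>" by (simp_all add: g_def \<kappa>_def)
      ultimately show ?thesis using \<kappa> by linarith
    qed
    from this[OF le1 le5 le3 le4] show ?thesis unfolding X_def .
  qed
  \<comment> \<open>The quotient is affine in \<open>l\<close> with slope \<open>1 / S\<close>. A
    smaller slope that also satisfies \<open>c * l0 \<le> \<kappa>\<close> keeps
    \<open>2 + \<kappa> + c * l\<close> below it for all \<open>l \<ge> l0\<close>.\<close>
  define c where "c = min (1 / S) (\<kappa> / l0)"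
  have c: "c > 0" "c \<le> 1 / S" "c * l0 \<le> \<kappa>"
  proof -
    have "c \<le> \<kappa> / l0" by (simp add: c_def)
    then show "c * l0 \<le> \<kappa>" using assms by (simp add: field_simps)
  qed (use \<kappa> S1 assms in \<open>auto simp: c_def\<close>)
  have fin: "(l + 2 * sqrt (1 - 2 * \<delta>) * t * S' - sqrt (2 * \<delta>) * S) / S \<ge> 2 + \<kappa> + max \<kappa> (c * l)" if "l \<ge> l0" for l
  proof -
    have "(l + 2 * sqrt (1 - 2 * \<delta>) * t * S' - sqrt (2 * \<delta>) * S) / S =
      (l - l0) * (1 / S) + (l0 / S + (2 * sqrt (1 - 2 * \<delta>) * t * S' - sqrt (2 * \<delta>) * S) / S)"
      by (simp add: add_divide_distrib diff_divide_distrib)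
    moreover have "(l - l0) * (1 / S) \<ge> (l - l0) * c" using that c by (intro mult_left_mono) auto
    moreover have "(l - l0) * c \<ge> 0" using that c by simp
    moreover have "(l - l0) * c = c * l - c * l0" by (simp add: algebra_simps)
    ultimately show ?thesis using main c(3) by linarith
  qed
  show ?thesis
    by (rule exI[of _ \<delta>], rule exI[of _ L], rule exI[of _ \<kappa>], rule exI[of _ c])
       (unfold Let_def t_def[symmetric] S_def[symmetric] S'_def[symmetric],
        use \<delta>(1,2) \<kappa> c(1) L up fin S1 in auto)
qed

section \<open>Singular vectors of spiked matrices\<close>

definition mv :: "'i set \<Rightarrow> 'j set \<Rightarrow> ('i \<times> 'j \<Rightarrow> real) \<Rightarrow> ('j \<Rightarrow> real) \<Rightarrow> 'i \<Rightarrow> real" where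
  "mv I J A y = (\<lambda>i\<in>I. ip J (\<lambda>j. A (i, j)) y)"

definition tmv :: "'i set \<Rightarrow> 'j set \<Rightarrow> ('i \<times> 'j \<Rightarrow> real) \<Rightarrow> ('i \<Rightarrow> real) \<Rightarrow> 'j \<Rightarrow> real" where
  "tmv I J A x = (\<lambda>j\<in>J. ip I (\<lambda>i. A (i, j)) x)"

definition gram :: "'i set \<Rightarrow> 'j set \<Rightarrow> ('i \<times> 'j \<Rightarrow> real) \<Rightarrow> ('j \<Rightarrow> real) \<Rightarrow> 'j \<Rightarrow> real" where
  "gram I J A y = tmv I J A (mv I J A y)"

definition perp :: "'i set \<Rightarrow> ('i \<Rightarrow> real) \<Rightarrow> ('i \<Rightarrow> real) \<Rightarrow> 'i \<Rightarrow> real" where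
  "perp I e x = (\<lambda>i\<in>I. x i - ip I e x * e i)"

text \<open>Maximality is expressed as a bound on the bilinear form, not by comparison with other
  singular triples; \<open>top_singular_triple_top_pair\<close> connects the two.\<close>

definition top_pair ::
  "'i set \<Rightarrow> 'j set \<Rightarrow> ('i \<times> 'j \<Rightarrow> real) \<Rightarrow> real \<Rightarrow> ('i \<Rightarrow> real) \<Rightarrow> ('j \<Rightarrow> real) \<Rightarrow> bool" where
  "top_pair I J A \<sigma> u v \<longleftrightarrow> L2_set u I = 1 \<and> L2_set v J = 1 \<and>
     (\<forall>i\<in>I. mv I J A v i = \<sigma> * u i) \<and> (\<forall>j\<in>J. tmv I J A u j = \<sigma> * v j) \<and>
     (\<forall>x y. bil I J A x y \<le> \<sigma> * (L2_set x I * L2_set y J))"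

lemma ip_mv: "ip I x (mv I J A y) = bil I J A x y"
  unfolding bil_def by (rule ip_cong) (auto simp: mv_def)

lemma ip_tmv: "ip J (tmv I J A x) y = bil I J A x y"
  unfolding bil_alt by (rule ip_cong) (auto simp: tmv_def ip_commute)

lemma ip_gram: "ip J (gram I J A x) y = ip I (mv I J A x) (mv I J A y)"
  by (simp add: gram_def ip_tmv ip_mv)

lemma mv_combine: "i \<in> I \<Longrightarrow> mv I J A (\<lambda>j. a * x j + b * y j) i = a * mv I J A x i + b * mv I J A y i"
  by (simp add: mv_def ip_simps)

lemma tmv_combine: "j \<in> J \<Longrightarrow> tmv I J A (\<lambda>j. a * x j + b * y j) j = a * tmv I J A x j + b * tmv I J A y j"
  by (simp add: tmv_def ip_simps)

lemma mv_cong: "(\<And>j. j \<in> J \<Longrightarrow> x j = y j) \<Longrightarrow> mv I J A x = mv I J A y"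
  unfolding mv_def by (intro restrict_ext ip_cong) auto

lemma tmv_cong: "(\<And>j. j \<in> I \<Longrightarrow> x j = y j) \<Longrightarrow> tmv I J A x = tmv I J A y"
  unfolding tmv_def by (intro restrict_ext ip_cong) auto

lemma gram_cong: "(\<And>j. j \<in> J \<Longrightarrow> x j = y j) \<Longrightarrow> gram I J A x = gram I J A y"
  using mv_cong[of J x y I A] by (simp add: gram_def)

lemma gram_combine:
  assumes "j \<in> J"
  shows "gram I J A (\<lambda>j. a * x j + b * y j) j = a * gram I J A x j + b * gram I J A y j"
proof -
  have "gram I J A (\<lambda>j. a * x j + b * y j) = tmv I J A (\<lambda>i. a * mv I J A x i + b * mv I J A y i)"
    unfolding gram_def by (rule tmv_cong) (simp add: mv_combine)
  then show ?thesis using assms by (simp add: tmv_combine gram_def)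
qed

lemma bil_add_rank_one:
  assumes "\<And>i j. i \<in> I \<Longrightarrow> j \<in> J \<Longrightarrow> W (i, j) = a * v i * v' j + D (i, j)"
  shows "bil I J W x y = a * (ip I v x * ip J v' y) + bil I J D x y"
proof -
  have "bil I J W x y = ip I x (\<lambda>i. (a * ip J v' y) * v i + ip J (\<lambda>j. D (i, j)) y)"
    unfolding bil_def
  proof (rule ip_cong)
    fix i assume i: "i \<in> I"
    have "ip J (\<lambda>j. W (i, j)) y = ip J (\<lambda>j. (a * v i) * v' j + D (i, j)) y"
      by (rule ip_cong) (use assms i in auto)
    then show "ip J (\<lambda>j. W (i, j)) y = (a * ip J v' y) * v i + ip J (\<lambda>j. D (i, j)) y"
      by (simp add: ip_simps)
  qed simp
  then show ?thesis unfolding bil_def ip_simps by (simp add: ip_commute[of I x v])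
qed

lemma L2_set_mv_le:
  assumes "\<And>x. bil I J A x y \<le> s * (L2_set x I * L2_set y J)" "s \<ge> 0"
  shows "L2_set (mv I J A y) I \<le> s * L2_set y J"
proof (cases "L2_set (mv I J A y) I = 0")
  case True
  then show ?thesis using assms(2) by simp
next
  case False
  then have pos: "L2_set (mv I J A y) I > 0" by (simp add: order_less_le)
  have "L2_set (mv I J A y) I * L2_set (mv I J A y) I = bil I J A (mv I J A y) y"
    by (simp add: ip_mv[symmetric] ip_self_L2 power2_eq_square)
  also have "\<dots> \<le> (s * L2_set y J) * L2_set (mv I J A y) I"
    using assms(1)[of "mv I J A y"] by (simp add: mult_ac)
  finally show ?thesis using pos by simp
qed

lemma bil_le_of_L2_set_mv:
  assumes "\<And>y. L2_set (mv I J A y) I \<le> s * L2_set y J"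
  shows "bil I J A x y \<le> s * (L2_set x I * L2_set y J)"
proof -
  have "bil I J A x y \<le> L2_set x I * L2_set (mv I J A y) I"
    unfolding ip_mv[symmetric] using abs_ip_le[of I x "mv I J A y"] by linarith
  also have "\<dots> \<le> L2_set x I * (s * L2_set y J)" by (intro mult_left_mono assms) simp
  finally show ?thesis by (simp add: mult_ac)
qed

lemma top_pair_value:
  assumes "top_pair I J A \<sigma> u v"
  shows "\<sigma> = bil I J A u v" "\<sigma> \<ge> 0"
proof -
  have "bil I J A u v = ip I u (\<lambda>i. \<sigma> * u i)"
    unfolding ip_mv[symmetric] by (rule ip_cong) (use assms in \<open>auto simp: top_pair_def\<close>)
  then show s: "\<sigma> = bil I J A u v" using assms by (simp add: top_pair_def ip_simps ip_self_L2)
  have "bil I J A (\<lambda>i. (-1) * u i) v \<le> \<sigma> * (L2_set (\<lambda>i. (-1) * u i) I * L2_set v J)"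
    using assms unfolding top_pair_def by blast
  moreover have "L2_set (\<lambda>i. (-1) * u i) I = L2_set u I" by (simp add: L2_set_def)
  moreover have "bil I J A (\<lambda>i. (-1) * u i) v = - bil I J A u v"
    unfolding bil_def ip_scale_left by simp
  ultimately have "- \<sigma> \<le> \<sigma> * (L2_set u I * L2_set v J)" using s by simp
  then show "\<sigma> \<ge> 0" using assms by (simp add: top_pair_def)
qed

lemma top_pair_gram:
  assumes "top_pair I J A \<sigma> u v" "j \<in> J"
  shows "gram I J A v j = \<sigma>\<^sup>2 * v j"
proof -
  have "gram I J A v = tmv I J A (\<lambda>i. \<sigma> * u i + 0 * u i)"
    unfolding gram_def by (rule tmv_cong) (use assms in \<open>auto simp: top_pair_def\<close>)
  then show ?thesis
    using assms tmv_combine[of j J I A \<sigma> u 0 u] by (simp add: top_pair_def power2_eq_square)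
qed

text \<open>A spike \<open>\<beta> e e\<^sup>T\<close> on top of a matrix \<open>G\<close> of norm at most \<open>s < \<sigma>\<close>. Since \<open>A\<close> and \<open>G\<close> agree on the
  complement of \<open>e\<close>, all singular values of \<open>A\<close> other than the top one are at most \<open>s\<close>.\<close>

locale spiked =
  fixes I :: "'i set" and \<beta> s \<sigma> :: real and e u w :: "'i \<Rightarrow> real" and G A :: "'i \<times> 'i \<Rightarrow> real"
  assumes A: "\<And>i j. i \<in> I \<Longrightarrow> j \<in> I \<Longrightarrow> A (i, j) = \<beta> * e i * e j + G (i, j)"
    and e: "L2_set e I = 1" and \<beta>: "\<beta> \<ge> 0"
    and G: "\<And>x y. bil I I G x y \<le> s * (L2_set x I * L2_set y I)" and s: "s \<ge> 0"
    and top: "top_pair I I A \<sigma> u w"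
begin

lemma ip_w_w: "ip I w w = 1" and L2w: "L2_set w I = 1"
  using top by (auto simp: top_pair_def ip_self_L2)

lemma bil_A: "bil I I A x y = \<beta> * (ip I e x * ip I e y) + bil I I G x y"
  by (rule bil_add_rank_one) (rule A)

text \<open>Evaluate \<open>\<sigma>\<close> as the form at the top pair: the noise contributes at
  most \<open>s\<close>, and the spike at most its strength times the overlap of \<open>w\<close>,
  because \<open>\<bar>ip I e u\<bar> \<le> 1\<close>. A top value well above \<open>s\<close> thus
  forces an overlap.\<close>

lemma overlap: "\<sigma> \<le> \<beta> * \<bar>ip I e w\<bar> + s"
proof -
  have "\<sigma> = \<beta> * (ip I e u * ip I e w) + bil I I G u w"
    using top_pair_value(1)[OF top] bil_A by simp
  moreover have "bil I I G u w \<le> s" using G[of u w] top by (simp add: top_pair_def)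
  moreover have "ip I e u * ip I e w \<le> \<bar>ip I e w\<bar>"
  proof -
    have "\<bar>ip I e u\<bar> \<le> 1" using abs_ip_le[of I e u] e top by (simp add: top_pair_def)
    then have "\<bar>ip I e u\<bar> * \<bar>ip I e w\<bar> \<le> 1 * \<bar>ip I e w\<bar>" by (intro mult_right_mono) auto
    then show ?thesis by (simp add: abs_mult[symmetric])
  qed
  ultimately show ?thesis using mult_left_mono[OF _ \<beta>] by fastforce
qed

lemma L2_mv_perp:
  assumes "ip I e z = 0"
  shows "L2_set (mv I I A z) I \<le> s * L2_set z I"
  by (rule L2_set_mv_le) (use bil_A assms G s in auto)

text \<open>Min-max in the plane of \<open>x\<close> and \<open>w\<close>: some combination
  \<open>z\<close> of the two is orthogonal to \<open>e\<close>, and there \<open>A\<close> acts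
  like \<open>G\<close>. Since \<open>x\<close> and \<open>w\<close> are orthogonal and so are their
  images, Pythagoras splits |A z|^2 \<le> s^2 |z|^2; the share of \<open>w\<close> carries the
  factor \<sigma>^2 > s^2, so the share of \<open>x\<close> has to obey the bound.\<close>

lemma L2_mv_orth:
  assumes x: "ip I w x = 0" and gap: "s < \<sigma>"
  shows "L2_set (mv I I A x) I \<le> s * L2_set x I"
proof -
  define a where "a = ip I e w"
  define b where "b = - ip I e x"
  define z where "z j = a * x j + b * w j" for j
  have "ip I e z = 0" unfolding z_def ip_simps by (simp add: a_def b_def)
  then have "(L2_set (mv I I A z) I)\<^sup>2 \<le> (s * L2_set z I)\<^sup>2"
    by (intro power_mono L2_mv_perp) auto
  moreover have "(L2_set z I)\<^sup>2 = a\<^sup>2 * (L2_set x I)\<^sup>2 + b\<^sup>2"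
    unfolding ip_self_L2[symmetric] z_def ip_simps
    by (simp add: ip_commute[of I x w] x ip_w_w power2_eq_square algebra_simps)
  moreover have "(L2_set (mv I I A z) I)\<^sup>2 = a\<^sup>2 * (L2_set (mv I I A x) I)\<^sup>2 + b\<^sup>2 * \<sigma>\<^sup>2"
  proof -
    have "ip I (mv I I A z) (mv I I A z) = ip I (\<lambda>i. a * mv I I A x i + b * mv I I A w i) (\<lambda>i. a * mv I I A x i + b * mv I I A w i)"
      by (rule ip_cong) (simp_all add: mv_combine z_def[abs_def])
    moreover have g: "ip I (mv I I A w) (mv I I A y) = \<sigma>\<^sup>2 * ip I w y" for y
    proof -
      have "ip I (gram I I A w) y = ip I (\<lambda>j. \<sigma>\<^sup>2 * w j) y"
        by (rule ip_cong) (use top_pair_gram[OF top] in auto)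
      then show ?thesis by (simp add: ip_gram ip_simps)
    qed
    ultimately show ?thesis
      unfolding ip_self_L2[symmetric] ip_simps
      by (simp add: g ip_commute[of I "mv I I A x" "mv I I A w"] x ip_w_w power2_eq_square algebra_simps)
  qed
  ultimately have le: "a\<^sup>2 * (L2_set (mv I I A x) I)\<^sup>2 + b\<^sup>2 * \<sigma>\<^sup>2 \<le> s\<^sup>2 * (a\<^sup>2 * (L2_set x I)\<^sup>2 + b\<^sup>2)"
    by (simp add: power_mult_distrib)
  have ss: "s\<^sup>2 < \<sigma>\<^sup>2" using gap s by (intro power_strict_mono) auto
  \<comment> \<open>Otherwise \<open>w\<close> itself would be orthogonal to \<open>e\<close>, and
    \<sigma> = |A w| \<le> s.\<close>
  have a0: "a \<noteq> 0"
  proof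
    assume "a = 0"
    then have "L2_set (mv I I A w) I \<le> s * L2_set w I" by (intro L2_mv_perp) (simp add: a_def)
    moreover have "L2_set (mv I I A w) I = \<sigma>"
    proof -
      have "L2_set (mv I I A w) I = L2_set (\<lambda>i. \<sigma> * u i) I"
        by (rule L2_set_cong) (use top in \<open>auto simp: top_pair_def\<close>)
      also have "\<dots> = \<sigma> * L2_set u I" using top_pair_value(2)[OF top] by (simp add: L2_set_right_distrib)
      finally show ?thesis using top by (simp add: top_pair_def)
    qed
    ultimately show False using gap L2w by simp
  qed
  have "b\<^sup>2 * s\<^sup>2 \<le> b\<^sup>2 * \<sigma>\<^sup>2" using ss by (intro mult_left_mono) auto
  then have "a\<^sup>2 * (L2_set (mv I I A x) I)\<^sup>2 \<le> a\<^sup>2 * (s * L2_set x I)\<^sup>2"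
    using le by (simp add: power_mult_distrib algebra_simps)
  then have "(L2_set (mv I I A x) I)\<^sup>2 \<le> (s * L2_set x I)\<^sup>2" using a0 by simp
  then show ?thesis by (rule power2_le_imp_le) (use s in simp)
qed

lemma gram_orth:
  assumes x: "ip I w x = 0" and gap: "s < \<sigma>"
  shows "ip I w (gram I I A x) = 0" "L2_set (gram I I A x) I \<le> s\<^sup>2 * L2_set x I"
proof -
  have g: "ip I w (gram I I A y) = \<sigma>\<^sup>2 * ip I w y" for y
  proof -
    have "ip I w (gram I I A y) = ip I (mv I I A y) (mv I I A w)"
      by (subst ip_commute) (rule ip_gram)
    also have "\<dots> = ip I (mv I I A w) (mv I I A y)" by (rule ip_commute)
    also have "\<dots> = ip I (gram I I A w) y" by (rule ip_gram[symmetric])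
    also have "\<dots> = ip I (\<lambda>j. \<sigma>\<^sup>2 * w j) y"
      by (rule ip_cong) (use top_pair_gram[OF top] in auto)
    finally show ?thesis by (simp add: ip_simps)
  qed
  show f: "ip I w (gram I I A x) = 0" using g x by simp
  let ?f = "gram I I A x"
  have "(L2_set ?f I)\<^sup>2 = ip I (mv I I A x) (mv I I A ?f)"
    by (simp add: ip_self_L2[symmetric] ip_gram)
  also have "\<dots> \<le> L2_set (mv I I A x) I * L2_set (mv I I A ?f) I"
    using abs_ip_le[of I "mv I I A x" "mv I I A ?f"] by linarith
  also have "\<dots> \<le> (s * L2_set x I) * (s * L2_set ?f I)"
    by (intro mult_mono L2_mv_orth x f gap) (use s in auto)
  finally have *: "L2_set ?f I * L2_set ?f I \<le> (s\<^sup>2 * L2_set x I) * L2_set ?f I"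
    by (simp add: power2_eq_square mult_ac)
  show "L2_set ?f I \<le> s\<^sup>2 * L2_set x I"
  proof (cases "L2_set ?f I = 0")
    case True
    then show ?thesis by simp
  next
    case False
    then have "L2_set ?f I > 0" by (simp add: order_less_le)
    then show ?thesis using * by simp
  qed
qed

text \<open>Power method started at \<open>e\<close>: each step multiplies the component along
  \<open>w\<close> by \<sigma>^2 and the length of the orthogonal rest by at most s^2.\<close>

lemma gram_iterate:
  assumes gap: "s < \<sigma>"
  shows "\<exists>r. (\<forall>i\<in>I. (gram I I A ^^ L) e i = \<sigma> ^ (2 * L) * ip I e w * w i + r i) \<and>
    ip I w r = 0 \<and> L2_set r I \<le> s ^ (2 * L)"
proof (induction L)
  case 0
  define r where "r i = e i - ip I e w * w i" for i
  have "ip I w r = 0" unfolding r_def ip_simps by (simp add: ip_w_w ip_commute)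
  moreover have "(L2_set r I)\<^sup>2 \<le> 1\<^sup>2"
  proof -
    have "(L2_set r I)\<^sup>2 = 1 - (ip I e w)\<^sup>2"
      unfolding ip_self_L2[symmetric] r_def ip_simps
      by (simp add: ip_w_w ip_commute[of I w e] ip_self_L2[of I e] e power2_eq_square)
    then show ?thesis by simp
  qed
  then have "L2_set r I \<le> 1" by (rule power2_le_imp_le) simp
  moreover have "ip I e w * w i + r i = e i" for i by (simp add: r_def)
  ultimately show ?case by (intro exI[of _ r]) simp
next
  case (Suc L)
  then obtain r where r: "\<forall>i\<in>I. (gram I I A ^^ L) e i = \<sigma> ^ (2 * L) * ip I e w * w i + r i"
    "ip I w r = 0" "L2_set r I \<le> s ^ (2 * L)" by blast
  show ?case
  proof (intro exI[of _ "gram I I A r"] conjI ballI)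
    fix i assume i: "i \<in> I"
    have "gram I I A ((gram I I A ^^ L) e) = gram I I A (\<lambda>i. (\<sigma> ^ (2 * L) * ip I e w) * w i + 1 * r i)"
      by (rule gram_cong) (use r(1) in auto)
    then show "(gram I I A ^^ Suc L) e i = \<sigma> ^ (2 * Suc L) * ip I e w * w i + gram I I A r i"
      using i top_pair_gram[OF top i] gram_combine[OF i, of I A "\<sigma> ^ (2 * L) * ip I e w" w 1 r]
      by (simp add: power2_eq_square)
  next
    have "L2_set (gram I I A r) I \<le> s\<^sup>2 * L2_set r I" by (rule gram_orth(2)[OF r(2) gap])
    also have "\<dots> \<le> s\<^sup>2 * s ^ (2 * L)" using r(3) by (intro mult_left_mono) auto
    finally show "L2_set (gram I I A r) I \<le> s ^ (2 * Suc L)" by (simp add: power2_eq_square)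
  qed (rule gram_orth(1)[OF r(2) gap])
qed

lemma L2_perp_le: "L2_set (perp I e x) I \<le> L2_set x I"
proof (rule power2_le_imp_le)
  have "ip I (perp I e x) (perp I e x) = ip I (\<lambda>i. x i - ip I e x * e i) (\<lambda>i. x i - ip I e x * e i)"
    by (rule ip_cong) (auto simp: perp_def)
  also have "\<dots> = ip I x x - (ip I e x)\<^sup>2"
    unfolding ip_simps by (simp add: ip_commute[of I x e] ip_self_L2[of I e] e power2_eq_square)
  finally show "(L2_set (perp I e x) I)\<^sup>2 \<le> (L2_set x I)\<^sup>2"
    by (simp add: ip_self_L2[symmetric])
qed simp

text \<open>Solve the decomposition of \<open>gram_iterate\<close> for \<open>w\<close>: up to a
  remainder of size \<open>s ^ (2 * L)\<close>, the part of \<open>w\<close> orthogonal to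
  \<open>e\<close> is that of the iterate divided by \<open>\<sigma> ^ (2 * L) * ip I e w\<close>.
  The iterate has length at most 2 \<sigma>^(2L), so a bound relative to its length passes to
  \<open>w\<close> with a factor 2 and a division by \<open>c\<close>.\<close>

lemma functional_on_perp:
  assumes gap: "s < \<sigma>" and c: "0 < c" "c \<le> \<bar>ip I e w\<bar>"
    and h: "L2_set h I \<le> 1" and y: "\<bar>ip I h (perp I e ((gram I I A ^^ L) e))\<bar> \<le> \<eta> * L2_set (perp I e ((gram I I A ^^ L) e)) I"
    and \<eta>: "\<eta> \<ge> 0"
  shows "\<bar>ip I h (perp I e w)\<bar> \<le> (2 * \<eta> + (s / \<sigma>) ^ (2 * L)) / c"
proof -
  obtain r where r: "\<forall>i\<in>I. (gram I I A ^^ L) e i = \<sigma> ^ (2 * L) * ip I e w * w i + r i"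
    "L2_set r I \<le> s ^ (2 * L)" using gram_iterate[OF gap, of L] by blast
  let ?y = "(gram I I A ^^ L) e" and ?a = "\<sigma> ^ (2 * L) * ip I e w"
  have \<sigma>: "\<sigma> > 0" using gap s by simp
  have ey: "ip I e ?y = ?a * ip I e w + ip I e r"
  proof -
    have "ip I e ?y = ip I e (\<lambda>i. ?a * w i + r i)" by (rule ip_cong) (use r in auto)
    then show ?thesis unfolding ip_simps .
  qed
  have py: "ip I h (perp I e ?y) = ?a * ip I h (perp I e w) + ip I h (perp I e r)"
  proof -
    have "ip I h (perp I e ?y) = ip I h (\<lambda>i. ?a * perp I e w i + perp I e r i)"
      by (rule ip_cong) (use r in \<open>auto simp: perp_def ey algebra_simps\<close>)
    then show ?thesis unfolding ip_simps .
  qed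
  have hr: "\<bar>ip I h (perp I e r)\<bar> \<le> s ^ (2 * L)"
  proof -
    have "\<bar>ip I h (perp I e r)\<bar> \<le> L2_set h I * L2_set (perp I e r) I" by (rule abs_ip_le)
    also have "\<dots> \<le> 1 * L2_set r I" by (intro mult_mono h L2_perp_le) auto
    finally show ?thesis using r(2) by simp
  qed
  have ew1: "\<bar>ip I e w\<bar> \<le> 1" using abs_ip_le[of I e w] e L2w by simp
  have s_le: "s ^ (2 * L) \<le> \<sigma> ^ (2 * L)" using gap s by (intro power_mono) auto
  have Ly: "L2_set (perp I e ?y) I \<le> 2 * \<sigma> ^ (2 * L)"
  proof -
    have "L2_set (perp I e ?y) I \<le> L2_set ?y I" by (rule L2_perp_le)
    also have "\<dots> = L2_set (\<lambda>i. ?a * w i + r i) I" by (rule L2_set_cong) (use r in auto)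
    also have "\<dots> \<le> L2_set (\<lambda>i. ?a * w i) I + L2_set r I" by (rule L2_set_triangle_ineq)
    also have "L2_set (\<lambda>i. ?a * w i) I = \<bar>?a\<bar>"
      by (simp add: L2_eq_sqrt_ip ip_simps ip_w_w real_sqrt_mult[symmetric])
    also have "\<bar>?a\<bar> \<le> \<sigma> ^ (2 * L) * 1"
      using \<sigma> ew1 unfolding abs_mult by (intro mult_mono) auto
    finally show ?thesis using r(2) s_le by simp
  qed
  have "\<bar>?a\<bar> * \<bar>ip I h (perp I e w)\<bar> = \<bar>ip I h (perp I e ?y) - ip I h (perp I e r)\<bar>"
    unfolding py by (simp add: abs_mult)
  also have "\<dots> \<le> \<eta> * (2 * \<sigma> ^ (2 * L)) + s ^ (2 * L)"
    using y hr mult_left_mono[OF Ly \<eta>] by linarith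
  also have "\<dots> = \<sigma> ^ (2 * L) * (2 * \<eta> + (s / \<sigma>) ^ (2 * L))"
    using \<sigma> by (simp add: power_divide field_simps)
  finally have "\<sigma> ^ (2 * L) * (\<bar>ip I e w\<bar> * \<bar>ip I h (perp I e w)\<bar>) \<le> \<sigma> ^ (2 * L) * (2 * \<eta> + (s / \<sigma>) ^ (2 * L))"
    using \<sigma> by (simp add: abs_mult mult.assoc)
  then have "\<bar>ip I e w\<bar> * \<bar>ip I h (perp I e w)\<bar> \<le> 2 * \<eta> + (s / \<sigma>) ^ (2 * L)"
    using \<sigma> by simp
  moreover have "c * \<bar>ip I h (perp I e w)\<bar> \<le> \<bar>ip I e w\<bar> * \<bar>ip I h (perp I e w)\<bar>"
    using c by (intro mult_right_mono) auto
  ultimately show ?thesis using c(1) by (simp add: field_simps)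
qed

end

text \<open>The part \<open>y\<close> of \<open>x\<close> orthogonal to \<open>v\<close> does not
  see the rank-one term, so \<sigma> |y|^2 is the value of the form \<open>D\<close> at
  \<open>y\<close> and \<open>z\<close>, at most d |y|; testing \<open>W\<close> at \<open>v\<close>
  and \<open>v'\<close> gives \<sigma> \<ge> |a| - d.\<close>

lemma rank_one_perturbation_loss:
  assumes top: "top_pair I J W \<sigma> x z"
    and W: "\<And>i j. i \<in> I \<Longrightarrow> j \<in> J \<Longrightarrow> W (i, j) = a * v i * v' j + D (i, j)"
    and v: "L2_set v I = 1" "L2_set v' J = 1"
    and D: "\<And>x y. \<bar>bil I J D x y\<bar> \<le> d * (L2_set x I * L2_set y J)" and d: "d < \<bar>a\<bar>"
  shows "1 - (ip I v x)\<^sup>2 \<le> (d / (\<bar>a\<bar> - d))\<^sup>2"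
proof -
  have bil_W: "bil I J W x y = a * (ip I v x * ip J v' y) + bil I J D x y" for x y
    by (rule bil_add_rank_one) (rule W)
  have xx: "ip I x x = 1" "L2_set x I = 1" and zz: "L2_set z J = 1" and vv: "ip I v v = 1" "ip J v' v' = 1"
    using top v by (auto simp: top_pair_def ip_self_L2)
  have \<sigma>: "\<bar>a\<bar> - d \<le> \<sigma>"
  proof -
    \<comment> \<open>\<open>a\<close> will be the overlap of a singular vector with
      \<open>e\<close>, whose sign is arbitrary.\<close>
    define g where "g = sgn a"
    define y where "y i = g * v i" for i
    have "bil I J W y v' \<le> \<sigma> * (L2_set y I * L2_set v' J)" using top unfolding top_pair_def by blast
    moreover have Ly: "L2_set y I \<le> 1"
      unfolding y_def L2_eq_sqrt_ip ip_simps vv by (simp add: g_def sgn_if)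
    moreover have "bil I J W y v' = \<bar>a\<bar> + bil I J D y v'"
      unfolding bil_W unfolding y_def ip_simps vv by (simp add: g_def linordered_idom_class.abs_sgn)
    moreover have "\<bar>bil I J D y v'\<bar> \<le> d * (L2_set y I * 1)" using D[of y v'] v by simp
    moreover have "d \<ge> 0"
      using D[of v v'] v by (simp add: order_trans[OF abs_ge_zero])
    ultimately show ?thesis
      using mult_left_mono[OF Ly, of d] mult_left_mono[OF Ly, of \<sigma>] top_pair_value(2)[OF top] v by simp
  qed
  define c where "c = ip I v x"
  define y where "y i = x i - c * v i" for i
  have vy: "ip I v y = 0" unfolding y_def ip_simps by (simp add: c_def vv)
  have xy: "ip I x y = 1 - c\<^sup>2" unfolding y_def ip_simps by (simp add: xx c_def ip_commute[of I x v] power2_eq_square)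
  have yy: "ip I y y = 1 - c\<^sup>2"
  proof -
    have "ip I y y = ip I (\<lambda>i. x i - c * v i) y" by (rule ip_cong) (simp_all add: y_def)
    then have "ip I y y = ip I x y - c * ip I v y" by (simp only: ip_simps)
    then show ?thesis using vy xy by simp
  qed
  have "\<sigma> * ip I y x = bil I J W y z"
  proof -
    have "bil I J W y z = ip I y (\<lambda>i. \<sigma> * x i)"
      unfolding ip_mv[symmetric] by (rule ip_cong) (use top in \<open>auto simp: top_pair_def\<close>)
    then show ?thesis by (simp add: ip_simps)
  qed
  also have "\<dots> = bil I J D y z" unfolding bil_W vy by simp
  also have "\<dots> \<le> d * L2_set y I" using D[of y z] zz by simp
  finally have le: "\<sigma> * (L2_set y I * L2_set y I) \<le> d * L2_set y I"
    using xy yy by (simp add: ip_commute[of I y x] ip_self_L2 power2_eq_square)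
  have s0: "0 < \<sigma>" using \<sigma> d by linarith
  have Ly: "L2_set y I \<le> d / (\<bar>a\<bar> - d)"
  proof (cases "L2_set y I = 0")
    case True
    moreover have "d \<ge> 0" using D[of v v'] v by (simp add: order_trans[OF abs_ge_zero])
    ultimately show ?thesis using d by simp
  next
    case False
    then have "L2_set y I > 0" by (simp add: order_less_le)
    then have "\<sigma> * L2_set y I \<le> d" using le by (simp add: mult.assoc[symmetric])
    moreover have "(\<bar>a\<bar> - d) * L2_set y I \<le> \<sigma> * L2_set y I" using \<sigma> by (intro mult_right_mono) auto
    ultimately show ?thesis using d by (simp add: field_simps)
  qed
  have "1 - c\<^sup>2 = (L2_set y I)\<^sup>2" using yy by (simp add: ip_self_L2)
  also have "\<dots> \<le> (d / (\<bar>a\<bar> - d))\<^sup>2" by (intro power_mono Ly) simp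
  finally show ?thesis by (simp add: c_def)
qed

section \<open>Existence of top singular pairs\<close>

lemma ip_self_eq_1_iff: "ip I x x = 1 \<longleftrightarrow> L2_set x I = 1"
  by (simp add: L2_eq_sqrt_ip)

text \<open>Coordinates outside \<open>J\<close> are pinned to 0, which makes the sphere a closed
  subset of a product of compact sets; Tychonoff's theorem does the rest.\<close>

lemma compact_unit_vectors:
  fixes J :: "'j set"
  assumes "finite J"
  shows "compact {x :: 'j \<Rightarrow> real. (\<forall>j. j \<notin> J \<longrightarrow> x j = 0) \<and> ip J x x = 1}"
proof -
  define S where "S j = (if j \<in> J then {-1..1} else {0::real})" for j
  have "compact (PiE UNIV S)"
  proof -
    have "compactin (product_topology (\<lambda>_. euclidean) UNIV) (PiE UNIV S)"
      unfolding compactin_PiE by (auto simp: S_def)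
    then show ?thesis unfolding euclidean_product_topology by simp
  qed
  moreover have "closed {x :: 'j \<Rightarrow> real. ip J x x = 1}"
    unfolding ip_def by (intro closed_Collect_eq continuous_intros) auto
  ultimately have "compact (PiE UNIV S \<inter> {x. ip J x x = 1})" by (rule compact_Int_closed)
  also have "PiE UNIV S \<inter> {x. ip J x x = 1} = {x. (\<forall>j. j \<notin> J \<longrightarrow> x j = 0) \<and> ip J x x = 1}"
  proof (intro equalityI subsetI)
    fix x assume "x \<in> PiE UNIV S \<inter> {x. ip J x x = 1}"
    then have x: "x j \<in> S j" "ip J x x = 1" for j by (auto simp: PiE_def Pi_def)
    then have "x j = 0" if "j \<notin> J" for j using x(1)[of j] that by (simp add: S_def)
    then show "x \<in> {x. (\<forall>j. j \<notin> J \<longrightarrow> x j = 0) \<and> ip J x x = 1}" using x by simp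
  next
    fix x assume x: "x \<in> {x. (\<forall>j. j \<notin> J \<longrightarrow> x j = 0) \<and> ip J x x = 1}"
    have "x j \<in> S j" for j
    proof (cases "j \<in> J")
      case True
      have "(x j)\<^sup>2 \<le> (\<Sum>i\<in>J. (x i)\<^sup>2)" by (rule member_le_sum) (use True assms in auto)
      then have "(x j)\<^sup>2 \<le> 1" using x by (simp add: ip_def power2_eq_square)
      then have "\<bar>x j\<bar> \<le> 1" by (simp add: abs_square_le_1)
      then show ?thesis using True by (simp add: S_def abs_le_iff)
    qed (use x in \<open>simp add: S_def\<close>)
    then show "x \<in> PiE UNIV S \<inter> {x. ip J x x = 1}" using x by auto
  qed
  finally show ?thesis .
qed

lemma mv_scale: "i \<in> I \<Longrightarrow> mv I J A (\<lambda>j. c * y j) i = c * mv I J A y i"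
  using mv_combine[of i I J A c y 0 y] by simp

lemma ip_mv_combine:
  "ip I (mv I J A (\<lambda>j. x j + t * z j)) (mv I J A (\<lambda>j. x j + t * z j)) =
    ip I (mv I J A x) (mv I J A x) + 2 * t * ip I (mv I J A x) (mv I J A z) + t\<^sup>2 * ip I (mv I J A z) (mv I J A z)"
proof -
  have "ip I (mv I J A (\<lambda>j. x j + t * z j)) (mv I J A (\<lambda>j. x j + t * z j)) =
    ip I (\<lambda>i. mv I J A x i + t * mv I J A z i) (\<lambda>i. mv I J A x i + t * mv I J A z i)"
    by (rule ip_cong) (use mv_combine[of _ I J A 1 x t z] in simp_all)
  then show ?thesis
    unfolding ip_simps by (simp add: ip_commute[of I "mv I J A z" "mv I J A x"] power2_eq_square algebra_simps)
qed

text \<open>A maximizer \<open>v\<close> of |A y|^2 on the unit sphere is critical. The residual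
  \<open>z\<close> of the eigenvalue equation serves as the direction of variation: at
  \<open>v\<close> + t \<open>z\<close> the difference |A y|^2 - s^2 |y|^2, which is never positive,
  equals 2 t |z|^2 up to order t^2, so \<open>z\<close> vanishes.\<close>

lemma top_right_vector_exists:
  assumes I: "finite I" and J: "finite J" "J \<noteq> {}"
  shows "\<exists>v s. L2_set v J = 1 \<and> s \<ge> 0 \<and> (\<forall>y. L2_set (mv I J A y) I \<le> s * L2_set y J) \<and>
    (\<forall>j\<in>J. gram I J A v j = s\<^sup>2 * v j)"
proof -
  define K where "K = {x. (\<forall>j. j \<notin> J \<longrightarrow> x j = 0) \<and> ip J x x = 1}"
  define F where "F x = ip I (mv I J A x) (mv I J A x)" for x
  have F_eq: "F x = (\<Sum>i\<in>I. (\<Sum>j\<in>J. A (i, j) * x j) * (\<Sum>j\<in>J. A (i, j) * x j))" for x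
    by (simp add: F_def ip_def mv_def)
  have "continuous_on UNIV F"
    unfolding F_eq[abs_def] by (intro continuous_intros) auto
  then have cF: "continuous_on K F" by (rule continuous_on_subset) simp
  obtain j0 where j0: "j0 \<in> J" using J by blast
  have "(\<lambda>j. if j = j0 then 1 else 0) \<in> K"
    using j0 J by (auto simp: K_def ip_def if_distrib[of "\<lambda>a. a * _"] sum.delta cong: if_cong)
  then have "K \<noteq> {}" by blast
  then obtain v where v: "v \<in> K" "\<And>y. y \<in> K \<Longrightarrow> F y \<le> F v"
    using continuous_attains_sup[OF compact_unit_vectors[OF J(1), folded K_def] _ cF] by blast
  define s where "s = sqrt (F v)"
  have Fv0: "F v \<ge> 0" by (simp add: F_def)
  have s: "s \<ge> 0" "s\<^sup>2 = F v" using Fv0 by (auto simp: s_def)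
  have bound: "F y \<le> s\<^sup>2 * ip J y y" for y
  proof (cases "ip J y y = 0")
    case True
    then have "\<forall>j\<in>J. y j = 0" using J by (simp add: ip_self_eq_0)
    then have "F y = 0" by (simp add: F_eq)
    then show ?thesis using True by simp
  next
    case False
    define c where "c = 1 / sqrt (ip J y y)"
    have c: "c\<^sup>2 * ip J y y = 1" using False by (simp add: c_def power_divide)
    define y' where "y' j = (if j \<in> J then c * y j else 0)" for j
    have "ip J y' y' = ip J (\<lambda>j. c * y j) (\<lambda>j. c * y j)" by (rule ip_cong) (auto simp: y'_def)
    then have "ip J y' y' = 1" using c by (simp add: ip_simps power2_eq_square mult.assoc)
    then have "F y' \<le> s\<^sup>2" using v(2)[of y'] s by (simp add: K_def y'_def)
    moreover have "F y' = c\<^sup>2 * F y"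
    proof -
      have "F y' = ip I (\<lambda>i. c * mv I J A y i) (\<lambda>i. c * mv I J A y i)"
        unfolding F_def using mv_cong[of J y' "\<lambda>j. c * y j" I A]
        by (intro ip_cong) (auto simp: y'_def mv_scale)
      then show ?thesis by (simp add: ip_simps F_def power2_eq_square mult.assoc)
    qed
    moreover have "c\<^sup>2 * (s\<^sup>2 * ip J y y) = s\<^sup>2"
      unfolding mult.left_commute[of "c\<^sup>2"] c by simp
    ultimately have "c\<^sup>2 * F y \<le> c\<^sup>2 * (s\<^sup>2 * ip J y y)" by linarith
    moreover have "c\<^sup>2 > 0" using False by (simp add: c_def)
    ultimately show ?thesis by simp
  qed
  have vv: "ip J v v = 1" using v(1) by (simp add: K_def)
  define z where "z j = gram I J A v j - s\<^sup>2 * v j" for j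
  define a where "a = ip J z z"
  have a_eq: "ip I (mv I J A v) (mv I J A z) - s\<^sup>2 * ip J v z = a"
  proof -
    have "a = ip J (\<lambda>j. gram I J A v j - s\<^sup>2 * v j) z" unfolding a_def by (rule ip_cong) (simp_all add: z_def)
    then show ?thesis unfolding ip_simps by (simp add: ip_gram)
  qed
  have ineq: "2 * a \<le> t * (s\<^sup>2 * a)" if "t > 0" for t
  proof -
    have "F (\<lambda>j. v j + t * z j) \<le> s\<^sup>2 * ip J (\<lambda>j. v j + t * z j) (\<lambda>j. v j + t * z j)" by (rule bound)
    then have "F v + 2 * t * ip I (mv I J A v) (mv I J A z) + t\<^sup>2 * F z \<le> s\<^sup>2 * (1 + 2 * t * ip J v z + t\<^sup>2 * a)"
      unfolding F_def ip_mv_combine ip_simps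
      by (simp add: vv a_def ip_commute[of J z v] power2_eq_square algebra_simps)
    moreover have "F z \<ge> 0" by (simp add: F_def)
    then have "t\<^sup>2 * F z \<ge> 0" by simp
    moreover have "s\<^sup>2 * (1 + 2 * t * ip J v z + t\<^sup>2 * a) = s\<^sup>2 + 2 * t * (s\<^sup>2 * ip J v z) + t * (t * (s\<^sup>2 * a))"
      by (simp add: algebra_simps power2_eq_square)
    moreover have "2 * t * ip I (mv I J A v) (mv I J A z) = 2 * t * a + 2 * t * (s\<^sup>2 * ip J v z)"
      unfolding a_eq[symmetric] by (simp add: algebra_simps)
    ultimately have "t * (2 * a) \<le> t * (t * (s\<^sup>2 * a))" unfolding s(2) by linarith
    then show ?thesis using that by simp
  qed
  have "a = 0"
  proof (rule ccontr)
    assume "a \<noteq> 0"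
    then have a: "a > 0" by (simp add: a_def order_less_le)
    \<comment> \<open>Any step t with t s^2 < 2 gives the contradiction; this one also covers
      \<open>s = 0\<close>.\<close>
    have "2 * a \<le> 1 / (s\<^sup>2 + 1) * (s\<^sup>2 * a)" by (rule ineq) (simp add: add_nonneg_pos)
    also have "\<dots> \<le> 1 * a"
    proof -
      have "s\<^sup>2 / (s\<^sup>2 + 1) \<le> 1" by (simp add: add_nonneg_pos)
      then have "s\<^sup>2 / (s\<^sup>2 + 1) * a \<le> 1 * a" using a by (intro mult_right_mono) auto
      then show ?thesis by simp
    qed
    finally show False using a by simp
  qed
  then have "\<forall>j\<in>J. gram I J A v j = s\<^sup>2 * v j" using J by (simp add: a_def ip_self_eq_0 z_def)
  moreover have "L2_set (mv I J A y) I \<le> s * L2_set y J" for y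
  proof (rule power2_le_imp_le)
    show "(L2_set (mv I J A y) I)\<^sup>2 \<le> (s * L2_set y J)\<^sup>2"
      using bound[of y] by (simp add: ip_self_L2 F_def power_mult_distrib)
  qed (use s in simp)
  ultimately show ?thesis using s(1) vv by (auto simp: ip_self_eq_1_iff)
qed

lemma scalar_prod_eq_ip: "v \<in> carrier_vec n \<Longrightarrow> scalar_prod u v = ip {0..<n} (\<lambda>i. u $ i) (\<lambda>i. v $ i)"
  by (auto simp: scalar_prod_def ip_def)

lemma vec_norm_eq_L2: "v \<in> carrier_vec n \<Longrightarrow> vec_norm v = L2_set (\<lambda>i. v $ i) {0..<n}"
  by (simp add: vec_norm_def scalar_prod_eq_ip L2_eq_sqrt_ip)

lemma index_mult_mat_vec_mv:
  assumes "A \<in> carrier_mat a b" "v \<in> carrier_vec b" "i < a"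
  shows "(A *\<^sub>v v) $ i = mv {0..<a} {0..<b} (\<lambda>p. A $$ p) (\<lambda>j. v $ j) i"
  using assms by (auto simp: scalar_prod_def mv_def ip_def intro!: sum.cong)

lemma index_transpose_mult_vec_tmv:
  assumes "A \<in> carrier_mat a b" "v \<in> carrier_vec a" "j < b"
  shows "(transpose_mat A *\<^sub>v v) $ j = tmv {0..<a} {0..<b} (\<lambda>p. A $$ p) (\<lambda>i. v $ i) j"
  using assms by (auto simp: scalar_prod_def tmv_def ip_def intro!: sum.cong)

text \<open>\<open>top_singular_triple\<close> compares \<open>\<sigma>\<close> with singular values
  only, so bounding the form by \<open>\<sigma>\<close> takes a triple that attains the norm
  \<open>s\<close>. Its left vector is the image of the maximizer divided by \<open>s\<close>, which
  is why \<open>s = 0\<close> is split off.\<close>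

lemma top_singular_triple_top_pair:
  assumes A: "A \<in> carrier_mat a b" and top: "top_singular_triple A \<sigma> u v"
  shows "u \<in> carrier_vec a" "v \<in> carrier_vec b"
    "top_pair {0..<a} {0..<b} (\<lambda>p. A $$ p) \<sigma> (\<lambda>i. u $ i) (\<lambda>j. v $ j)"
proof -
  let ?I = "{0..<a}" and ?J = "{0..<b}" and ?A = "\<lambda>p. A $$ p"
  have st: "\<sigma> \<ge> 0" "u \<in> carrier_vec a" "v \<in> carrier_vec b" "vec_norm u = 1" "vec_norm v = 1"
    "A *\<^sub>v v = \<sigma> \<cdot>\<^sub>v u" "transpose_mat A *\<^sub>v u = \<sigma> \<cdot>\<^sub>v v"
    using top A by (auto simp: top_singular_triple_def singular_triple_def)
  then show "u \<in> carrier_vec a" "v \<in> carrier_vec b" by auto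
  have L: "L2_set (\<lambda>i. u $ i) ?I = 1" "L2_set (\<lambda>j. v $ j) ?J = 1"
    using st(2-5) by (auto simp: vec_norm_eq_L2)
  then have J: "?J \<noteq> {}" by (metis L2_set_empty zero_neq_one)
  obtain v' s where v': "L2_set v' ?J = 1" and s: "s \<ge> 0"
    and bnd: "\<And>y. L2_set (mv ?I ?J ?A y) ?I \<le> s * L2_set y ?J"
    and gr: "\<And>j. j \<in> ?J \<Longrightarrow> gram ?I ?J ?A v' j = s\<^sup>2 * v' j"
    using top_right_vector_exists[of ?I ?J ?A] J by auto
  have "s \<le> \<sigma>"
  proof (cases "s = 0")
    case True
    then show ?thesis using st(1) by simp
  next
    case False
    define x where "x = (\<lambda>i. (1 / s) * mv ?I ?J ?A v' i)"
    define u1 where "u1 = vec a x"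
    define v1 where "v1 = vec b v'"
    have c: "u1 \<in> carrier_vec a" "v1 \<in> carrier_vec b" by (auto simp: u1_def v1_def)
    have u1: "u1 $ i = x i" if "i < a" for i using that by (simp add: u1_def)
    have v1: "v1 $ j = v' j" if "j < b" for j using that by (simp add: v1_def)
    have "ip ?I (mv ?I ?J ?A v') (mv ?I ?J ?A v') = s\<^sup>2"
    proof -
      have "ip ?J (gram ?I ?J ?A v') v' = ip ?J (\<lambda>j. s\<^sup>2 * v' j) v'" by (rule ip_cong) (use gr in auto)
      then show ?thesis using v' by (simp add: ip_gram ip_simps ip_self_L2)
    qed
    then have "ip ?I x x = 1" unfolding x_def ip_simps using False by (simp add: power2_eq_square)
    then have "vec_norm u1 = 1"
      using L2_set_cong[OF refl, of ?I "\<lambda>i. u1 $ i" x] u1 by (simp add: vec_norm_eq_L2[OF c(1)] ip_self_eq_1_iff)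
    moreover have "vec_norm v1 = 1"
      using L2_set_cong[OF refl, of ?J "\<lambda>i. v1 $ i" v'] v1 v' by (simp add: vec_norm_eq_L2[OF c(2)])
    moreover have "A *\<^sub>v v1 = s \<cdot>\<^sub>v u1"
    proof (rule eq_vecI)
      fix i assume "i < dim_vec (s \<cdot>\<^sub>v u1)"
      then have i: "i < a" using c by simp
      have "mv ?I ?J ?A (\<lambda>j. v1 $ j) = mv ?I ?J ?A v'" by (rule mv_cong) (use v1 in auto)
      then show "(A *\<^sub>v v1) $ i = (s \<cdot>\<^sub>v u1) $ i"
        using i c False by (simp add: index_mult_mat_vec_mv[OF A c(2) i] u1 x_def del: index_mult_mat_vec)
    qed (use A c in auto)
    moreover have "transpose_mat A *\<^sub>v u1 = s \<cdot>\<^sub>v v1"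
    proof (rule eq_vecI)
      fix j assume "j < dim_vec (s \<cdot>\<^sub>v v1)"
      then have j: "j < b" using c by simp
      have "tmv ?I ?J ?A (\<lambda>j. u1 $ j) = tmv ?I ?J ?A (\<lambda>i. (1 / s) * mv ?I ?J ?A v' i + 0 * v' i)"
        by (rule tmv_cong) (use u1 in \<open>auto simp: x_def\<close>)
      then have "tmv ?I ?J ?A (\<lambda>j. u1 $ j) j = (1 / s) * gram ?I ?J ?A v' j"
        using tmv_combine[of j ?J ?I ?A "1 / s" "mv ?I ?J ?A v'" 0 v'] j by (simp add: gram_def)
      also have "\<dots> = s * v' j" using gr[of j] j False by (simp add: power2_eq_square)
      finally show "(transpose_mat A *\<^sub>v u1) $ j = (s \<cdot>\<^sub>v v1) $ j"
        using j c v1 by (simp add: index_transpose_mult_vec_tmv[OF A c(1) j] del: index_mult_mat_vec)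
    qed (use A c in auto)
    ultimately have "singular_triple A s u1 v1"
      using s c A by (simp add: singular_triple_def)
    then show ?thesis using top unfolding top_singular_triple_def by blast
  qed
  have "bil ?I ?J ?A x y \<le> \<sigma> * (L2_set x ?I * L2_set y ?J)" for x y
  proof -
    have "bil ?I ?J ?A x y \<le> s * (L2_set x ?I * L2_set y ?J)" by (rule bil_le_of_L2_set_mv[OF bnd])
    also have "\<dots> \<le> \<sigma> * (L2_set x ?I * L2_set y ?J)" using \<open>s \<le> \<sigma>\<close> by (intro mult_right_mono) auto
    finally show ?thesis .
  qed
  moreover have "mv ?I ?J ?A (\<lambda>j. v $ j) i = \<sigma> * u $ i" if "i \<in> ?I" for i
    using index_mult_mat_vec_mv[OF A st(3), of i] st(2,6) that by (simp del: index_mult_mat_vec)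
  moreover have "tmv ?I ?J ?A (\<lambda>i. u $ i) j = \<sigma> * v $ j" if "j \<in> ?J" for j
    using index_transpose_mult_vec_tmv[OF A st(2), of j] st(3,7) that by (simp del: index_mult_mat_vec)
  ultimately show "top_pair ?I ?J ?A \<sigma> (\<lambda>i. u $ i) (\<lambda>j. v $ j)"
    using L by (simp add: top_pair_def)
qed

section \<open>Directions of rotation-invariant vectors\<close>

text \<open>For a unit vector \<open>e\<close>, the length of the part of \<open>g\<close>
  orthogonal to \<open>e\<close> (\<open>perp_component\<close>).\<close>

definition perp_norm :: "'i set \<Rightarrow> ('i \<Rightarrow> real) \<Rightarrow> ('i \<Rightarrow> real) \<Rightarrow> real" where
  "perp_norm I e g = sqrt (ip I g g - (ip I e g)\<^sup>2)"

text \<open>For \<open>y\<close> orthogonal to the unit vector \<open>e\<close>: the cosine between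
  \<open>y\<close> and the part of \<open>g\<close> orthogonal to \<open>e\<close> exceeds
  \<open>1 - \<tau>\<close>. Cleared of denominators, and strict, so that it fails when one of the
  two vectors is zero.\<close>

definition in_cone :: "'i set \<Rightarrow> ('i \<Rightarrow> real) \<Rightarrow> real \<Rightarrow> ('i \<Rightarrow> real) \<Rightarrow> ('i \<Rightarrow> real) \<Rightarrow> bool" where
  "in_cone I e \<tau> y g \<longleftrightarrow> (1 - \<tau>) * L2_set y I * perp_norm I e g < ip I y g"

lemma in_cone_scale_left:
  assumes "c > 0"
  shows "in_cone I e \<tau> (\<lambda>i. c * y i) g \<longleftrightarrow> in_cone I e \<tau> y g"
proof -
  have "L2_set (\<lambda>i. c * y i) I = c * L2_set y I" using assms by (simp add: L2_set_right_distrib)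
  then have "in_cone I e \<tau> (\<lambda>i. c * y i) g \<longleftrightarrow> c * ((1 - \<tau>) * L2_set y I * perp_norm I e g) < c * ip I y g"
    by (simp add: in_cone_def ip_simps mult_ac)
  then show ?thesis using assms by (simp add: in_cone_def mult.assoc)
qed

lemma perp_norm_scale: "c \<ge> 0 \<Longrightarrow> perp_norm I e (\<lambda>i. c * y i) = c * perp_norm I e y"
proof -
  assume "c \<ge> 0"
  moreover have "ip I (\<lambda>i. c * y i) (\<lambda>i. c * y i) - (ip I e (\<lambda>i. c * y i))\<^sup>2 = c\<^sup>2 * (ip I y y - (ip I e y)\<^sup>2)"
    unfolding ip_simps by (simp add: power2_eq_square algebra_simps)
  ultimately show ?thesis by (simp add: perp_norm_def real_sqrt_mult)
qed

lemma perp_norm_orth: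
  assumes "ip I e z = 0"
  shows "perp_norm I e z = L2_set z I"
  by (simp add: perp_norm_def assms L2_eq_sqrt_ip)

lemma in_cone_scale_right:
  assumes "c > 0"
  shows "in_cone I e \<tau> y (\<lambda>i. c * g i) \<longleftrightarrow> in_cone I e \<tau> y g"
proof -
  have "in_cone I e \<tau> y (\<lambda>i. c * g i) \<longleftrightarrow> c * ((1 - \<tau>) * L2_set y I * perp_norm I e g) < c * ip I y g"
    using assms by (simp add: in_cone_def ip_simps perp_norm_scale mult_ac)
  then show ?thesis using assms by (simp add: in_cone_def mult.assoc)
qed

lemma ip_householder_fixed:
  assumes "ip I e a = 0"
  shows "ip I e (householder I a g) = ip I e g"
  by (simp add: ip_householder_right assms ip_commute[of I a e])

lemma in_cone_householder:
  assumes "ip I e a = 0"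
  shows "in_cone I e \<tau> (householder I a y) (householder I a g) \<longleftrightarrow> in_cone I e \<tau> y g"
  by (simp add: in_cone_def perp_norm_def ip_householder_fixed[OF assms])

lemma in_cone_cong:
  assumes "\<And>i. i \<in> I \<Longrightarrow> y i = y' i" "\<And>i. i \<in> I \<Longrightarrow> g i = g' i"
  shows "in_cone I e \<tau> y g \<longleftrightarrow> in_cone I e \<tau> y' g'"
proof -
  have "ip I y g = ip I y' g'" "ip I g g = ip I g' g'" "ip I e g = ip I e g'" "L2_set y I = L2_set y' I"
    using assms by (auto intro!: ip_cong L2_set_cong)
  then show ?thesis by (simp add: in_cone_def perp_norm_def)
qed

lemma perp_component:
  fixes e g :: "'i \<Rightarrow> real"
  assumes e: "L2_set e I = 1"
  defines "p \<equiv> (\<lambda>i. g i - ip I e g * e i)"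
  shows "ip I e p = 0" "L2_set p I = perp_norm I e g" "ip I e y = 0 \<Longrightarrow> ip I y p = ip I y g"
proof -
  have ee: "ip I e e = 1" using e by (simp add: ip_self_L2)
  show "ip I e p = 0" unfolding p_def ip_simps by (simp add: ee)
  show "L2_set p I = perp_norm I e g"
    unfolding p_def L2_eq_sqrt_ip perp_norm_def ip_simps by (simp add: ee ip_commute[of I g e] power2_eq_square)
  show "ip I e y = 0 \<Longrightarrow> ip I y p = ip I y g"
    unfolding p_def ip_simps by (simp add: ip_commute[of I y e])
qed

lemma in_cone_perp:
  assumes e: "L2_set e I = 1" and y: "ip I e y = 0"
  shows "in_cone I e \<tau> y (\<lambda>i. g i - ip I e g * e i) \<longleftrightarrow> in_cone I e \<tau> y g"
  unfolding in_cone_def perp_norm_orth[OF perp_component(1)[OF e]] perp_component(2)[OF e]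
    perp_component(3)[OF e y] by simp

text \<open>Reflections that fix \<open>e\<close> act transitively on the directions orthogonal to \<open>e\<close>.\<close>

lemma rotate_direction:
  assumes I: "finite I" and e: "ip I e y = 0" "ip I e z = 0" and pos: "L2_set y I > 0" "L2_set z I > 0"
  shows "\<exists>a c. ip I e a = 0 \<and> c > 0 \<and> (\<forall>i\<in>I. householder I a (\<lambda>i. c * y i) i = z i)"
proof -
  define c where "c = L2_set z I / L2_set y I"
  have c: "c > 0" using pos by (simp add: c_def)
  define a where "a = (\<lambda>i. c * y i - z i)"
  have "ip I (\<lambda>i. c * y i) (\<lambda>i. c * y i) = ip I z z"
    unfolding ip_simps using pos by (simp add: ip_self_L2 c_def power2_eq_square)
  then have "\<forall>i\<in>I. householder I a (\<lambda>i. c * y i) i = z i"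
    using householder_swap[OF I, of "\<lambda>i. c * y i" z] by (simp add: a_def)
  moreover have "ip I e a = 0" unfolding a_def ip_simps by (simp add: e)
  ultimately show ?thesis using c by blast
qed

lemma std_normal_interval_pos:
  assumes "a < b"
  shows "emeasure std_normal {a<..<b} > 0"
proof (rule ccontr)
  assume "\<not> 0 < emeasure std_normal {a<..<b}"
  then have "{a<..<b} \<in> null_sets std_normal" by (intro null_setsI) auto
  then have "AE x in lborel. x \<in> {a<..<b} \<longrightarrow> ennreal (std_normal_density x) = 0"
    unfolding std_normal_def by (subst (asm) null_sets_density_iff) auto
  moreover have "ennreal (std_normal_density x) \<noteq> 0" for x
    by (simp add: std_normal_density_def)
  ultimately have "AE x in lborel. x \<notin> {a<..<b}" by simp
  then have "emeasure lborel {a<..<b} = 0"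
    by (subst (asm) AE_iff_measurable[where N="{a<..<b}"]) auto
  then show False using assms by simp
qed

text \<open>A small box around \<open>y\<close> lies in the cone, and the Gaussian measure charges
  boxes. No quantitative bound is sought, because the measure of the cone cancels in
  \<open>invariant_direction_transfer\<close>.\<close>

lemma gauss_cone_pos:
  assumes I: "finite I" and y: "L2_set y I > 0" and e: "ip I e y = 0" and \<tau>: "0 < \<tau>" "\<tau> < 1"
  shows "(\<integral>\<^sup>+g. (if in_cone I e \<tau> y g then 1 else 0) \<partial>gauss I) > 0"
proof -
  \<comment> \<open>Summed over the coordinates, this keeps |g - y| below \<tau>/3 |y| on the box;
    the margin used is (1 - \<tau>) (1 + \<tau>/3) < 1 - \<tau>/3.\<close>
  define r where "r = \<tau> / 3 * L2_set y I / (real (card I) + 1)"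
  have r: "r > 0" using y \<tau> by (simp add: r_def)
  define B where "B = PiE I (\<lambda>i. {y i - r<..<y i + r})"
  have B: "B \<in> sets (gauss I)" unfolding B_def gauss_def using I by (intro sets_PiM_I_finite) auto
  have "emeasure (gauss I) B = (\<Prod>i\<in>I. emeasure std_normal {y i - r<..<y i + r})"
    unfolding B_def gauss_def using I by (intro std_normals.emeasure_PiM) auto
  also have "\<dots> > 0"
  proof -
    have "emeasure std_normal {y i - r<..<y i + r} \<noteq> 0" for i
      using std_normal_interval_pos[of "y i - r" "y i + r"] r by simp
    then have "(\<Prod>i\<in>I. emeasure std_normal {y i - r<..<y i + r}) \<noteq> 0"
      using I by (simp add: prod_zero_iff)
    then show ?thesis by (simp add: zero_less_iff_neq_zero)
  qed
  also have "emeasure (gauss I) B = (\<integral>\<^sup>+g. indicator B g \<partial>gauss I)" using B by simp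
  also have "\<dots> \<le> (\<integral>\<^sup>+g. (if in_cone I e \<tau> y g then 1 else 0) \<partial>gauss I)"
  proof (rule nn_integral_mono)
    fix g
    have "in_cone I e \<tau> y g" if g: "g \<in> B"
    proof -
      define d where "d = (\<lambda>i. g i - y i)"
      have "L2_set d I \<le> (\<Sum>i\<in>I. \<bar>d i\<bar>)" by (rule L2_set_le_sum_abs)
      also have "\<dots> \<le> (\<Sum>i\<in>I. r)"
      proof (rule sum_mono)
        fix i assume "i \<in> I"
        then have "g i \<in> {y i - r<..<y i + r}" using g unfolding B_def by (rule PiE_mem[rotated])
        then show "\<bar>d i\<bar> \<le> r" by (auto simp: d_def)
      qed
      also have "\<dots> = real (card I) * r" by simp
      also have "\<dots> \<le> (real (card I) + 1) * r" using r by (intro mult_right_mono) auto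
      also have "\<dots> = \<tau> / 3 * L2_set y I"
      proof -
        have "real (card I) + 1 \<noteq> 0" by linarith
        then show ?thesis
          unfolding r_def by (subst times_divide_eq_right) (rule nonzero_mult_div_cancel_left)
      qed
      finally have d: "L2_set d I \<le> \<tau> / 3 * L2_set y I" .
      have gd: "ip I y g = ip I y y + ip I y d" by (simp add: d_def ip_simps)
      have "L2_set y I * L2_set d I \<le> L2_set y I * (\<tau> / 3 * L2_set y I)" using d by (intro mult_left_mono) auto
      then have "\<bar>ip I y d\<bar> \<le> L2_set y I * (\<tau> / 3 * L2_set y I)"
        using abs_ip_le[of I y d] by (rule order_trans[rotated])
      also have "\<dots> = \<tau> / 3 * (L2_set y I)\<^sup>2" by (simp add: power2_eq_square)
      finally have lower: "(1 - \<tau> / 3) * (L2_set y I)\<^sup>2 \<le> ip I y g"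
        unfolding gd ip_self_L2 by (simp add: algebra_simps)
      have "perp_norm I e g \<le> L2_set g I"
        unfolding perp_norm_def L2_eq_sqrt_ip by (intro real_sqrt_le_mono) simp
      also have "L2_set g I = L2_set (\<lambda>i. y i + d i) I" by (simp add: d_def)
      also have "\<dots> \<le> L2_set y I + L2_set d I" by (rule L2_set_triangle_ineq)
      also have "\<dots> \<le> (1 + \<tau> / 3) * L2_set y I" using d by (simp add: algebra_simps)
      finally have "(1 - \<tau>) * L2_set y I * perp_norm I e g \<le> (1 - \<tau>) * L2_set y I * ((1 + \<tau> / 3) * L2_set y I)"
        using \<tau> by (intro mult_left_mono) auto
      also have "\<dots> = ((1 - \<tau>) * (1 + \<tau> / 3)) * (L2_set y I)\<^sup>2" by (simp add: power2_eq_square mult_ac)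
      also have "\<dots> < (1 - \<tau> / 3) * (L2_set y I)\<^sup>2"
      proof (rule mult_strict_right_mono)
        have "(1 - \<tau>) * (1 + \<tau> / 3) = 1 - 2 / 3 * \<tau> - \<tau>\<^sup>2 / 3" by (simp add: field_simps power2_eq_square)
        then show "(1 - \<tau>) * (1 + \<tau> / 3) < 1 - \<tau> / 3" using \<tau> zero_le_power2[of \<tau>] by linarith
      qed (use y in simp)
      finally show ?thesis using lower by (simp add: in_cone_def)
    qed
    then show "(indicator B g :: ennreal) \<le> (if in_cone I e \<tau> y g then 1 else 0)"
      by (auto simp: indicator_def)
  qed
  finally show ?thesis .
qed

lemma measurable_in_cone:
  assumes f: "f \<in> measurable M (gauss I)" and g: "g \<in> measurable M (gauss I)"
  shows "(\<lambda>w. if in_cone I e \<tau> (f w) (g w) then 1 else 0 :: ennreal) \<in> borel_measurable M"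
proof -
  have fi: "(\<lambda>w. f w i) \<in> borel_measurable M" and gi: "(\<lambda>w. g w i) \<in> borel_measurable M" if "i \<in> I" for i
    using measurable_into_gauss_apply[OF f that] measurable_into_gauss_apply[OF g that] by auto
  have [measurable]: "(\<lambda>w. ip I (f w) (f w)) \<in> borel_measurable M" "(\<lambda>w. ip I (g w) (g w)) \<in> borel_measurable M"
    "(\<lambda>w. ip I e (g w)) \<in> borel_measurable M" "(\<lambda>w. ip I (f w) (g w)) \<in> borel_measurable M"
    by (intro measurable_ip fi gi borel_measurable_const; assumption)+
  have "{w \<in> space M. in_cone I e \<tau> (f w) (g w)} \<in> sets M"
    unfolding in_cone_def perp_norm_def L2_eq_sqrt_ip by measurable
  then show ?thesis by (intro measurable_If) auto
qed

text \<open>Averaging over both the invariant vector \<open>Y\<close> and an independent Gaussian vector \<open>g\<close>: the cone of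
  vectors close in direction to \<open>g\<close> has the same probability for all \<open>g\<close>, and likewise with the roles
  exchanged. Hence properties that hold for most \<open>g\<close> hold approximately for most \<open>Y\<close>.\<close>

lemma invariant_direction_transfer:
  fixes Y :: "'a \<Rightarrow> 'i \<Rightarrow> real"
  assumes P: "prob_space P" and I: "finite I" and Y: "Y \<in> measurable P (gauss I)"
    and e: "L2_set e I = 1" and Ye: "\<And>\<omega>. ip I e (Y \<omega>) = 0"
    and inv: "\<And>a F. ip I e a = 0 \<Longrightarrow> F \<in> borel_measurable (gauss I) \<Longrightarrow>
        (\<integral>\<^sup>+\<omega>. F (householder I a (Y \<omega>)) \<partial>P) = (\<integral>\<^sup>+\<omega>. F (Y \<omega>) \<partial>P)"
    and C: "C \<in> sets (gauss I)" and \<tau>: "0 < \<tau>" "\<tau> < 1"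
  shows "\<exists>D\<in>sets (gauss I). (\<forall>y\<in>D. \<exists>g\<in>C. in_cone I e \<tau> y g) \<and>
    emeasure P {\<omega> \<in> space P. Y \<omega> \<notin> D \<and> L2_set (Y \<omega>) I > 0} * emeasure (gauss I) {g \<in> space (gauss I). perp_norm I e g > 0}
      \<le> emeasure (gauss I) (space (gauss I) - C)"
proof -
  interpret P: prob_space P by fact
  interpret G: prob_space "gauss I" by (rule prob_space_gauss)
  interpret PG: pair_sigma_finite P "gauss I" ..
  note Y [measurable] C [measurable]
  define K :: "('i \<Rightarrow> real) \<Rightarrow> ('i \<Rightarrow> real) \<Rightarrow> ennreal" where "K y g = (if in_cone I e \<tau> y g then 1 else 0)" for y g
  have K [measurable]: "(\<lambda>w. K (f w) (g w)) \<in> borel_measurable M"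
    if "f \<in> measurable M (gauss I)" "g \<in> measurable M (gauss I)" for f g and M :: "'x measure"
    unfolding K_def by (rule measurable_in_cone[OF that])
  have Kc: "(\<lambda>g. K y g) \<in> borel_measurable (gauss I)" for y
  proof -
    have "(\<lambda>g. K (restrict y I) g) \<in> borel_measurable (gauss I)"
      by (intro K measurable_const) (auto simp: space_gauss)
    moreover have "K (restrict y I) g = K y g" for g
      using in_cone_cong[of I "restrict y I" y g g] by (simp add: K_def)
    ultimately show ?thesis by simp
  qed
  have Kc': "(\<lambda>\<omega>. K (Y \<omega>) g) \<in> borel_measurable P" for g
  proof -
    have "(\<lambda>\<omega>. K (Y \<omega>) (restrict g I)) \<in> borel_measurable P"
      by (intro K measurable_const Y) (auto simp: space_gauss)
    moreover have "K y (restrict g I) = K y g" for y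
      using in_cone_cong[of I y y "restrict g I" g] by (simp add: K_def indicator_def)
    ultimately show ?thesis by simp
  qed
  \<comment> \<open>The two marginals of the kernel: \<open>h_const\<close> rests on the invariance
    of the Gaussian law, \<open>H_const\<close> on that of the law of \<open>Y\<close>.\<close>
  define h where "h y = (\<integral>\<^sup>+g. K y g \<partial>gauss I)" for y
  define H where "H g = (\<integral>\<^sup>+\<omega>. K (Y \<omega>) g \<partial>P)" for g
  define good where "good y = (\<integral>\<^sup>+g. K y g * indicator C g \<partial>gauss I)" for y
  have Khh: "K (householder I a y) (householder I a g) = K y g" if "ip I e a = 0" for a y g
    using in_cone_householder[OF that] by (simp add: K_def indicator_def)
  have h_const: "h y = h z"
    if yz: "ip I e y = 0" "ip I e z = 0" "L2_set y I > 0" "L2_set z I > 0" for y z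
  proof -
    obtain a c where ac: "ip I e a = 0" "c > 0" "\<forall>i\<in>I. householder I a (\<lambda>i. c * y i) i = z i"
      using rotate_direction[OF I yz] by blast
    have "h z = (\<integral>\<^sup>+g. K (householder I a (\<lambda>i. c * y i)) g \<partial>gauss I)"
      unfolding h_def K_def using in_cone_cong[of I z "householder I a (\<lambda>i. c * y i)"] ac(3) by (simp add: indicator_def)
    also have "\<dots> = (\<integral>\<^sup>+g. K (householder I a (\<lambda>i. c * y i)) (householder I a g) \<partial>gauss I)"
      by (rule gauss_invariant_nn_integral[OF householder_gauss_invariant[OF I] Kc, symmetric])
    also have "\<dots> = (\<integral>\<^sup>+g. K (\<lambda>i. c * y i) g \<partial>gauss I)"
      by (simp only: Khh[OF ac(1)])
    also have "\<dots> = h y"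
      unfolding h_def K_def in_cone_scale_left[OF ac(2)] ..
    finally show ?thesis by simp
  qed
  have H_const: "H g = H g'" if gg: "perp_norm I e g > 0" "perp_norm I e g' > 0" for g g'
  proof -
    let ?p = "\<lambda>i. g i - ip I e g * e i" and ?q = "\<lambda>i. g' i - ip I e g' * e i"
    obtain a c where ac: "ip I e a = 0" "c > 0" "\<forall>i\<in>I. householder I a (\<lambda>i. c * ?p i) i = ?q i"
      using rotate_direction[OF I, of e ?p ?q] perp_component(1,2)[OF e] gg by auto
    have Kp: "K (Y \<omega>) ?p = K (Y \<omega>) g" "K (Y \<omega>) ?q = K (Y \<omega>) g'" for \<omega>
      using in_cone_perp[OF e Ye] by (simp_all add: K_def indicator_def)
    have "H g' = (\<integral>\<^sup>+\<omega>. K (Y \<omega>) ?q \<partial>P)" unfolding H_def Kp ..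
    also have "\<dots> = (\<integral>\<^sup>+\<omega>. K (Y \<omega>) (householder I a (\<lambda>i. c * ?p i)) \<partial>P)"
      using in_cone_cong[of I "Y _" "Y _" "householder I a (\<lambda>i. c * ?p i)" ?q] ac(3)
      by (intro nn_integral_cong) (simp add: K_def indicator_def)
    also have "\<dots> = (\<integral>\<^sup>+\<omega>. K (householder I a (Y \<omega>)) (\<lambda>i. c * ?p i) \<partial>P)"
    proof (rule nn_integral_cong)
      fix \<omega>
      have eq: "K (Y \<omega>) (householder I a (\<lambda>i. c * ?p i)) =
        K (householder I a (Y \<omega>)) (householder I a (householder I a (\<lambda>i. c * ?p i)))"
        using Khh[OF ac(1)] by simp
      have "in_cone I e \<tau> (householder I a (Y \<omega>)) (householder I a (householder I a (\<lambda>i. c * ?p i)))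
          \<longleftrightarrow> in_cone I e \<tau> (householder I a (Y \<omega>)) (\<lambda>i. c * ?p i)"
        by (rule in_cone_cong) (simp_all add: householder_involution)
      then have "K (householder I a (Y \<omega>)) (householder I a (householder I a (\<lambda>i. c * ?p i))) =
        K (householder I a (Y \<omega>)) (\<lambda>i. c * ?p i)"
        by (simp only: K_def)
      then show "K (Y \<omega>) (householder I a (\<lambda>i. c * ?p i)) = K (householder I a (Y \<omega>)) (\<lambda>i. c * ?p i)"
        unfolding eq .
    qed
    also have "\<dots> = (\<integral>\<^sup>+\<omega>. K (Y \<omega>) (\<lambda>i. c * ?p i) \<partial>P)"
    proof (rule inv[OF ac(1)])
      have "(\<lambda>y. K y (restrict (\<lambda>i. c * ?p i) I)) \<in> borel_measurable (gauss I)"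
        by (intro K measurable_const) (auto simp: space_gauss)
      moreover have "K y (restrict (\<lambda>i. c * ?p i) I) = K y (\<lambda>i. c * ?p i)" for y
        using in_cone_cong[of I y y "restrict (\<lambda>i. c * ?p i) I" "\<lambda>i. c * ?p i"] by (simp add: K_def indicator_def)
      ultimately show "(\<lambda>y. K y (\<lambda>i. c * ?p i)) \<in> borel_measurable (gauss I)" by simp
    qed
    also have "\<dots> = H g"
      unfolding H_def using in_cone_scale_right[OF ac(2), of I e \<tau> _ ?p] Kp(1)
      by (intro nn_integral_cong) (simp add: K_def indicator_def)
    finally show ?thesis by simp
  qed
  have K0: "K (Y \<omega>) g = 0" if "\<not> perp_norm I e g > 0 \<or> \<not> L2_set (Y \<omega>) I > 0" for \<omega> g
  proof -
    have "ip I (Y \<omega>) g = ip I (Y \<omega>) (\<lambda>i. g i - ip I e g * e i)"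
      using perp_component(3)[OF e Ye] by simp
    also have "\<dots> \<le> L2_set (Y \<omega>) I * perp_norm I e g"
      using abs_ip_le[of I "Y \<omega>" "\<lambda>i. g i - ip I e g * e i"] perp_component(2)[OF e, of g] by simp
    finally have le: "ip I (Y \<omega>) g \<le> L2_set (Y \<omega>) I * perp_norm I e g" .
    have "perp_norm I e g \<ge> 0" using perp_component(2)[OF e, of g] L2_set_nonneg by metis
    then have "L2_set (Y \<omega>) I = 0 \<or> perp_norm I e g = 0"
      using that L2_set_nonneg[of "Y \<omega>" I] by (auto simp: not_less)
    then have "\<not> in_cone I e \<tau> (Y \<omega>) g" using le by (auto simp: in_cone_def)
    then show ?thesis by (simp add: K_def)
  qed
  have good_m [measurable]: "good \<in> borel_measurable (gauss I)"
    unfolding good_def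
    by (intro G.borel_measurable_nn_integral) measurable
  \<comment> \<open>The cone at such a \<open>y\<close> meets \<open>C\<close> in positive measure.
    For every other value of \<open>Y\<close>, the whole cone mass lies outside
    \<open>C\<close>.\<close>
  define D where "D = {y \<in> space (gauss I). good y > 0}"
  have D: "D \<in> sets (gauss I)" unfolding D_def by measurable
  have D1: "\<exists>g\<in>C. in_cone I e \<tau> y g" if "y \<in> D" for y
  proof (rule ccontr)
    assume "\<not> (\<exists>g\<in>C. in_cone I e \<tau> y g)"
    then have z: "K y g * indicator C g = 0" for g by (auto simp: K_def indicator_def)
    have "good y = (\<integral>\<^sup>+g. 0 \<partial>gauss I)" unfolding good_def by (rule nn_integral_cong) (rule z)
    then have "good y = 0" by simp
    then show False using that by (simp add: D_def)
  qed
  let ?bad = "{\<omega> \<in> space P. Y \<omega> \<notin> D \<and> L2_set (Y \<omega>) I > 0}"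
  let ?nz = "{g \<in> space (gauss I). perp_norm I e g > 0}"
  have [measurable]: "(\<lambda>\<omega>. ip I (Y \<omega>) (Y \<omega>)) \<in> borel_measurable P"
    by (intro measurable_ip measurable_into_gauss_apply[OF Y]; assumption)
  have LY: "(\<lambda>\<omega>. L2_set (Y \<omega>) I) \<in> borel_measurable P"
    unfolding L2_eq_sqrt_ip by measurable
  note D [measurable] LY [measurable]
  have badm: "?bad \<in> sets P" by measurable
  have nzm: "?nz \<in> sets (gauss I)"
  proof -
    have [measurable]: "(\<lambda>g. ip I g g) \<in> borel_measurable (gauss I)" "(\<lambda>g. ip I e g) \<in> borel_measurable (gauss I)"
      by (intro measurable_ip measurable_gauss_apply borel_measurable_const; assumption)+
    show ?thesis unfolding perp_norm_def by measurable
  qed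
  have "emeasure P ?bad * emeasure (gauss I) ?nz \<le> emeasure (gauss I) (space (gauss I) - C)"
  proof (cases "?bad = {} \<or> ?nz = {}")
    case True
    then have "emeasure P ?bad = 0 \<or> emeasure (gauss I) ?nz = 0" by (auto simp del: Collect_empty_eq)
    then show ?thesis by auto
  next
    case False
    then obtain \<omega>0 g0 where w0: "L2_set (Y \<omega>0) I > 0" and g0: "perp_norm I e g0 > 0" by auto
    define h0 where "h0 = h (Y \<omega>0)"
    define c where "c = H g0"
    have hY: "h (Y \<omega>) = (if L2_set (Y \<omega>) I > 0 then h0 else 0)" for \<omega>
      using h_const[OF Ye Ye, of \<omega> \<omega>0] w0 K0[of _ \<omega>] by (auto simp: h0_def h_def)
    have Hg: "H g = (if perp_norm I e g > 0 then c else 0)" for g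
      using H_const[of g g0] g0 K0[of g] by (auto simp: c_def H_def)
    have h0_pos: "h0 > 0"
      unfolding h0_def h_def K_def by (rule gauss_cone_pos[OF I w0 Ye \<tau>])
    have h0_fin: "h0 < \<infinity>"
    proof -
      have "h0 \<le> (\<integral>\<^sup>+g. 1 \<partial>gauss I)"
        unfolding h0_def h_def K_def by (intro nn_integral_mono) (auto simp: indicator_def)
      also have "\<dots> = 1" by (simp add: G.emeasure_space_1)
      finally show ?thesis by (auto simp: order.strict_trans1)
    qed
    \<comment> \<open>Double counting. The full integral of \<open>K\<close> shows that
      \<open>c\<close> times the measure of \<open>?nz\<close> is at most \<open>h0\<close>.
      Restricted to \<open>g\<close> outside \<open>C\<close>, the integral is at least
      \<open>h0\<close> times the probability of \<open>?bad\<close> and at most \<open>c\<close>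
      times the measure of the complement of \<open>C\<close>. Combining both, \<open>h0\<close>
      cancels, however narrow the cones are.\<close>
    have "c * emeasure (gauss I) ?nz = (\<integral>\<^sup>+g. H g \<partial>gauss I)"
      using nzm by (subst nn_integral_cmult_indicator[symmetric, OF nzm])
        (auto intro!: nn_integral_cong simp: Hg indicator_def space_gauss)
    also have "\<dots> = (\<integral>\<^sup>+\<omega>. h (Y \<omega>) \<partial>P)"
      unfolding H_def h_def by (rule PG.Fubini') measurable
    also have "\<dots> \<le> (\<integral>\<^sup>+\<omega>. h0 \<partial>P)" by (intro nn_integral_mono) (simp add: hY)
    also have "\<dots> = h0" by (simp add: P.emeasure_space_1)
    finally have c_le: "c * emeasure (gauss I) ?nz \<le> h0" .
    have "emeasure P ?bad * h0 = (\<integral>\<^sup>+\<omega>. h0 * indicator ?bad \<omega> \<partial>P)"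
      using badm by (simp add: nn_integral_cmult_indicator mult.commute)
    also have "\<dots> \<le> (\<integral>\<^sup>+\<omega>. (\<integral>\<^sup>+g. K (Y \<omega>) g * indicator (space (gauss I) - C) g \<partial>gauss I) \<partial>P)"
    proof (rule nn_integral_mono)
      fix \<omega> assume w: "\<omega> \<in> space P"
      show "h0 * indicator ?bad \<omega> \<le> (\<integral>\<^sup>+g. K (Y \<omega>) g * indicator (space (gauss I) - C) g \<partial>gauss I)"
      proof (cases "\<omega> \<in> ?bad")
        case True
        then have g0: "good (Y \<omega>) = 0"
          using measurable_space[OF Y w] by (auto simp: D_def)
        have "h0 = h (Y \<omega>)" using True by (simp add: hY)
        also have "h (Y \<omega>) = (\<integral>\<^sup>+g. K (Y \<omega>) g * indicator C g + K (Y \<omega>) g * indicator (space (gauss I) - C) g \<partial>gauss I)"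
          unfolding h_def by (intro nn_integral_cong) (auto simp: indicator_def)
        also have "\<dots> = good (Y \<omega>) + (\<integral>\<^sup>+g. K (Y \<omega>) g * indicator (space (gauss I) - C) g \<partial>gauss I)"
          unfolding good_def using C by (intro nn_integral_add borel_measurable_times_ennreal Kc) auto
        finally show ?thesis using g0 True by simp
      qed simp
    qed
    also have "\<dots> = (\<integral>\<^sup>+g. (\<integral>\<^sup>+\<omega>. K (Y \<omega>) g * indicator (space (gauss I) - C) g \<partial>P) \<partial>gauss I)"
      by (rule PG.Fubini'[symmetric]) measurable
    also have "\<dots> = (\<integral>\<^sup>+g. H g * indicator (space (gauss I) - C) g \<partial>gauss I)"
      unfolding H_def by (intro nn_integral_cong nn_integral_multc Kc')
    also have "\<dots> \<le> (\<integral>\<^sup>+g. c * indicator (space (gauss I) - C) g \<partial>gauss I)"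
      by (intro nn_integral_mono mult_right_mono) (auto simp: Hg)
    also have "\<dots> = c * emeasure (gauss I) (space (gauss I) - C)"
      using C by (intro nn_integral_cmult_indicator) auto
    finally have e: "emeasure P ?bad * h0 \<le> c * emeasure (gauss I) (space (gauss I) - C)" .
    have "h0 * (emeasure P ?bad * emeasure (gauss I) ?nz) = (emeasure P ?bad * h0) * emeasure (gauss I) ?nz"
      by (simp only: mult_ac)
    also have "\<dots> \<le> (c * emeasure (gauss I) (space (gauss I) - C)) * emeasure (gauss I) ?nz"
      by (rule mult_right_mono[OF e]) simp
    also have "\<dots> = (c * emeasure (gauss I) ?nz) * emeasure (gauss I) (space (gauss I) - C)"
      by (simp only: mult_ac)
    also have "\<dots> \<le> h0 * emeasure (gauss I) (space (gauss I) - C)"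
      by (rule mult_right_mono[OF c_le]) simp
    finally show ?thesis using h0_pos h0_fin by (subst (asm) ennreal_mult_le_mult_iff) auto
  qed
  then show ?thesis using D D1 by blast
qed

section \<open>Noise norm and top singular value of a spiked Gaussian matrix\<close>

lemma top_pair_scale:
  assumes "top_pair I J A \<sigma> u v" "t > 0"
  shows "top_pair I J (\<lambda>p. t * A p) (t * \<sigma>) u v"
proof -
  have m: "mv I J (\<lambda>p. t * A p) y = (\<lambda>i\<in>I. t * mv I J A y i)" for y
    by (auto simp: mv_def ip_simps)
  have tm: "tmv I J (\<lambda>p. t * A p) x = (\<lambda>j\<in>J. t * tmv I J A x j)" for x
    by (auto simp: tmv_def ip_simps)
  have b: "bil I J (\<lambda>p. t * A p) x y = t * bil I J A x y" for x y
    unfolding bil_def ip_simps ..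
  have "bil I J (\<lambda>p. t * A p) x y \<le> t * \<sigma> * (L2_set x I * L2_set y J)" for x y
    unfolding b using assms by (simp add: top_pair_def mult.assoc)
  then show ?thesis using assms by (simp add: top_pair_def m tm)
qed

lemma top_pair_cong:
  assumes "\<And>i j. i \<in> I \<Longrightarrow> j \<in> J \<Longrightarrow> A (i, j) = B (i, j)"
  shows "top_pair I J A \<sigma> u v \<longleftrightarrow> top_pair I J B \<sigma> u v"
proof -
  have "mv I J A = mv I J B" "tmv I J A = tmv I J B" "bil I J A = bil I J B"
    using assms by (auto simp: mv_def tmv_def bil_def fun_eq_iff intro!: restrict_ext ip_cong)
  then show ?thesis by (simp add: top_pair_def)
qed

lemma sqrt_scaled_le:
  assumes "1 \<le> \<delta> * N" "\<delta> \<ge> 0" "N \<ge> 0"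
  shows "sqrt (1 + \<delta> * N) \<le> sqrt (2 * \<delta>) * sqrt N"
  using assms by (simp add: real_sqrt_mult[symmetric] mult.commute)

text \<open>A reflection takes \<open>e\<close> to the first unit vector, which puts the spike into
  the corner that tridiagonalization preserves; the bound on the noise and the test vectors then
  come from the same event, chosen before \<open>l\<close>. In the bound on \<open>\<sigma>\<close>,
  the term \<open>\<kappa>\<close> secures a spectral gap, and \<open>c * l\<close> an overlap that
  does not degrade for strong spikes.\<close>

lemma spiked_gauss_event:
  assumes l0: "l0 > 1"
  shows "\<exists>\<delta> \<kappa> c n0. 0 < \<delta> \<and> 0 < \<kappa> \<and> 0 < c \<and> (\<forall>N\<ge>n0. \<forall>e. L2_set e {0..<N} = 1 \<longrightarrow>
    (\<exists>E\<in>sets (gauss ({0..<N} \<times> {0..<N})).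
      measure (gauss ({0..<N} \<times> {0..<N})) E \<ge> 1 - real N * (6 * exp (- (\<delta>\<^sup>2 * real N / 16))) \<and>
      (\<forall>g\<in>E. (\<forall>x y. bil {0..<N} {0..<N} g x y \<le> (2 + \<kappa>) * sqrt (real N) * (L2_set x {0..<N} * L2_set y {0..<N})) \<and>
        (\<forall>l\<ge>l0. \<forall>\<sigma> u w. top_pair {0..<N} {0..<N} (\<lambda>(i, j). l * sqrt (real N) * e i * e j + g (i, j)) \<sigma> u w \<longrightarrow>
           \<sigma> \<ge> (2 + \<kappa> + max \<kappa> (c * l)) * sqrt (real N)))))"
proof -
  define t where "t = 1 / l0"
  obtain \<delta> L \<kappa> c where c: "0 < \<delta>" "2 * \<delta> \<le> 1" "0 < \<kappa>" "0 < c" "1 \<le> L"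
    and up: "sqrt (2 * \<delta>) + 2 * sqrt (1 + \<delta>) \<le> 2 + \<kappa>"
    and lo0: "let t = 1 / l0; S = (\<Sum>i<L. t ^ (2 * i)); S' = (\<Sum>i<L - 1. t ^ (2 * i)) in
      S > 0 \<and> (\<forall>l\<ge>l0. (l + 2 * sqrt (1 - 2 * \<delta>) * t * S' - sqrt (2 * \<delta>) * S) / S \<ge> 2 + \<kappa> + max \<kappa> (c * l))"
    using spike_constants[OF l0] by blast
  define S where "S = (\<Sum>i<L. t ^ (2 * i))"
  define S' where "S' = (\<Sum>i<L - 1. t ^ (2 * i))"
  have S: "S > 0" and lo: "\<And>l. l \<ge> l0 \<Longrightarrow> (l + 2 * sqrt (1 - 2 * \<delta>) * t * S' - sqrt (2 * \<delta>) * S) / S \<ge> 2 + \<kappa> + max \<kappa> (c * l)"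
    using lo0 unfolding Let_def t_def[symmetric] S_def[symmetric] S'_def[symmetric] by auto
  have t: "t \<ge> 0" using l0 by (simp add: t_def)
  have S'0: "S' \<ge> 0" using t by (auto simp: S'_def intro: sum_nonneg)
  \<comment> \<open>Gives \<open>real L + 1 \<le> \<delta> * real N\<close>, so that both the
    cut-off \<open>L\<close> and the 1 in \<open>1 + s\<close> are absorbed by
    \<open>\<delta> * real N\<close>.\<close>
  define n0 where "n0 = nat \<lceil>real (Suc L) / \<delta>\<rceil>"
  have "\<exists>E\<in>sets (gauss ({0..<N} \<times> {0..<N})).
      measure (gauss ({0..<N} \<times> {0..<N})) E \<ge> 1 - real N * (6 * exp (- (\<delta>\<^sup>2 * real N / 16))) \<and>
      (\<forall>g\<in>E. (\<forall>x y. bil {0..<N} {0..<N} g x y \<le> (2 + \<kappa>) * sqrt (real N) * (L2_set x {0..<N} * L2_set y {0..<N})) \<and>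
        (\<forall>l\<ge>l0. \<forall>\<sigma> u w. top_pair {0..<N} {0..<N} (\<lambda>(i, j). l * sqrt (real N) * e i * e j + g (i, j)) \<sigma> u w \<longrightarrow>
           \<sigma> \<ge> (2 + \<kappa> + max \<kappa> (c * l)) * sqrt (real N)))"
    if N: "N \<ge> n0" and e: "L2_set e {0..<N} = 1" for N e
  proof -
    define I where "I = {0..<N}"
    have "real (Suc L) / \<delta> \<le> real N" using N by (simp add: n0_def nat_le_iff ceiling_le_iff)
    then have LN: "real L + 1 \<le> \<delta> * real N" using c by (simp add: field_simps)
    have "\<delta> * real N \<le> 1 * real N" using c by (intro mult_right_mono) auto
    then have L: "L < N" "1 \<le> \<delta> * real N" "real L \<le> \<delta> * real N" using LN c by auto
    have I: "finite I" "0 \<in> I" using L by (auto simp: I_def)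
    define s where "s = \<delta> * real N"
    have s0: "s \<ge> 0" using c by (simp add: s_def)
    obtain E0 where E0: "E0 \<in> sets (gauss (I \<times> I))" "\<And>B. B \<in> E0 \<Longrightarrow> tridiagonalizable s N N 0 B"
      "measure (gauss (I \<times> I)) E0 \<ge> 1 - real N * (6 * exp (- (\<delta>\<^sup>2 * real N / 16)))"
      using tridiagonalizable_event[of N N N \<delta> 0] c unfolding I_def s_def by auto
    define a where "a = (\<lambda>i. e i - (if i = 0 then 1 else 0))"
    let ?H = "householder I a"
    define T where "T g = refl_left I I a (refl_right I I a g)" for g
    have T: "gauss_invariant (I \<times> I) T"
      unfolding T_def[abs_def]
      by (intro gauss_invariant_comp[OF refl_left_gauss_invariant refl_right_gauss_invariant] I)
    define E where "E = {g \<in> space (gauss (I \<times> I)). T g \<in> E0}"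
    have He: "?H e i = (if i = 0 then 1 else 0)" if "i \<in> I" for i
      unfolding a_def
    proof (rule householder_swap[OF I(1) _ that])
      show "ip I e e = ip I (\<lambda>i. if i = 0 then 1 else 0) (\<lambda>i. if i = 0 then 1 else 0)"
        using ip_unit_vec[OF I, of 1 "\<lambda>i. if i = 0 then 1 else 0"] e[folded I_def]
        by (simp add: ip_self_L2[of I e])
    qed
    have Tbil: "bil I I g x y = bil I I (T g) (?H x) (?H y)" for g x y
      unfolding T_def bil_refl_left bil_refl_right
      by (rule bil_cong) (auto simp: householder_involution)
    have "emeasure (gauss (I \<times> I)) E = emeasure (gauss (I \<times> I)) E0"
      unfolding E_def by (rule gauss_invariant_emeasure[OF T E0(1)])
    then have mE: "measure (gauss (I \<times> I)) E = measure (gauss (I \<times> I)) E0" by (simp add: measure_def)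
    have "T -` E0 \<inter> space (gauss (I \<times> I)) \<in> sets (gauss (I \<times> I))"
      using T E0(1) unfolding gauss_invariant_def by (intro measurable_sets) auto
    then have sE: "E \<in> sets (gauss (I \<times> I))" unfolding E_def by (simp add: vimage_def Int_def conj_commute)
    have root: "sqrt (1 + s) \<le> sqrt (2 * \<delta>) * sqrt (real N)" unfolding s_def using L c by (intro sqrt_scaled_le) auto
    have bnd: "bil I I g x y \<le> (2 + \<kappa>) * sqrt (real N) * (L2_set x I * L2_set y I)" if g: "g \<in> E" for g x y
    proof -
      have "tridiagonalizable s N N 0 (T g)" using g E0(2) by (simp add: E_def)
      then have "bil I I g x y \<le> (sqrt (1 + s) + 2 * sqrt (real N + s)) * (L2_set x I * L2_set y I)"
        using tridiagonalizable_bound[of s N N "T g" N "?H x" "?H y"] s0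
        unfolding Tbil[of g] I_def[symmetric] by (simp add: abs_le_iff)
      also have "\<dots> \<le> ((2 + \<kappa>) * sqrt (real N)) * (L2_set x I * L2_set y I)"
      proof (rule mult_right_mono)
        have "real N + s = (1 + \<delta>) * real N" by (simp add: s_def algebra_simps)
        then have "sqrt (real N + s) = sqrt (1 + \<delta>) * sqrt (real N)" by (simp add: real_sqrt_mult)
        then have "sqrt (1 + s) + 2 * sqrt (real N + s) \<le> sqrt (2 * \<delta>) * sqrt (real N) + 2 * (sqrt (1 + \<delta>) * sqrt (real N))"
          using root by linarith
        also have "\<dots> = (sqrt (2 * \<delta>) + 2 * sqrt (1 + \<delta>)) * sqrt (real N)" by (simp add: distrib_right)
        also have "\<dots> \<le> (2 + \<kappa>) * sqrt (real N)" using up by (intro mult_right_mono) auto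
        finally show "sqrt (1 + s) + 2 * sqrt (real N + s) \<le> (2 + \<kappa>) * sqrt (real N)" .
      qed simp
      finally show ?thesis .
    qed
    have top_value: "\<sigma> \<ge> (2 + \<kappa> + max \<kappa> (c * l)) * sqrt (real N)"
      if g: "g \<in> E" and l: "l \<ge> l0" and top: "top_pair I I (\<lambda>(i, j). l * sqrt (real N) * e i * e j + g (i, j)) \<sigma> u w"
      for g l \<sigma> u w
    proof -
      have T': "tridiagonalizable s N N 0 (T g)" using g E0(2) by (simp add: E_def)
      show ?thesis
      proof -
        have "2 * \<delta> * real N \<le> 1 * real N" using c by (intro mult_right_mono) auto
        then have True: "real L + s \<le> real N" using L(3) by (simp add: s_def)
        obtain x y where xy: "x 0 = 1" "y 0 = 1" "ip I x x = S" "ip I y y = S"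
          and low: "bil I I (T g) x y \<ge> 2 * sqrt (real N - real L - s) * t * S' - sqrt (1 + s) * S"
          using tridiagonalizable_test_vectors[OF T' c(5) L(1) True s0 t]
          unfolding S_def[symmetric] S'_def[symmetric] I_def[symmetric] by blast
        have ex: "ip I e (?H z) = z 0" for z
        proof -
          have "ip I e (?H z) = ip I (?H e) z" by (rule ip_householder_sym[symmetric])
          also have "\<dots> = ip I (\<lambda>i. if i = 0 then 1 else 0) z" by (rule ip_cong) (use He in auto)
          finally show ?thesis using ip_unit_vec[OF I, of 1 z] by simp
        qed
        have bT: "bil I I g (?H x) (?H y) = bil I I (T g) x y"
          unfolding Tbil[of g] by (rule bil_cong) (auto simp: householder_involution)
        have "bil I I (\<lambda>(i, j). l * sqrt (real N) * e i * e j + g (i, j)) (?H x) (?H y)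
          = l * sqrt (real N) * (ip I e (?H x) * ip I e (?H y)) + bil I I g (?H x) (?H y)"
          by (rule bil_add_rank_one) simp
        then have "l * sqrt (real N) + bil I I (T g) x y =
            bil I I (\<lambda>(i, j). l * sqrt (real N) * e i * e j + g (i, j)) (?H x) (?H y)"
          unfolding bT ex xy(1,2) by simp
        also have "\<dots> \<le> \<sigma> * (L2_set (?H x) I * L2_set (?H y) I)"
          using top unfolding top_pair_def by blast
        also have "L2_set (?H x) I * L2_set (?H y) I = S"
          using xy(3,4) S by (simp add: L2_eq_sqrt_ip)
        finally have 1: "l * sqrt (real N) + bil I I (T g) x y \<le> \<sigma> * S" .
        \<comment> \<open>Both \<open>real L\<close> and \<open>s\<close> are at most
          \<open>\<delta> * real N\<close>.\<close>
        have "sqrt (1 - 2 * \<delta>) * sqrt (real N) \<le> sqrt (real N - real L - s)"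
          using L(3) by (simp add: real_sqrt_mult[symmetric] s_def algebra_simps)
        then have "sqrt (1 - 2 * \<delta>) * sqrt (real N) * (2 * t * S') \<le> sqrt (real N - real L - s) * (2 * t * S')"
          using t S'0 by (intro mult_right_mono) auto
        moreover have "sqrt (1 + s) * S \<le> sqrt (2 * \<delta>) * sqrt (real N) * S"
          using root S by (intro mult_right_mono) auto
        moreover have "sqrt (real N) * (l + 2 * sqrt (1 - 2 * \<delta>) * t * S' - sqrt (2 * \<delta>) * S) =
          l * sqrt (real N) + sqrt (1 - 2 * \<delta>) * sqrt (real N) * (2 * t * S') - sqrt (2 * \<delta>) * sqrt (real N) * S"
          by (simp add: algebra_simps)
        moreover have "sqrt (real N - real L - s) * (2 * t * S') = 2 * sqrt (real N - real L - s) * t * S'" by simp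
        ultimately have "sqrt (real N) * (l + 2 * sqrt (1 - 2 * \<delta>) * t * S' - sqrt (2 * \<delta>) * S) \<le> \<sigma> * S"
          using 1 low by linarith
        then have "sqrt (real N) * ((l + 2 * sqrt (1 - 2 * \<delta>) * t * S' - sqrt (2 * \<delta>) * S) / S) \<le> \<sigma>"
          using S by (simp add: field_simps)
        moreover have "sqrt (real N) * (2 + \<kappa> + max \<kappa> (c * l)) \<le>
          sqrt (real N) * ((l + 2 * sqrt (1 - 2 * \<delta>) * t * S' - sqrt (2 * \<delta>) * S) / S)"
          by (intro mult_left_mono lo l) simp
        ultimately show ?thesis by (simp add: mult.commute)
      qed
    qed
    show ?thesis
      unfolding I_def[symmetric]
    proof (intro bexI[OF _ sE] conjI ballI allI impI)
      show "1 - real N * (6 * exp (- (\<delta>\<^sup>2 * real N / 16))) \<le> measure (gauss (I \<times> I)) E"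
        using mE E0(3) by simp
    qed (rule bnd top_value; assumption)+
  qed
  then show ?thesis using c by blast
qed

section \<open>Matricization\<close>

lemma bij_betw_grid:
  fixes n m :: nat
  shows "bij_betw (\<lambda>(i, j). i + j * n) ({0..<n} \<times> {0..<m}) {0..<n * m}"
proof (rule bij_betwI[of _ _ _ "\<lambda>k. (k mod n, k div n)"])
  show "(\<lambda>(i, j). i + j * n) \<in> {0..<n} \<times> {0..<m} \<rightarrow> {0..<n * m}"
  proof (intro funcsetI, clarsimp)
    fix i j assume "i < n" "j < m"
    then have "i + j * n < Suc j * n" by simp
    also have "\<dots> \<le> m * n" using \<open>j < m\<close> by (intro mult_le_mono1) simp
    finally show "i + j * n < n * m" by (simp add: mult.commute)
  qed
  show "(\<lambda>k. (k mod n, k div n)) \<in> {0..<n * m} \<rightarrow> {0..<n} \<times> {0..<m}"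
    by (auto simp: less_mult_imp_div_less mult.commute) (metis less_nat_zero_code mod_less_divisor mult_0_right neq0_conv)
qed auto

lemma sum_grid: "(\<Sum>k\<in>{0..<n * m}. f k) = (\<Sum>i\<in>{0..<n}. \<Sum>j\<in>{0..<m}. f (i + j * n :: nat) :: real)"
  unfolding sum.cartesian_product
  by (rule sum.reindex_bij_betw[OF bij_betw_grid, symmetric, THEN trans]) (auto intro!: sum.cong)

text \<open>The vector \<open>x \<otimes> z\<close>, with the index convention of \<^const>\<open>Mat1\<close>.\<close>

definition kron :: "nat \<Rightarrow> (nat \<Rightarrow> real) \<Rightarrow> (nat \<Rightarrow> real) \<Rightarrow> nat \<Rightarrow> real" where
  "kron n x z = (\<lambda>k. x (k mod n) * z (k div n))"

lemma L2_set_kron_like: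
  fixes n m :: nat
  assumes "\<And>i j. i < n \<Longrightarrow> j < m \<Longrightarrow> h (i + j * n) = x i * z j"
  shows "L2_set h {0..<n * m} = L2_set x {0..<n} * L2_set z {0..<m}"
proof -
  have "(\<Sum>k\<in>{0..<n * m}. (h k)\<^sup>2) = (\<Sum>i\<in>{0..<n}. \<Sum>j\<in>{0..<m}. (x i)\<^sup>2 * (z j)\<^sup>2)"
    unfolding sum_grid by (intro sum.cong) (auto simp: assms power_mult_distrib)
  also have "\<dots> = (\<Sum>i\<in>{0..<n}. (x i)\<^sup>2) * (\<Sum>j\<in>{0..<m}. (z j)\<^sup>2)" by (simp add: sum_product)
  finally show ?thesis by (simp add: L2_set_def real_sqrt_mult)
qed

lemma L2_set_kron: "L2_set (kron n x z) {0..<n * m} = L2_set x {0..<n} * L2_set z {0..<m}"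
  by (rule L2_set_kron_like) (simp add: kron_def)

text \<open>Reduces the norm of a matricization to inner products of the vector with product
  vectors.\<close>

lemma bil_matricization:
  "bil {0..<n} {0..<m} (\<lambda>(i, j). g (i + j * n)) x z = ip {0..<n * m} (kron n x z) g"
  unfolding ip_def sum_grid bil_def
  by (intro sum.cong) (auto simp: kron_def sum_distrib_left mult_ac)

lemma abs_bil_le_of_unit:
  assumes "\<And>x z. L2_set x I = 1 \<Longrightarrow> L2_set z J = 1 \<Longrightarrow> \<bar>bil I J B x z\<bar> \<le> d" and fin: "finite I" "finite J"
  shows "\<bar>bil I J B x z\<bar> \<le> d * (L2_set x I * L2_set z J)"
proof (cases "L2_set x I = 0 \<or> L2_set z J = 0")
  case True
  then have "(\<forall>i\<in>I. x i = 0) \<or> (\<forall>j\<in>J. z j = 0)" using fin by (simp add: L2_set_eq_0_iff)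
  then have "bil I J B x z = 0" by (auto simp: bil_def ip_def)
  then show ?thesis using True by auto
next
  case False
  define a where "a = L2_set x I"
  define b where "b = L2_set z J"
  have ab: "a > 0" "b > 0" using False by (auto simp: a_def b_def order_less_le)
  have "L2_set (\<lambda>i. (1 / a) * x i) I = 1" "L2_set (\<lambda>i. (1 / b) * z i) J = 1"
    using ab L2_set_right_distrib[of "1 / a" x I] L2_set_right_distrib[of "1 / b" z J] by (auto simp: a_def b_def)
  then have "\<bar>bil I J B (\<lambda>i. (1 / a) * x i) (\<lambda>i. (1 / b) * z i)\<bar> \<le> d" by (rule assms(1))
  moreover have "bil I J B (\<lambda>i. (1 / a) * x i) (\<lambda>i. (1 / b) * z i) = bil I J B x z / (a * b)"
    unfolding bil_def ip_simps by (simp add: field_simps)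
  ultimately have "\<bar>bil I J B x z\<bar> / (a * b) \<le> d" using ab by (simp add: abs_divide abs_mult)
  then show ?thesis using ab unfolding a_def[symmetric] b_def[symmetric] by (simp add: field_simps)
qed

lemma householder_map_to_first:
  fixes N :: nat
  assumes "L2_set e {0..<N} = 1" "0 < N"
  shows "householder {0..<N} (\<lambda>i. e i - (if i = 0 then 1 else 0)) g 0 = ip {0..<N} e g"
proof -
  let ?I = "{0..<N}" and ?a = "\<lambda>i. e i - (if i = 0 then 1 else 0)" and ?u = "\<lambda>i. if i = 0 then 1 else (0::real)"
  have u: "ip ?I ?u z = z 0" for z using ip_unit_vec[of ?I 0 1 z] assms(2) by simp
  have "householder ?I ?a e i = ?u i" if "i \<in> ?I" for i
    by (rule householder_swap) (use assms(1) that u[of ?u] in \<open>auto simp: ip_self_L2[of ?I e]\<close>)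
  then have "ip ?I (householder ?I ?a e) (householder ?I ?a g) = ip ?I ?u (householder ?I ?a g)"
    by (intro ip_cong) auto
  then show ?thesis by (simp add: u)
qed

text \<open>Relative to the length sqrt (n m) of \<open>g\<close>, both the norm of its
  matricization and its component along \<open>e\<close> are of order 1 / sqrt n. Three events
  enter: tridiagonalization with \<delta> = 1 at scale \<open>m\<close>; a chi-square bound for one
  coordinate, after a reflection taking \<open>e\<close> to the first unit vector; and one for the
  full length with \<delta> = 1/4, whence 256 = 16 * 4^2.\<close>

lemma small_matricization_event:
  assumes n: "4 \<le> n" "n \<le> m" and e: "L2_set e {0..<n * m} = 1"
  shows "\<exists>C\<in>sets (gauss {0..<n * m}).
    measure (gauss {0..<n * m}) (space (gauss {0..<n * m}) - C) \<le>
      real m * (6 * exp (- (real m / 16))) + 2 * exp (- (real m / 16)) + 2 * exp (- (real (n * m) / 256)) \<and>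
    (\<forall>g\<in>C. perp_norm {0..<n * m} e g \<ge> sqrt (real (n * m)) / 2 \<and> \<bar>ip {0..<n * m} e g\<bar> \<le> 2 * sqrt (real m) \<and>
      (\<forall>x z. \<bar>bil {0..<n} {0..<m} (\<lambda>(i, j). g (i + j * n)) x z\<bar> \<le> 5 * sqrt (real m) * (L2_set x {0..<n} * L2_set z {0..<m})))"
proof -
  define N where "N = n * m"
  define I where "I = {0..<N}"
  interpret G: prob_space "gauss I" by (rule prob_space_gauss)
  have N: "0 < N" "m \<le> N" "4 * m \<le> N" "1 \<le> m" using n by (auto simp: N_def)
  have I: "finite I" "0 \<in> I" "card I = N" using N by (auto simp: I_def)
  have eI: "L2_set e I = 1" using e by (simp add: I_def N_def)
  let ?P = "{0..<n} \<times> {0..<m}"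
  obtain E where E: "E \<in> sets (gauss ?P)" "\<And>B. B \<in> E \<Longrightarrow> tridiagonalizable (real m) n m 0 B"
    "measure (gauss ?P) E \<ge> 1 - real (min n m) * (6 * exp (- (real m / 16)))"
    using tridiagonalizable_event[of n m m 1 0] n by auto
  define f where "f = (\<lambda>(i, j). i + j * n)"
  have f: "inj_on f ?P" "f ` ?P \<subseteq> I"
    using bij_betw_grid[of n m] by (auto simp: bij_betw_def f_def I_def N_def)
  define C1 where "C1 = {g \<in> space (gauss I). (\<lambda>p\<in>?P. g (f p)) \<in> E}"
  have C1: "C1 \<in> sets (gauss I)" "measure (gauss I) C1 = measure (gauss ?P) E"
  proof -
    have "(\<lambda>g. \<lambda>p\<in>?P. g (f p)) -` E \<inter> space (gauss I) \<in> sets (gauss I)"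
      by (rule measurable_sets[OF measurable_gauss_reindex[OF f(2)] E(1)])
    then show "C1 \<in> sets (gauss I)" unfolding C1_def by (simp add: vimage_def Int_def conj_commute)
    show "measure (gauss I) C1 = measure (gauss ?P) E"
      unfolding C1_def measure_def using emeasure_gauss_reindex[OF f E(1)] by simp
  qed
  define a where "a = (\<lambda>i. e i - (if i = 0 then 1 else 0))"
  define B2 where "B2 = {g \<in> space (gauss I). \<not> \<bar>ip {0} g g - real (card {0::nat})\<bar> \<le> 1 * real m}"
  have B2: "B2 \<in> sets (gauss I)" "measure (gauss I) B2 \<le> 2 * exp (- (real m / 16))"
    using emeasure_gauss_subvector[of "{0}" "\<lambda>i. i" I "real m" 1] N I by (auto simp: B2_def)
  define B2' where "B2' = {g \<in> space (gauss I). householder I a g \<in> B2}"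
  have B2': "B2' \<in> sets (gauss I)" "measure (gauss I) B2' \<le> 2 * exp (- (real m / 16))"
  proof -
    note inv = householder_gauss_invariant[OF I(1), of a]
    have "householder I a -` B2 \<inter> space (gauss I) \<in> sets (gauss I)"
      using inv B2(1) unfolding gauss_invariant_def by (intro measurable_sets) auto
    then show "B2' \<in> sets (gauss I)" unfolding B2'_def by (simp add: vimage_def Int_def conj_commute)
    show "measure (gauss I) B2' \<le> 2 * exp (- (real m / 16))"
      unfolding B2'_def measure_def gauss_invariant_emeasure[OF inv B2(1)] using B2(2) by (simp add: measure_def)
  qed
  define B3 where "B3 = {g \<in> space (gauss I). \<not> \<bar>ip I g g - real (card I)\<bar> \<le> 1 / 4 * real N}"
  have B3: "B3 \<in> sets (gauss I)" "measure (gauss I) B3 \<le> 2 * exp (- (real N / 256))"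
    using emeasure_gauss_subvector[of I "\<lambda>i. i" I "real N" "1/4"] I by (auto simp: B3_def power2_eq_square)
  define C where "C = C1 - (B2' \<union> B3)"
  have C: "C \<in> sets (gauss I)" unfolding C_def using C1 B2' B3 by auto
  have "space (gauss I) - C = (space (gauss I) - C1) \<union> B2' \<union> B3"
    using sets.sets_into_space[OF B2'(1)] sets.sets_into_space[OF B3(1)] by (auto simp: C_def)
  then have "measure (gauss I) (space (gauss I) - C) \<le> measure (gauss I) ((space (gauss I) - C1) \<union> B2') + measure (gauss I) B3"
    using C1 B2' B3 by (simp add: measure_Un_le)
  also have "\<dots> \<le> measure (gauss I) (space (gauss I) - C1) + measure (gauss I) B2' + measure (gauss I) B3"
    using C1 B2' B3 by (simp add: measure_Un_le)
  also have "measure (gauss I) (space (gauss I) - C1) \<le> real m * (6 * exp (- (real m / 16)))"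
  proof -
    have "measure (gauss I) (space (gauss I) - C1) = 1 - measure (gauss ?P) E"
      using G.prob_compl[OF C1(1)] C1(2) by simp
    also have "\<dots> \<le> real (min n m) * (6 * exp (- (real m / 16)))" using E(3) by simp
    also have "\<dots> \<le> real m * (6 * exp (- (real m / 16)))" by (intro mult_right_mono) auto
    finally show ?thesis .
  qed
  finally have mC: "measure (gauss I) (space (gauss I) - C) \<le>
      real m * (6 * exp (- (real m / 16))) + 2 * exp (- (real m / 16)) + 2 * exp (- (real N / 256))"
    using B2'(2) B3(2) by simp
  have good: "perp_norm I e g \<ge> sqrt (real N) / 2 \<and> \<bar>ip I e g\<bar> \<le> 2 * sqrt (real m) \<and>
      (\<forall>x z. \<bar>bil {0..<n} {0..<m} (\<lambda>(i, j). g (i + j * n)) x z\<bar> \<le> 5 * sqrt (real m) * (L2_set x {0..<n} * L2_set z {0..<m}))"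
    if g: "g \<in> C" for g
  proof (intro conjI allI)
    have g1: "(\<lambda>p\<in>?P. g (f p)) \<in> E" and g2: "householder I a g \<notin> B2" and g3: "\<bar>ip I g g - real N\<bar> \<le> 1 / 4 * real N"
      using g I by (auto simp: C_def C1_def B2'_def B3_def)
    have "householder I a g \<in> space (gauss I)" by (auto simp: space_gauss householder_def)
    then have "\<bar>ip {0} (householder I a g) (householder I a g) - 1\<bar> \<le> real m" using g2 by (auto simp: B2_def)
    moreover have "householder I a g 0 = ip I e g"
      unfolding a_def I_def by (rule householder_map_to_first) (use eI N in \<open>auto simp: I_def\<close>)
    ultimately have eg: "(ip I e g)\<^sup>2 \<le> 2 * real m" using N(4) by (simp add: ip_def power2_eq_square)
    then show "\<bar>ip I e g\<bar> \<le> 2 * sqrt (real m)"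
      by (intro power2_le_imp_le[of "\<bar>ip I e g\<bar>"]) (auto simp: power_mult_distrib)
    \<comment> \<open>Here \<open>4 \<le> n\<close> enters: 3/4 N - 2 m \<ge> N / 4.\<close>
    have "4 * real m \<le> real N" using N(3) by (metis of_nat_mono of_nat_mult of_nat_numeral)
    then have "real N / 4 \<le> ip I g g - (ip I e g)\<^sup>2" using eg g3 by linarith
    then have "sqrt (real N / 4) \<le> perp_norm I e g" unfolding perp_norm_def by (rule real_sqrt_le_mono)
    then show "sqrt (real N) / 2 \<le> perp_norm I e g" by (simp add: real_sqrt_divide)
    fix x z
    have "bil {0..<n} {0..<m} (\<lambda>(i, j). g (i + j * n)) x z = bil {0..<n} {0..<m} (\<lambda>p\<in>?P. g (f p)) x z"
      by (rule bil_cong) (auto simp: f_def)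
    also have "\<bar>\<dots>\<bar> \<le> (sqrt (1 + real m) + 2 * sqrt (real m + real m)) * (L2_set x {0..<n} * L2_set z {0..<m})"
      by (rule tridiagonalizable_bound[OF E(2)[OF g1]]) (use n in auto)
    also have "\<dots> \<le> (5 * sqrt (real m)) * (L2_set x {0..<n} * L2_set z {0..<m})"
    proof (rule mult_right_mono)
      \<comment> \<open>Three summands of at most sqrt (2 m) \<le> 5/3 sqrt m each.\<close>
      have "sqrt (1 + real m) \<le> sqrt (real m + real m)" using N(4) by (intro real_sqrt_le_mono) simp
      moreover have "sqrt (real m + real m) \<le> 5 / 3 * sqrt (real m)"
        by (rule real_le_lsqrt) (auto simp: power_mult_distrib power2_eq_square)
      ultimately show "sqrt (1 + real m) + 2 * sqrt (real m + real m) \<le> 5 * sqrt (real m)" by linarith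
    qed simp
    finally show "\<bar>bil {0..<n} {0..<m} (\<lambda>(i, j). g (i + j * n)) x z\<bar> \<le> 5 * sqrt (real m) * (L2_set x {0..<n} * L2_set z {0..<m})" .
  qed
  show ?thesis
    using C mC good unfolding I_def N_def by blast
qed

text \<open>Unit vectors with cosine above 1 - \<tau> differ by at most sqrt (2 \<tau>), so a
  functional of norm at most 1 takes nearly the same value on both.\<close>

lemma cone_functional_bound:
  assumes cone: "in_cone I e \<tau> y g" and e: "L2_set e I = 1" and y: "ip I e y = 0" "L2_set y I > 0"
    and g: "perp_norm I e g > 0" and h: "L2_set h I \<le> 1" and \<tau>: "0 \<le> \<tau>"
    and b: "\<bar>ip I h (\<lambda>i. g i - ip I e g * e i)\<bar> \<le> b * perp_norm I e g"
  shows "\<bar>ip I h y\<bar> \<le> (b + sqrt (2 * \<tau>)) * L2_set y I"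
proof -
  define p where "p = (\<lambda>i. g i - ip I e g * e i)"
  define P where "P = perp_norm I e g"
  define Y where "Y = L2_set y I"
  have pos: "P > 0" "Y > 0" using g y by (auto simp: P_def Y_def)
  have p: "ip I p p = P\<^sup>2" "ip I y p = ip I y g"
    using perp_component(2)[OF e, of g] perp_component(3)[OF e y(1), of g] by (simp_all add: p_def P_def ip_self_L2)
  have yy: "ip I y y = Y\<^sup>2" by (simp add: Y_def ip_self_L2)
  define q where "q = (\<lambda>i. (1 / Y) * y i - (1 / P) * p i)"
  have "ip I q q = 2 - 2 * (ip I y g / (Y * P))"
    unfolding q_def ip_simps yy p ip_commute[of I p y] using pos by (simp add: power2_eq_square field_simps)
  moreover have "1 - \<tau> < ip I y g / (Y * P)"
    using cone pos unfolding in_cone_def P_def[symmetric] Y_def[symmetric] by (simp add: field_simps)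
  ultimately have "ip I q q \<le> 2 * \<tau>" by linarith
  then have q: "L2_set q I \<le> sqrt (2 * \<tau>)" unfolding L2_eq_sqrt_ip by (rule real_sqrt_le_mono)
  have "ip I h q = ip I h y / Y - ip I h p / P" unfolding q_def ip_simps by simp
  then have "\<bar>ip I h y / Y\<bar> \<le> \<bar>ip I h q\<bar> + \<bar>ip I h p / P\<bar>" by linarith
  then have "\<bar>ip I h y\<bar> / Y \<le> \<bar>ip I h q\<bar> + \<bar>ip I h p\<bar> / P" using pos by (simp add: abs_divide)
  also have "\<bar>ip I h q\<bar> \<le> sqrt (2 * \<tau>)"
  proof -
    have "\<bar>ip I h q\<bar> \<le> L2_set h I * L2_set q I" by (rule abs_ip_le)
    also have "\<dots> \<le> 1 * sqrt (2 * \<tau>)" by (intro mult_mono h q) auto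
    finally show ?thesis by simp
  qed
  also have "\<bar>ip I h p\<bar> / P \<le> b" using b pos unfolding p_def[symmetric] P_def[symmetric] by (simp add: field_simps)
  finally have "\<bar>ip I h y\<bar> / Y \<le> b + sqrt (2 * \<tau>)" by simp
  then show ?thesis using pos unfolding Y_def[symmetric] by (simp add: field_simps)
qed

section \<open>Krylov vectors and their rotational symmetry\<close>

definition spike_matrix :: "real \<Rightarrow> ('i \<Rightarrow> real) \<Rightarrow> ('i \<times> 'i \<Rightarrow> real) \<Rightarrow> 'i \<times> 'i \<Rightarrow> real" where
  "spike_matrix b e g = (\<lambda>(i, j). b * e i * e j + g (i, j))"

lemma bil_spike_refl_right:
  assumes "ip I e a = 0"
  shows "bil I I (spike_matrix b e (refl_right I I a g)) x y = bil I I (spike_matrix b e g) x (householder I a y)"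
proof -
  have "bil I I (spike_matrix b e g') x y = b * (ip I e x * ip I e y) + bil I I g' x y" for g' x y
    by (rule bil_add_rank_one) (simp add: spike_matrix_def)
  then show ?thesis by (simp add: bil_refl_right ip_householder_fixed[OF assms])
qed

lemma ip_unit_vec_left: "finite I \<Longrightarrow> j \<in> I \<Longrightarrow> ip I x (\<lambda>i. if i = j then 1 else 0) = x j"
  by (simp add: ip_def if_distrib[of "\<lambda>a. _ * a"] sum.delta cong: if_cong)

text \<open>If the reflection H fixes \<open>e\<close>, multiplying the noise by H from the right
  multiplies the whole spiked matrix A by H, and A^T A becomes H A^T A H. The identity is shown
  weakly, against all \<open>z\<close>, and read off at unit vectors.\<close>

lemma gram_spike_refl_right:
  assumes I: "finite I" and ea: "ip I e a = 0" and i: "i \<in> I"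
  shows "gram I I (spike_matrix b e (refl_right I I a g)) y i =
    householder I a (gram I I (spike_matrix b e g) (householder I a y)) i"
proof -
  let ?A = "spike_matrix b e g" and ?A' = "spike_matrix b e (refl_right I I a g)" and ?H = "householder I a"
  have mvA: "ip I x (mv I I ?A' y) = ip I x (mv I I ?A (?H y))" for x y
    by (simp add: ip_mv bil_spike_refl_right[OF ea])
  have "ip I (gram I I ?A' y) z = ip I (?H (gram I I ?A (?H y))) z" for z
  proof -
    have "ip I (gram I I ?A' y) z = ip I (mv I I ?A' y) (mv I I ?A' z)" by (rule ip_gram)
    also have "\<dots> = ip I (mv I I ?A' z) (mv I I ?A' y)" by (rule ip_commute)
    also have "\<dots> = ip I (mv I I ?A' z) (mv I I ?A (?H y))" by (rule mvA)
    also have "\<dots> = ip I (mv I I ?A (?H y)) (mv I I ?A' z)" by (rule ip_commute)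
    also have "\<dots> = ip I (mv I I ?A (?H y)) (mv I I ?A (?H z))" by (rule mvA)
    also have "\<dots> = ip I (gram I I ?A (?H y)) (?H z)" by (rule ip_gram[symmetric])
    finally show ?thesis by (simp add: ip_householder_sym)
  qed
  from this[of "\<lambda>k. if k = i then 1 else 0"] show ?thesis
    using ip_unit_vec_left[OF I i] by simp
qed

lemma gram_iterate_spike_refl_right:
  assumes I: "finite I" and ea: "ip I e a = 0" and i: "i \<in> I"
  shows "(gram I I (spike_matrix b e (refl_right I I a g)) ^^ L) e i =
    householder I a ((gram I I (spike_matrix b e g) ^^ L) e) i"
  using i
proof (induction L arbitrary: i)
  case 0
  then show ?case by (simp add: householder_def ip_commute[of I a e] ea)
next
  case (Suc L)
  let ?A = "spike_matrix b e g" and ?A' = "spike_matrix b e (refl_right I I a g)" and ?H = "householder I a"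
  have "gram I I ?A' ((gram I I ?A' ^^ L) e) = gram I I ?A' (?H ((gram I I ?A ^^ L) e))"
    by (rule gram_cong) (rule Suc.IH)
  then have "(gram I I ?A' ^^ Suc L) e i = ?H (gram I I ?A (?H (?H ((gram I I ?A ^^ L) e)))) i"
    using gram_spike_refl_right[OF I ea Suc.prems] by simp
  also have "gram I I ?A (?H (?H ((gram I I ?A ^^ L) e))) = gram I I ?A ((gram I I ?A ^^ L) e)"
    by (rule gram_cong) (simp add: householder_involution)
  finally show ?case by simp
qed

lemma perp_householder:
  assumes ea: "ip I e a = 0"
  shows "perp I e (householder I a x) = householder I a (perp I e x)"
proof
  fix i
  have "ip I a (perp I e x) = ip I a (\<lambda>i. x i - ip I e x * e i)" by (rule ip_cong) (auto simp: perp_def)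
  then have p: "ip I a (perp I e x) = ip I a x" by (simp add: ip_simps ip_commute[of I a e] ea)
  then show "perp I e (householder I a x) i = householder I a (perp I e x) i"
    unfolding perp_def[of I e "householder I a x"] ip_householder_fixed[OF ea]
      householder_def[of I a "perp I e x"] p
    by (simp add: perp_def householder_def)
qed

lemma perp_cong: "(\<And>i. i \<in> I \<Longrightarrow> x i = y i) \<Longrightarrow> perp I e x = perp I e y"
  using ip_cong[of I e e x y] by (auto simp: perp_def fun_eq_iff)

lemma ip_perp: "L2_set e I = 1 \<Longrightarrow> ip I e (perp I e x) = 0"
proof -
  assume e: "L2_set e I = 1"
  have "ip I e (perp I e x) = ip I e (\<lambda>i. x i - ip I e x * e i)" by (rule ip_cong) (auto simp: perp_def)
  then show ?thesis using e by (simp add: ip_simps ip_self_L2)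
qed

text \<open>Stands in for the part of the singular vector orthogonal to \<open>e\<close>: being
  polynomial in the noise it is measurable, and it is equivariant by
  \<open>krylov_refl_right\<close>.\<close>

definition krylov :: "'i set \<Rightarrow> real \<Rightarrow> ('i \<Rightarrow> real) \<Rightarrow> nat \<Rightarrow> ('i \<times> 'i \<Rightarrow> real) \<Rightarrow> 'i \<Rightarrow> real" where
  "krylov I b e L g = perp I e ((gram I I (spike_matrix b e g) ^^ L) e)"

lemma krylov_refl_right:
  assumes "finite I" "ip I e a = 0"
  shows "krylov I b e L (refl_right I I a g) = householder I a (krylov I b e L g)"
  unfolding krylov_def perp_householder[OF assms(2), symmetric]
  by (rule perp_cong) (rule gram_iterate_spike_refl_right[OF assms])

lemma measurable_krylov: "krylov I b e L \<in> measurable (gauss (I \<times> I)) (gauss I)"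
proof -
  let ?A = "\<lambda>g. spike_matrix b e g" and ?M = "gauss (I \<times> I)"
  have A: "(\<lambda>g. ?A g (i, j)) \<in> borel_measurable ?M" if "i \<in> I" "j \<in> I" for i j
    unfolding spike_matrix_def using measurable_gauss_apply[of "(i, j)" "I \<times> I"] that by simp
  have mv: "(\<lambda>g. mv I I (?A g) (f g) i) \<in> borel_measurable ?M"
    if "\<And>j. j \<in> I \<Longrightarrow> (\<lambda>g. f g j) \<in> borel_measurable ?M" "i \<in> I" for f i
    unfolding mv_def using that by (simp add: measurable_ip A)
  have tmv: "(\<lambda>g. tmv I I (?A g) (f g) i) \<in> borel_measurable ?M"
    if "\<And>j. j \<in> I \<Longrightarrow> (\<lambda>g. f g j) \<in> borel_measurable ?M" "i \<in> I" for f i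
    unfolding tmv_def using that by (simp add: measurable_ip A)
  have it: "(\<lambda>g. (gram I I (?A g) ^^ L) e i) \<in> borel_measurable ?M" if "i \<in> I" for i
    using that
  proof (induction L arbitrary: i)
    case (Suc L)
    then show ?case unfolding gram_def funpow.simps comp_def by (intro tmv mv)
  qed simp
  have "(\<lambda>g. perp I e ((gram I I (?A g) ^^ L) e)) \<in> measurable ?M (PiM I (\<lambda>_. borel))"
    unfolding perp_def
    by (intro measurable_restrict borel_measurable_diff borel_measurable_times measurable_ip it
        borel_measurable_const; assumption)
  then show ?thesis
    unfolding measurable_cong_sets[OF refl sets_gauss] krylov_def[abs_def] .
qed

text \<open>For most noise matrices, \<open>invariant_direction_transfer\<close> yields a vector of
  \<open>C\<close> close in direction to the Krylov vector, and \<open>cone_functional_bound\<close>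
  carries its estimates over, for all \<open>x\<close> and \<open>z\<close> at once. The hypothesis
  \<open>small\<close> gives \<open>perp_norm\<close> a probability of at least 1/2 to be positive;
  dividing by it doubles the failure probability.\<close>

lemma matricization_of_krylov_event:
  assumes n: "4 \<le> n" "n \<le> m" and e: "L2_set e {0..<n * m} = 1"
    and small: "real m * (6 * exp (- (real m / 16))) + 2 * exp (- (real m / 16)) + 2 * exp (- (real (n * m) / 256)) \<le> 1 / 2"
  shows "\<exists>E\<in>sets (gauss ({0..<n * m} \<times> {0..<n * m})).
    measure (gauss ({0..<n * m} \<times> {0..<n * m})) (space (gauss ({0..<n * m} \<times> {0..<n * m})) - E) \<le>
      2 * (real m * (6 * exp (- (real m / 16))) + 2 * exp (- (real m / 16)) + 2 * exp (- (real (n * m) / 256))) \<and>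
    (\<forall>g\<in>E. \<forall>x z. L2_set x {0..<n} = 1 \<longrightarrow> L2_set z {0..<m} = 1 \<longrightarrow>
      \<bar>ip {0..<n * m} (kron n x z) (krylov {0..<n * m} b e L g)\<bar> \<le> 16 / sqrt (real n) * L2_set (krylov {0..<n * m} b e L g) {0..<n * m})"
proof -
  define N where "N = n * m"
  define I where "I = {0..<N}"
  \<comment> \<open>Makes the error sqrt (2 \<tau>) of the same order 1 / sqrt n as the main
    term.\<close>
  define \<tau> where "\<tau> = 1 / real n"
  define p where "p = real m * (6 * exp (- (real m / 16))) + 2 * exp (- (real m / 16)) + 2 * exp (- (real N / 256))"
  interpret P: prob_space "gauss (I \<times> I)" by (rule prob_space_gauss)
  interpret G: prob_space "gauss I" by (rule prob_space_gauss)
  have I: "finite I" and eI: "L2_set e I = 1" using e by (auto simp: I_def N_def)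
  have \<tau>: "0 < \<tau>" "\<tau> < 1" using n by (auto simp: \<tau>_def)
  let ?Y = "krylov I b e L"
  obtain C where C: "C \<in> sets (gauss I)" "measure (gauss I) (space (gauss I) - C) \<le> p"
    and C_good: "\<And>g. g \<in> C \<Longrightarrow> perp_norm I e g \<ge> sqrt (real N) / 2"
      "\<And>g. g \<in> C \<Longrightarrow> \<bar>ip I e g\<bar> \<le> 2 * sqrt (real m)"
      "\<And>g x z. g \<in> C \<Longrightarrow> \<bar>bil {0..<n} {0..<m} (\<lambda>(i, j). g (i + j * n)) x z\<bar> \<le> 5 * sqrt (real m) * (L2_set x {0..<n} * L2_set z {0..<m})"
    using small_matricization_event[OF n e] unfolding I_def N_def p_def by auto
  have N0: "real N > 0" using n by (simp add: N_def)
  have inv: "(\<integral>\<^sup>+g. F (householder I a (?Y g)) \<partial>gauss (I \<times> I)) = (\<integral>\<^sup>+g. F (?Y g) \<partial>gauss (I \<times> I))"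
    if "ip I e a = 0" "F \<in> borel_measurable (gauss I)" for a F
  proof -
    have "(\<lambda>g. F (?Y g)) \<in> borel_measurable (gauss (I \<times> I))"
      using measurable_compose[OF measurable_krylov that(2)] .
    from gauss_invariant_nn_integral[OF refl_right_gauss_invariant[OF I I] this, of a]
    show ?thesis by (simp add: krylov_refl_right[OF I that(1)])
  qed
  have "\<And>g. ip I e (?Y g) = 0" unfolding krylov_def by (rule ip_perp[OF eI])
  note Ye = this
  obtain D where D: "D \<in> sets (gauss I)" and D_cone: "\<And>y. y \<in> D \<Longrightarrow> \<exists>g\<in>C. in_cone I e \<tau> y g"
    and D_prob: "emeasure (gauss (I \<times> I)) {g \<in> space (gauss (I \<times> I)). ?Y g \<notin> D \<and> L2_set (?Y g) I > 0} *
      emeasure (gauss I) {g \<in> space (gauss I). perp_norm I e g > 0} \<le> emeasure (gauss I) (space (gauss I) - C)"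
    using invariant_direction_transfer[OF P.prob_space_axioms I measurable_krylov eI Ye inv C(1) \<tau>] by blast
  define B where "B = {g \<in> space (gauss (I \<times> I)). ?Y g \<notin> D \<and> L2_set (?Y g) I > 0}"
  have Bm: "B \<in> sets (gauss (I \<times> I))"
  proof -
    have [measurable]: "?Y \<in> measurable (gauss (I \<times> I)) (gauss I)" by (rule measurable_krylov)
    note D [measurable]
    have [measurable]: "(\<lambda>g. ip I (?Y g) (?Y g)) \<in> borel_measurable (gauss (I \<times> I))"
      by (intro measurable_ip measurable_into_gauss_apply[OF measurable_krylov]; assumption)
    show ?thesis unfolding B_def L2_eq_sqrt_ip by measurable
  qed
  have "measure (gauss (I \<times> I)) B * (1 / 2) \<le> p"
  proof -
    have half: "emeasure (gauss I) {g \<in> space (gauss I). perp_norm I e g > 0} \<ge> ennreal (1 / 2)"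
    proof -
      have "measure (gauss I) C = 1 - measure (gauss I) (space (gauss I) - C)"
        using G.prob_compl[OF C(1)] by simp
      then have "1 / 2 \<le> measure (gauss I) C" using C(2) small unfolding p_def N_def by linarith
      then have "ennreal (1 / 2) \<le> emeasure (gauss I) C" unfolding G.emeasure_eq_measure by (rule ennreal_leI)
      also have "\<dots> \<le> emeasure (gauss I) {g \<in> space (gauss I). perp_norm I e g > 0}"
      proof (rule emeasure_mono)
        have "perp_norm I e g > 0" if "g \<in> C" for g
          using C_good(1)[OF that] N0 by (meson half_gt_zero less_le_trans real_sqrt_gt_zero)
        then show "C \<subseteq> {g \<in> space (gauss I). perp_norm I e g > 0}"
          using sets.sets_into_space[OF C(1)] by auto
        have [measurable]: "(\<lambda>g. ip I g g) \<in> borel_measurable (gauss I)" "(\<lambda>g. ip I e g) \<in> borel_measurable (gauss I)"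
          by (intro measurable_ip measurable_gauss_apply borel_measurable_const; assumption)+
        show "{g \<in> space (gauss I). perp_norm I e g > 0} \<in> sets (gauss I)"
          unfolding perp_norm_def by measurable
      qed
      finally show ?thesis .
    qed
    have "emeasure (gauss (I \<times> I)) B * ennreal (1 / 2) \<le>
        emeasure (gauss (I \<times> I)) B * emeasure (gauss I) {g \<in> space (gauss I). perp_norm I e g > 0}"
      by (rule mult_left_mono[OF half]) simp
    also have "\<dots> \<le> emeasure (gauss I) (space (gauss I) - C)" using D_prob unfolding B_def .
    finally have "ennreal (measure (gauss (I \<times> I)) B * (1 / 2)) \<le> ennreal (measure (gauss I) (space (gauss I) - C))"
      unfolding P.emeasure_eq_measure G.emeasure_eq_measure ennreal_mult'[OF measure_nonneg] .
    then have "measure (gauss (I \<times> I)) B * (1 / 2) \<le> measure (gauss I) (space (gauss I) - C)"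
      by (rule iffD1[OF ennreal_le_iff[OF measure_nonneg]])
    then show ?thesis using C(2) by linarith
  qed
  then have mB: "measure (gauss (I \<times> I)) B \<le> 2 * p" by simp
  define E where "E = space (gauss (I \<times> I)) - B"
  have E: "E \<in> sets (gauss (I \<times> I))" "space (gauss (I \<times> I)) - E = B"
    using Bm sets.sets_into_space[OF Bm] by (auto simp: E_def)
  have bound: "\<bar>ip I (kron n x z) (?Y g)\<bar> \<le> 16 / sqrt (real n) * L2_set (?Y g) I"
    if g: "g \<in> E" and x: "L2_set x {0..<n} = 1" and z: "L2_set z {0..<m} = 1" for g x z
  proof (cases "L2_set (?Y g) I > 0")
    case False
    then have "L2_set (?Y g) I = 0" using L2_set_nonneg[of "?Y g" I] by linarith
    then show ?thesis using abs_ip_le[of I "kron n x z" "?Y g"] by simp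
  next
    case True
    then have "?Y g \<in> D" using g by (auto simp: E_def B_def)
    then obtain \<gamma> where \<gamma>: "\<gamma> \<in> C" and cone: "in_cone I e \<tau> (?Y g) \<gamma>" using D_cone by blast
    define P where "P = perp_norm I e \<gamma>"
    have P: "P \<ge> sqrt (real N) / 2" using C_good(1)[OF \<gamma>] by (simp add: P_def)
    then have P0: "P > 0" using N0 by (meson half_gt_zero less_le_trans real_sqrt_gt_zero)
    let ?h = "kron n x z"
    have h: "L2_set ?h I = 1" unfolding I_def N_def L2_set_kron using x z by simp
    \<comment> \<open>5 sqrt m from the matricization and 2 sqrt m from the component along
      \<open>e\<close> make 7 sqrt m = 14 / sqrt n * (sqrt N / 2). The 16 at the end is 14 plus a
      bound for sqrt 2.\<close>
    have "\<bar>ip I ?h (\<lambda>i. \<gamma> i - ip I e \<gamma> * e i)\<bar> \<le> 14 / sqrt (real n) * P"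
    proof -
      have "ip I ?h (\<lambda>i. \<gamma> i - ip I e \<gamma> * e i) = ip I ?h \<gamma> - ip I e \<gamma> * ip I ?h e" by (simp only: ip_simps)
      moreover have "\<bar>ip I ?h \<gamma>\<bar> \<le> 5 * sqrt (real m)"
        using C_good(3)[OF \<gamma>, of x z] x z unfolding bil_matricization I_def N_def by simp
      moreover have "\<bar>ip I e \<gamma> * ip I ?h e\<bar> \<le> 2 * sqrt (real m) * 1"
        unfolding abs_mult using abs_ip_le[of I ?h e] h eI C_good(2)[OF \<gamma>] by (intro mult_mono) auto
      ultimately have "\<bar>ip I ?h (\<lambda>i. \<gamma> i - ip I e \<gamma> * e i)\<bar> \<le> 7 * sqrt (real m)" by linarith
      also have "\<dots> = 14 / sqrt (real n) * (sqrt (real N) / 2)"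
        using n by (simp add: N_def real_sqrt_mult)
      also have "\<dots> \<le> 14 / sqrt (real n) * P" by (intro mult_left_mono P) simp
      finally show ?thesis .
    qed
    then have "\<bar>ip I ?h (?Y g)\<bar> \<le> (14 / sqrt (real n) + sqrt (2 * \<tau>)) * L2_set (?Y g) I"
      unfolding P_def using P0 h \<tau> by (intro cone_functional_bound[OF cone eI Ye True]) (auto simp: P_def)
    also have "\<dots> \<le> 16 / sqrt (real n) * L2_set (?Y g) I"
    proof (rule mult_right_mono)
      have "sqrt (2 * \<tau>) = sqrt 2 / sqrt (real n)" by (simp add: \<tau>_def real_sqrt_divide)
      also have "\<dots> \<le> 2 / sqrt (real n)"
        by (intro divide_right_mono real_le_lsqrt) auto
      finally show "14 / sqrt (real n) + sqrt (2 * \<tau>) \<le> 16 / sqrt (real n)" by (simp add: add_divide_distrib[symmetric])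
    qed simp
    finally show ?thesis .
  qed
  show ?thesis
    unfolding N_def[symmetric] I_def[symmetric] p_def[symmetric]
  proof (intro bexI[OF _ E(1)] conjI ballI allI impI)
    show "measure (gauss (I \<times> I)) (space (gauss (I \<times> I)) - E) \<le> 2 * p" unfolding E(2) by (rule mB)
  qed (rule bound)
qed

text \<open>The alignment loss that survives when the overlap of the top right singular vector with \<open>e\<close> is at least
  \<open>c\<close>: its component orthogonal to \<open>e\<close> has a matricization of norm at most \<open>residual \<kappa> c n\<close>.\<close>

definition residual :: "real \<Rightarrow> real \<Rightarrow> nat \<Rightarrow> real" where
  "residual \<kappa> c n = (32 / sqrt (real n) + ((2 + \<kappa>) / (2 + 2 * \<kappa>)) ^ (2 * n)) / c"

text \<open>Union bound: tridiagonalization of the noise, which has \<open>n * m\<close> rows and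
  columns, plus twice the failure probability of \<open>small_matricization_event\<close>.\<close>

definition failure_bound :: "real \<Rightarrow> nat \<Rightarrow> nat \<Rightarrow> real" where
  "failure_bound \<delta> n m = real (n * m) * (6 * exp (- (\<delta>\<^sup>2 * real (n * m) / 16))) +
     2 * (real m * (6 * exp (- (real m / 16))) + 2 * exp (- (real m / 16)) + 2 * exp (- (real (n * m) / 256)))"

text \<open>On the intersection of the two events the conclusion is deterministic and covers every
  choice of top pairs. The power method runs for \<open>n\<close> steps, so that its geometric error
  vanishes with \<open>n\<close> like the other part of \<open>residual\<close>, where 32 = 2 * 16.
  The constants are fixed before \<open>l\<close>.\<close>

lemma unfolding_event:
  assumes l0: "l0 > 1"
  shows "\<exists>\<delta> \<kappa> c n0. 0 < \<delta> \<and> 0 < \<kappa> \<and> 0 < c \<and> (\<forall>n m e v v' l. n0 \<le> n \<longrightarrow> 4 \<le> n \<longrightarrow> n \<le> m \<longrightarrow>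
    L2_set v {0..<n} = 1 \<longrightarrow> L2_set v' {0..<m} = 1 \<longrightarrow> (\<forall>i<n. \<forall>j<m. e (i + j * n) = v i * v' j) \<longrightarrow> l0 \<le> l \<longrightarrow>
    failure_bound \<delta> n m \<le> 1 \<longrightarrow> residual \<kappa> c n < c \<longrightarrow>
    (\<exists>E\<in>sets (gauss ({0..<n * m} \<times> {0..<n * m})).
      measure (gauss ({0..<n * m} \<times> {0..<n * m})) (space (gauss ({0..<n * m} \<times> {0..<n * m})) - E) \<le> failure_bound \<delta> n m \<and>
      (\<forall>g\<in>E. \<forall>\<sigma> u w \<sigma>' x z.
        top_pair {0..<n * m} {0..<n * m} (spike_matrix (l * sqrt (real (n * m))) e g) \<sigma> u w \<longrightarrow>
        top_pair {0..<n} {0..<m} (\<lambda>(i, j). w (i + j * n)) \<sigma>' x z \<longrightarrow>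
        1 - (ip {0..<n} v x)\<^sup>2 \<le> (residual \<kappa> c n / (c - residual \<kappa> c n))\<^sup>2)))"
proof -
  from spiked_gauss_event[OF l0] obtain \<delta> \<kappa> c n0 where pos: "0 < \<delta>" "0 < \<kappa>" "0 < c"
    and ev: "\<forall>N\<ge>n0. \<forall>e. L2_set e {0..<N} = 1 \<longrightarrow>
    (\<exists>E\<in>sets (gauss ({0..<N} \<times> {0..<N})).
      measure (gauss ({0..<N} \<times> {0..<N})) E \<ge> 1 - real N * (6 * exp (- (\<delta>\<^sup>2 * real N / 16))) \<and>
      (\<forall>g\<in>E. (\<forall>x y. bil {0..<N} {0..<N} g x y \<le> (2 + \<kappa>) * sqrt (real N) * (L2_set x {0..<N} * L2_set y {0..<N})) \<and>
        (\<forall>l\<ge>l0. \<forall>\<sigma> u w. top_pair {0..<N} {0..<N} (\<lambda>(i, j). l * sqrt (real N) * e i * e j + g (i, j)) \<sigma> u w \<longrightarrow>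
           \<sigma> \<ge> (2 + \<kappa> + max \<kappa> (c * l)) * sqrt (real N))))"
    by (elim exE conjE) (rule that; assumption)
  have "\<exists>E\<in>sets (gauss ({0..<n * m} \<times> {0..<n * m})).
      measure (gauss ({0..<n * m} \<times> {0..<n * m})) (space (gauss ({0..<n * m} \<times> {0..<n * m})) - E) \<le> failure_bound \<delta> n m \<and>
      (\<forall>g\<in>E. \<forall>\<sigma> u w \<sigma>' x z.
        top_pair {0..<n * m} {0..<n * m} (spike_matrix (l * sqrt (real (n * m))) e g) \<sigma> u w \<longrightarrow>
        top_pair {0..<n} {0..<m} (\<lambda>(i, j). w (i + j * n)) \<sigma>' x z \<longrightarrow>
        1 - (ip {0..<n} v x)\<^sup>2 \<le> (residual \<kappa> c n / (c - residual \<kappa> c n))\<^sup>2)"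
    if n: "n0 \<le> n" "4 \<le> n" "n \<le> m" and v: "L2_set v {0..<n} = 1" "L2_set v' {0..<m} = 1"
      and ev': "\<forall>i<n. \<forall>j<m. e (i + j * n) = v i * v' j" and l: "l0 \<le> l"
      and fb: "failure_bound \<delta> n m \<le> 1" and res: "residual \<kappa> c n < c" for n m e v v' l
  proof -
    define N where "N = n * m"
    define I where "I = {0..<N}"
    define b where "b = l * sqrt (real N)"
    interpret P: prob_space "gauss (I \<times> I)" by (rule prob_space_gauss)
    have e: "L2_set e I = 1" unfolding I_def N_def using L2_set_kron_like[of n m e v v'] ev' v by simp
    have "n \<le> n * m" using n by simp
    then have nN: "n0 \<le> N" "0 < N" using n(1,2) unfolding N_def by linarith+
    from ev[rule_format, OF nN(1) e[unfolded I_def]] obtain E1 where E1: "E1 \<in> sets (gauss (I \<times> I))"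
      "measure (gauss (I \<times> I)) E1 \<ge> 1 - real N * (6 * exp (- (\<delta>\<^sup>2 * real N / 16)))"
      and good1: "\<forall>g\<in>E1. (\<forall>x y. bil I I g x y \<le> (2 + \<kappa>) * sqrt (real N) * (L2_set x I * L2_set y I)) \<and>
        (\<forall>l\<ge>l0. \<forall>\<sigma> u w. top_pair I I (\<lambda>(i, j). l * sqrt (real N) * e i * e j + g (i, j)) \<sigma> u w \<longrightarrow>
           \<sigma> \<ge> (2 + \<kappa> + max \<kappa> (c * l)) * sqrt (real N))"
      unfolding I_def by (elim bexE conjE) (rule that[unfolded I_def]; assumption)
    have noise: "bil I I g x y \<le> (2 + \<kappa>) * sqrt (real N) * (L2_set x I * L2_set y I)" if "g \<in> E1" for g x y
      using good1 that by blast
    have top_val: "\<sigma> \<ge> (2 + \<kappa> + max \<kappa> (c * l)) * sqrt (real N)"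
      if "g \<in> E1" "top_pair I I (spike_matrix b e g) \<sigma> u w" for g \<sigma> u w
      using good1[rule_format, OF that(1), THEN conjunct2, rule_format, OF l] that(2)
      unfolding spike_matrix_def b_def by blast
    define p where "p = real m * (6 * exp (- (real m / 16))) + 2 * exp (- (real m / 16)) + 2 * exp (- (real (n * m) / 256))"
    have "0 \<le> real (n * m) * (6 * exp (- (\<delta>\<^sup>2 * real (n * m) / 16)))" by simp
    then have "p \<le> 1 / 2" using fb unfolding failure_bound_def p_def[symmetric] by linarith
    from matricization_of_krylov_event[OF n(2,3) e[unfolded I_def N_def] this[unfolded p_def], of b n]
    obtain E2 where E2: "E2 \<in> sets (gauss (I \<times> I))" "measure (gauss (I \<times> I)) (space (gauss (I \<times> I)) - E2) \<le> 2 * p"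
      and kry0: "\<forall>g\<in>E2. \<forall>x z. L2_set x {0..<n} = 1 \<longrightarrow> L2_set z {0..<m} = 1 \<longrightarrow>
        \<bar>ip I (kron n x z) (krylov I b e n g)\<bar> \<le> 16 / sqrt (real n) * L2_set (krylov I b e n g) I"
      unfolding I_def N_def p_def by (elim bexE conjE) (rule that[unfolded I_def N_def p_def]; assumption)
    note kry = kry0[rule_format]
    define E where "E = E1 \<inter> E2"
    have E: "E \<in> sets (gauss (I \<times> I))" using E1 E2 by (auto simp: E_def)
    have mE: "measure (gauss (I \<times> I)) (space (gauss (I \<times> I)) - E) \<le> failure_bound \<delta> n m"
    proof -
      have "space (gauss (I \<times> I)) - E = (space (gauss (I \<times> I)) - E1) \<union> (space (gauss (I \<times> I)) - E2)" by (auto simp: E_def)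
      then have "measure (gauss (I \<times> I)) (space (gauss (I \<times> I)) - E) \<le>
        measure (gauss (I \<times> I)) (space (gauss (I \<times> I)) - E1) + measure (gauss (I \<times> I)) (space (gauss (I \<times> I)) - E2)"
        using E1(1) E2(1) by (simp add: measure_Un_le)
      also have "measure (gauss (I \<times> I)) (space (gauss (I \<times> I)) - E1) \<le> real N * (6 * exp (- (\<delta>\<^sup>2 * real N / 16)))"
        using P.prob_compl[OF E1(1)] E1(2) by simp
      finally show ?thesis using E2(2) unfolding failure_bound_def p_def[symmetric] N_def by simp
    qed
    have main: "1 - (ip {0..<n} v x)\<^sup>2 \<le> (residual \<kappa> c n / (c - residual \<kappa> c n))\<^sup>2"
      if g: "g \<in> E" and top: "top_pair I I (spike_matrix b e g) \<sigma> u w"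
        and top': "top_pair {0..<n} {0..<m} (\<lambda>(i, j). w (i + j * n)) \<sigma>' x z" for g \<sigma> u w \<sigma>' x z
    proof -
      define s where "s = (2 + \<kappa>) * sqrt (real N)"
      define d where "d = residual \<kappa> c n"
      have rN: "sqrt (real N) > 0" using nN by simp
      have lpos: "l > 0" using l l0 by simp
      have g12: "g \<in> E1" "g \<in> E2" using g by (auto simp: E_def)
      interpret spiked I b s \<sigma> e u w g "spike_matrix b e g"
        by unfold_locales (use e noise[OF g12(1)] top pos lpos in \<open>auto simp: spike_matrix_def s_def b_def\<close>)
      have \<sigma>: "\<sigma> \<ge> (2 + \<kappa> + max \<kappa> (c * l)) * sqrt (real N)" by (rule top_val[OF g12(1) top])
      have \<sigma>1: "\<sigma> \<ge> (2 + 2 * \<kappa>) * sqrt (real N)"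
      proof -
        have "(2 + 2 * \<kappa>) * sqrt (real N) \<le> (2 + \<kappa> + max \<kappa> (c * l)) * sqrt (real N)"
          by (intro mult_right_mono) auto
        then show ?thesis using \<sigma> by linarith
      qed
      have "(2 + \<kappa>) * sqrt (real N) < (2 + 2 * \<kappa>) * sqrt (real N)" using pos rN by (intro mult_strict_right_mono) auto
      then have gap: "s < \<sigma>" using \<sigma>1 unfolding s_def by linarith
      have "c * l * sqrt (real N) + s \<le> (2 + \<kappa> + max \<kappa> (c * l)) * sqrt (real N)"
        unfolding s_def distrib_right[symmetric] by (intro mult_right_mono) auto
      \<comment> \<open>By \<open>overlap\<close>, \<open>\<sigma>\<close> exceeds \<open>s\<close>
        by at most \<open>b * \<bar>ip I e w\<bar>\<close>, and by the event it does so by at least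
        \<open>c * b\<close>.\<close>
      then have "c * b \<le> b * \<bar>ip I e w\<bar>" using \<sigma> overlap unfolding b_def by (simp add: mult.assoc)
      then have ov: "c \<le> \<bar>ip I e w\<bar>" using lpos rN by (simp add: b_def mult.commute)
      have ratio: "s / \<sigma> \<le> (2 + \<kappa>) / (2 + 2 * \<kappa>)"
      proof -
        have "s / \<sigma> \<le> s / ((2 + 2 * \<kappa>) * sqrt (real N))"
          using \<sigma>1 pos rN gap s by (intro divide_left_mono mult_pos_pos) auto
        then show ?thesis using rN by (simp add: s_def)
      qed
      \<comment> \<open>As \<open>e\<close> is the tensor product of \<open>v\<close> and
        \<open>v'\<close>, the second-step matrix is \<open>ip I e w\<close> times a rank-one matrix
        plus \<open>D\<close>.\<close>
      define D where "D = (\<lambda>(i, j). perp I e w (i + j * n))"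
      have Db: "\<bar>bil {0..<n} {0..<m} D x z\<bar> \<le> d" if "L2_set x {0..<n} = 1" "L2_set z {0..<m} = 1" for x z
      proof -
        have h: "L2_set (kron n x z) I = 1" unfolding I_def N_def L2_set_kron using that by simp
        have "\<bar>ip I (kron n x z) (perp I e w)\<bar> \<le> (2 * (16 / sqrt (real n)) + (s / \<sigma>) ^ (2 * n)) / c"
          by (rule functional_on_perp[OF gap pos(3) ov])
             (use h kry[OF g12(2) that] in \<open>auto simp: krylov_def\<close>)
        also have "\<dots> \<le> d"
          unfolding d_def residual_def using pos ratio s gap
          by (intro divide_right_mono add_mono power_mono) auto
        finally show ?thesis unfolding D_def bil_matricization I_def N_def .
      qed
      have D: "\<bar>bil {0..<n} {0..<m} D x z\<bar> \<le> d * (L2_set x {0..<n} * L2_set z {0..<m})" for x z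
        by (rule abs_bil_le_of_unit[OF Db]) auto
      have inI: "i + j * n \<in> I" if "i < n" "j < m" for i j
        using bij_betw_grid[of n m] that unfolding bij_betw_def I_def N_def by force
      have dc: "d < c" using res by (simp add: d_def)
      have d0: "d \<ge> 0" using pos by (simp add: d_def residual_def)
      have "1 - (ip {0..<n} v x)\<^sup>2 \<le> (d / (\<bar>ip I e w\<bar> - d))\<^sup>2"
      proof (rule rank_one_perturbation_loss[OF top' _ v D])
        show "(\<lambda>(i, j). w (i + j * n)) (i, j) = ip I e w * v i * v' j + D (i, j)"
          if "i \<in> {0..<n}" "j \<in> {0..<m}" for i j
          using that ev' inI[of i j] by (simp add: D_def perp_def)
        show "d < \<bar>ip I e w\<bar>" using dc ov by linarith
      qed
      also have "\<dots> \<le> (d / (c - d))\<^sup>2"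
        using d0 dc ov by (intro power_mono divide_left_mono mult_pos_pos) auto
      finally show ?thesis by (simp add: d_def)
    qed
    show ?thesis
      unfolding N_def[symmetric] I_def[symmetric] b_def[symmetric]
      by (intro bexI[OF _ E] conjI ballI allI impI mE main)
  qed
  then show ?thesis
    by (intro exI[of _ \<delta>] exI[of _ \<kappa>] exI[of _ c] exI[of _ n0] conjI allI impI pos)
qed

section \<open>Asymptotics of the error bounds\<close>

lemma mult_exp_minus_le:
  fixes a t :: real
  assumes "a > 0" "t > 0"
  shows "t * exp (- (a * t)) \<le> 27 / a ^ 3 / t\<^sup>2"
proof -
  \<comment> \<open>Cubing gives exp x \<ge> (x / 3)^3; of the three powers of \<open>t\<close>, two
    are left in the denominator, which is what summability needs.\<close>
  have "a * t / 3 \<le> exp (a * t / 3)" using exp_ge_add_one_self[of "a * t / 3"] by linarith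
  then have "(a * t / 3) ^ 3 \<le> exp (a * t / 3) ^ 3" using assms by (intro power_mono) auto
  also have "exp (a * t / 3) ^ 3 = exp (a * t)" by (simp add: exp_of_nat_mult[symmetric])
  finally have le: "a ^ 3 * t ^ 3 / 27 \<le> exp (a * t)" by (simp add: power_mult_distrib power_divide)
  have pos: "a ^ 3 * t ^ 3 / 27 > 0" using assms by simp
  have "t * exp (- (a * t)) = t / exp (a * t)" by (simp add: exp_minus field_simps)
  also have "\<dots> \<le> t / (a ^ 3 * t ^ 3 / 27)"
    using le pos assms by (intro divide_left_mono mult_pos_pos) auto
  also have "\<dots> = 27 / a ^ 3 / t\<^sup>2" using assms by (simp add: power2_eq_square power3_eq_cube)
  finally show ?thesis .
qed

lemma failure_bound_le:
  assumes "\<delta> > 0"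
  shows "\<exists>C. \<forall>n m. 1 \<le> n \<longrightarrow> n \<le> m \<longrightarrow> failure_bound \<delta> n m \<le> C / (real n)\<^sup>2"
proof -
  define K where "K a = 27 / a ^ 3" for a :: real
  define C where "C = 6 * K (\<delta>\<^sup>2 / 16) + 16 * K (1 / 16) + 4 * K (1 / 256)"
  have "failure_bound \<delta> n m \<le> C / (real n)\<^sup>2" if n: "1 \<le> n" "n \<le> m" for n m
  proof -
    have K: "t * exp (- (a * t)) \<le> K a / (real n)\<^sup>2" if "a > 0" "t \<ge> real n" for a t
    proof -
      have t: "t > 0" using that(2) n by linarith
      have "t * exp (- (a * t)) \<le> K a / t\<^sup>2" unfolding K_def by (rule mult_exp_minus_le[OF that(1) t])
      also have "\<dots> \<le> K a / (real n)\<^sup>2"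
        using that n t by (intro divide_left_mono power_mono mult_pos_pos) (auto simp: K_def)
      finally show ?thesis .
    qed
    have nm: "real (n * m) \<ge> real n" "real m \<ge> real n" "real (n * m) \<ge> 1" "real m \<ge> 1"
      using n mult_le_mono[OF n(1) order_trans[OF n]] by (simp_all del: of_nat_mult)
    have exps: "exp (- (real m / 16)) \<le> real m * exp (- (1 / 16 * real m))"
      "exp (- (real (n * m) / 256)) \<le> real (n * m) * exp (- (1 / 256 * real (n * m)))"
      using nm by (simp_all add: mult_le_cancel_right1)
    have "failure_bound \<delta> n m \<le> 6 * (K (\<delta>\<^sup>2 / 16) / (real n)\<^sup>2) +
       2 * (6 * (K (1 / 16) / (real n)\<^sup>2) + 2 * (K (1 / 16) / (real n)\<^sup>2) + 2 * (K (1 / 256) / (real n)\<^sup>2))"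
    proof -
      have k: "real (n * m) * exp (- (\<delta>\<^sup>2 / 16 * real (n * m))) \<le> K (\<delta>\<^sup>2 / 16) / (real n)\<^sup>2"
        "real m * exp (- (1 / 16 * real m)) \<le> K (1 / 16) / (real n)\<^sup>2"
        "real (n * m) * exp (- (1 / 256 * real (n * m))) \<le> K (1 / 256) / (real n)\<^sup>2"
        using assms nm by (intro K; simp)+
      have eq: "failure_bound \<delta> n m = 6 * (real (n * m) * exp (- (\<delta>\<^sup>2 / 16 * real (n * m)))) +
        2 * (6 * (real m * exp (- (1 / 16 * real m))) + 2 * exp (- (real m / 16)) + 2 * exp (- (real (n * m) / 256)))"
        unfolding failure_bound_def by (simp del: of_nat_mult)
      show ?thesis
        unfolding eq
        by (intro add_mono mult_left_mono k order_trans[OF exps(1) k(2)] order_trans[OF exps(2) k(3)]) simp_all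
    qed
    also have "\<dots> = C / (real n)\<^sup>2" by (simp add: C_def add_divide_distrib)
    finally show ?thesis .
  qed
  then show ?thesis by blast
qed

lemma residual_tendsto_0:
  assumes "\<kappa> > 0"
  shows "residual \<kappa> c \<longlonglongrightarrow> 0"
proof -
  define \<rho> where "\<rho> = (2 + \<kappa>) / (2 + 2 * \<kappa>)"
  have \<rho>: "0 \<le> \<rho>" "\<rho> < 1" using assms by (auto simp: \<rho>_def)
  have "\<rho>\<^sup>2 < 1" using \<rho> by (simp add: power_less_one_iff abs_square_less_1)
  then have "(\<lambda>n. (\<rho>\<^sup>2) ^ n) \<longlonglongrightarrow> 0" by (intro LIMSEQ_power_zero) simp
  then have 1: "(\<lambda>n. \<rho> ^ (2 * n)) \<longlonglongrightarrow> 0" by (simp add: power_mult)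
  have "filterlim (\<lambda>n. sqrt (real n)) at_top sequentially"
    by (rule filterlim_compose[OF sqrt_at_top filterlim_real_sequentially])
  then have 2: "(\<lambda>n. 32 / sqrt (real n)) \<longlonglongrightarrow> 0"
    by (intro tendsto_divide_0[OF tendsto_const] filterlim_at_top_imp_at_infinity)
  have "(\<lambda>n. (32 / sqrt (real n) + \<rho> ^ (2 * n)) * (1 / c)) \<longlonglongrightarrow> (0 + 0) * (1 / c)"
    by (intro tendsto_mult tendsto_add 1 2 tendsto_const)
  then show ?thesis by (simp add: residual_def[abs_def] \<rho>_def)
qed

section \<open>Unfolding of spiked tensors\<close>

text \<open>The unfolded tensor power, in the digit order of \<open>Mat\<close>: the least
  significant digit is the row index of \<open>Mat1\<close>, so \<open>tensor_vec_Suc\<close>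
  exhibits the matricization of the spike direction as a rank-one matrix.\<close>

definition tensor_vec :: "nat \<Rightarrow> nat \<Rightarrow> (nat \<Rightarrow> real) \<Rightarrow> nat \<Rightarrow> real" where
  "tensor_vec n q v a = prod_list (map v (digits n q a))"

lemma tensor_vec_Suc:
  assumes "i < n"
  shows "tensor_vec n (Suc q) v (i + j * n) = v i * tensor_vec n q v j"
  using assms by (simp add: tensor_vec_def digits_Suc)

lemma L2_set_tensor_vec:
  assumes "L2_set v {0..<n} = 1"
  shows "L2_set (tensor_vec n q v) {0..<n ^ q} = 1"
proof (induction q)
  case 0
  then show ?case by (simp add: tensor_vec_def digits_def)
next
  case (Suc q)
  then show ?case
    using L2_set_kron_like[of n "n ^ q" "tensor_vec n (Suc q) v" v "tensor_vec n q v"] assms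
    by (simp add: tensor_vec_Suc)
qed

lemma length_digits [simp]: "length (digits n q a) = q"
  by (simp add: digits_def)

lemma digits_in_multi_indices: "n \<ge> 1 \<Longrightarrow> digits n q a \<in> multi_indices n q"
  by (auto simp: multi_indices_def digits_def)

lemma inj_on_digits: "inj_on (digits n q) {0..<n ^ q}"
proof (induction q)
  case 0
  then show ?case by (simp add: inj_on_def)
next
  case (Suc q)
  show ?case
  proof (rule inj_onI)
    fix a b assume ab: "a \<in> {0..<n ^ Suc q}" "b \<in> {0..<n ^ Suc q}" and eq: "digits n (Suc q) a = digits n (Suc q) b"
    then have "a mod n = b mod n" "digits n q (a div n) = digits n q (b div n)" by (auto simp: digits_Suc)
    moreover have "a div n < n ^ q" "b div n < n ^ q"
      using ab by (auto intro!: less_mult_imp_div_less simp: mult.commute)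
    ultimately have "a div n = b div n" "a mod n = b mod n" using Suc by (auto dest: inj_onD)
    then show "a = b" by (metis div_mult_mod_eq)
  qed
qed

lemma tensor_power_append:
  assumes "length is = q" "length js = q"
  shows "tensor_power (q + q) v (is @ js) = prod_list (map (\<lambda>i. v $ i) is) * prod_list (map (\<lambda>i. v $ i) js)"
proof -
  have "prod_list (map (\<lambda>i. v $ i) (is @ js)) = (\<Prod>j<q + q. v $ ((is @ js) ! j))"
    using assms unfolding prod.list_conv_set_nth
    by (intro prod.cong) (auto simp: atLeast0LessThan nth_append)
  then show ?thesis by (simp add: tensor_power_def)
qed

lemma (in prob_space) std_normal_family_law:
  assumes indep: "indep_vars (\<lambda>_. borel) X K" and K: "K \<noteq> {}"
    and normal: "\<And>i. i \<in> K \<Longrightarrow> distributed M lborel (X i) std_normal_density"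
  shows "(\<lambda>\<omega>. \<lambda>i\<in>K. X i \<omega>) \<in> measurable M (gauss K)" "distr M (gauss K) (\<lambda>\<omega>. \<lambda>i\<in>K. X i \<omega>) = gauss K"
proof -
  have rv: "X i \<in> borel_measurable M" if "i \<in> K" for i
    using distributed_measurable[OF normal[OF that]] by simp
  then show m: "(\<lambda>\<omega>. \<lambda>i\<in>K. X i \<omega>) \<in> measurable M (gauss K)"
    unfolding measurable_cong_sets[OF refl sets_gauss] by (rule measurable_restrict)
  have law: "distr M borel (X i) = std_normal" if "i \<in> K" for i
  proof -
    have "distr M borel (X i) = distr M lborel (X i)" by (rule distr_cong) auto
    then show ?thesis using distributed_distr_eq_density[OF normal[OF that]] by (simp add: std_normal_def)
  qed
  have "distr M (gauss K) (\<lambda>\<omega>. \<lambda>i\<in>K. X i \<omega>) = distr M (PiM K (\<lambda>_. borel)) (\<lambda>\<omega>. \<lambda>i\<in>K. X i \<omega>)"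
    by (rule distr_cong) (auto simp: sets_gauss)
  also have "\<dots> = PiM K (\<lambda>i. distr M borel (X i))"
    using indep_vars_iff_distr_eq_PiM'[OF K, of X "\<lambda>_. borel"] rv indep by blast
  also have "\<dots> = gauss K" unfolding gauss_def by (rule PiM_cong) (auto simp: law)
  finally show "distr M (gauss K) (\<lambda>\<omega>. \<lambda>i\<in>K. X i \<omega>) = gauss K" .
qed

text \<open>With t the inner product, \<open>Loss\<close> is 2 - 2 |t|, and t^2 \<le> |t| as |t|
  \<le> 1. The quadratic form of the bound matches
  \<open>rank_one_perturbation_loss\<close>.\<close>

lemma Loss_bounds:
  assumes "x \<in> carrier_vec n" "v \<in> carrier_vec n" "L2_set (\<lambda>i. x $ i) {0..<n} = 1" "L2_set (\<lambda>i. v $ i) {0..<n} = 1"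
  shows "0 \<le> Loss x v" "Loss x v \<le> 2 * (1 - (ip {0..<n} (\<lambda>i. v $ i) (\<lambda>i. x $ i))\<^sup>2)"
proof -
  let ?I = "{0..<n}" and ?x = "\<lambda>i. x $ i" and ?v = "\<lambda>i. v $ i"
  define t where "t = ip ?I ?v ?x"
  have c: "x - v \<in> carrier_vec n" "x + v \<in> carrier_vec n" using assms by auto
  have xx: "ip ?I ?x ?x = 1" "ip ?I ?v ?v = 1" using assms by (simp_all add: ip_self_L2)
  have "(vec_norm (x - v))\<^sup>2 = ip ?I (\<lambda>i. ?x i - ?v i) (\<lambda>i. ?x i - ?v i)"
    unfolding vec_norm_eq_L2[OF c(1)] ip_self_L2[symmetric] by (rule ip_cong) (use assms in auto)
  also have "\<dots> = 2 - 2 * t" unfolding ip_simps by (simp add: xx t_def ip_commute[of ?I ?x ?v])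
  finally have 1: "(vec_norm (x - v))\<^sup>2 = 2 - 2 * t" .
  have "(vec_norm (x + v))\<^sup>2 = ip ?I (\<lambda>i. ?x i + ?v i) (\<lambda>i. ?x i + ?v i)"
    unfolding vec_norm_eq_L2[OF c(2)] ip_self_L2[symmetric] by (rule ip_cong) (use assms in auto)
  also have "\<dots> = 2 + 2 * t" unfolding ip_simps by (simp add: xx t_def ip_commute[of ?I ?x ?v])
  finally have 2: "(vec_norm (x + v))\<^sup>2 = 2 + 2 * t" .
  have "\<bar>t\<bar> \<le> 1" using abs_ip_le[of ?I ?v ?x] assms by (simp add: t_def)
  then have "t * t \<le> \<bar>t\<bar>" by (metis abs_ge_zero abs_mult_self_eq mult_left_le)
  then show "Loss x v \<le> 2 * (1 - (ip ?I ?v ?x)\<^sup>2)"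
    unfolding Loss_def 1 2 t_def[symmetric] by (auto simp: power2_eq_square min_def abs_if split: if_splits)
  show "0 \<le> Loss x v" by (simp add: Loss_def)
qed

text \<open>Multiplication by \<open>sqrt (real n)\<close> normalizes the noise to variance 1; it
  changes singular values but not singular vectors.\<close>

lemma recursive_unfolding_top_pairs:
  fixes G :: tensor
  assumes n: "n \<ge> 1" and k: "k = Suc q + Suc q"
    and est: "recursive_unfolding_estimate n k (spiked_tensor n k \<beta> v G) x"
    and g: "\<And>a c. a < n * n ^ q \<Longrightarrow> c < n * n ^ q \<Longrightarrow> g (a, c) = G (digits n (Suc q) a @ digits n (Suc q) c)"
  shows "\<exists>\<sigma> u w \<sigma>' z. x \<in> carrier_vec n \<and>
    top_pair {0..<n * n ^ q} {0..<n * n ^ q} (spike_matrix (\<beta> * sqrt (real n)) (tensor_vec n (Suc q) (\<lambda>i. v $ i)) g) \<sigma> u w \<and>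
    top_pair {0..<n} {0..<n ^ q} (\<lambda>(i, j). w (i + j * n)) \<sigma>' (\<lambda>i. x $ i) z"
proof -
  let ?N = "n * n ^ q" and ?X = "spiked_tensor n k \<beta> v G" and ?e = "tensor_vec n (Suc q) (\<lambda>i. v $ i)"
  have k2: "k div 2 = Suc q" "k div 2 - 1 = q" using k by auto
  have A: "Mat n k ?X \<in> carrier_mat ?N ?N" by (simp add: Mat_def k2)
  have B: "Mat1 n (n ^ q) w \<in> carrier_mat n (n ^ q)" for w by (simp add: Mat1_def)
  obtain w \<sigma> u \<sigma>' z where top: "top_singular_triple (Mat n k ?X) \<sigma> u w"
    and top': "top_singular_triple (Mat1 n (n ^ q) w) \<sigma>' x z"
    using est unfolding recursive_unfolding_estimate_def k2(2) top_right_singular_vector_def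
      top_left_singular_vector_def by blast
  have entry: "sqrt (real n) * Mat n k ?X $$ (a, c) = spike_matrix (\<beta> * sqrt (real n)) ?e g (a, c)"
    if "a \<in> {0..<?N}" "c \<in> {0..<?N}" for a c
  proof -
    let ?is = "digits n (Suc q) a @ digits n (Suc q) c"
    have "Mat n k ?X $$ (a, c) = ?X ?is" using that by (simp add: Mat_def k2)
    also have "\<dots> = \<beta> * (?e a * ?e c) + 1 / sqrt (real n) * g (a, c)"
      using that tensor_power_append[of "digits n (Suc q) a" "Suc q" "digits n (Suc q) c" v]
      by (simp only: spiked_tensor_def k tensor_vec_def length_digits g atLeastLessThan_iff)
    finally have "sqrt (real n) * Mat n k ?X $$ (a, c) =
        sqrt (real n) * (\<beta> * (?e a * ?e c)) + (sqrt (real n) * (1 / sqrt (real n))) * g (a, c)"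
      by (simp only: distrib_left mult.assoc)
    also have "sqrt (real n) * (1 / sqrt (real n)) = 1" using n by simp
    finally show ?thesis by (simp add: spike_matrix_def mult_ac)
  qed
  have "top_pair {0..<?N} {0..<?N} (\<lambda>p. sqrt (real n) * Mat n k ?X $$ p) (sqrt (real n) * \<sigma>) (\<lambda>i. u $ i) (\<lambda>i. w $ i)"
    by (rule top_pair_scale[OF top_singular_triple_top_pair(3)[OF A top]]) (use n in simp)
  moreover have "top_pair {0..<?N} {0..<?N} (\<lambda>p. sqrt (real n) * Mat n k ?X $$ p) s y z \<longleftrightarrow>
      top_pair {0..<?N} {0..<?N} (spike_matrix (\<beta> * sqrt (real n)) ?e g) s y z" for s y z
    by (rule top_pair_cong) (rule entry)
  ultimately have "top_pair {0..<?N} {0..<?N} (spike_matrix (\<beta> * sqrt (real n)) ?e g) (sqrt (real n) * \<sigma>) (\<lambda>i. u $ i) (\<lambda>i. w $ i)"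
    by blast
  moreover have "top_pair {0..<n} {0..<n ^ q} (\<lambda>p. Mat1 n (n ^ q) w $$ p) \<sigma>' (\<lambda>i. x $ i) (\<lambda>j. z $ j)"
    by (rule top_singular_triple_top_pair(3)[OF B top'])
  then have "top_pair {0..<n} {0..<n ^ q} (\<lambda>(i, j). (\<lambda>i. w $ i) (i + j * n)) \<sigma>' (\<lambda>i. x $ i) (\<lambda>j. z $ j)"
    by (subst (asm) top_pair_cong[where B="\<lambda>(i, j). (\<lambda>i. w $ i) (i + j * n)"]) (auto simp: Mat1_def)
  moreover have "x \<in> carrier_vec n" by (rule top_singular_triple_top_pair(1)[OF B top'])
  ultimately show ?thesis by blast
qed

theorem theorem5:
  fixes M :: "'a measure"
    and k :: nat
    and b \<epsilon> :: real
    and v0 :: "nat \<Rightarrow> real vec"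
    and \<beta> :: "nat \<Rightarrow> real"
    and G :: "nat \<Rightarrow> nat list \<Rightarrow> 'a \<Rightarrow> real"
    and vhat :: "nat \<Rightarrow> 'a \<Rightarrow> real vec"
  assumes "prob_space M"
    and "even k" and "k \<ge> 4"
    and "b = (real k - 2) / 4"
    and "\<epsilon> > 0"
    and v0: "\<And>n. n \<ge> 1 \<Longrightarrow> v0 n \<in> carrier_vec n \<and> vec_norm (v0 n) = 1"
    and \<beta>: "\<And>n. n \<ge> 1 \<Longrightarrow> \<beta> n \<ge> (1 + \<epsilon>) * real n powr b"
    and G_indep: "\<And>n. n \<ge> 1 \<Longrightarrow>
      prob_space.indep_vars M (\<lambda>_. borel) (G n) (multi_indices n k)"
    and G_normal: "\<And>n is. n \<ge> 1 \<Longrightarrow> is \<in> multi_indices n k \<Longrightarrow>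
      distributed M lborel (G n is) std_normal_density"
    and vhat: "\<And>n \<omega>. n \<ge> 1 \<Longrightarrow> \<omega> \<in> space M \<Longrightarrow>
      recursive_unfolding_estimate n k
        (spiked_tensor n k (\<beta> n) (v0 n) (\<lambda>is. G n is \<omega>)) (vhat n \<omega>)"
  shows "AE \<omega> in M. (\<lambda>n. Loss (vhat n \<omega>) (v0 n)) \<longlonglongrightarrow> 0"
proof -
  interpret M: prob_space M by fact
  define q where "q = k div 2 - 1"
  have k: "k = Suc q + Suc q" and q: "q \<ge> 1" using \<open>even k\<close> \<open>k \<ge> 4\<close> by (auto simp: q_def elim!: evenE)
  obtain \<delta> \<kappa> c n0 where pos: "0 < \<delta>" "0 < \<kappa>" "0 < c"
    and ev: "\<forall>n m e v v' l. n0 \<le> n \<longrightarrow> 4 \<le> n \<longrightarrow> n \<le> m \<longrightarrow>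
    L2_set v {0..<n} = 1 \<longrightarrow> L2_set v' {0..<m} = 1 \<longrightarrow> (\<forall>i<n. \<forall>j<m. e (i + j * n) = v i * v' j) \<longrightarrow> 1 + \<epsilon> \<le> l \<longrightarrow>
    failure_bound \<delta> n m \<le> 1 \<longrightarrow> residual \<kappa> c n < c \<longrightarrow>
    (\<exists>E\<in>sets (gauss ({0..<n * m} \<times> {0..<n * m})).
      measure (gauss ({0..<n * m} \<times> {0..<n * m})) (space (gauss ({0..<n * m} \<times> {0..<n * m})) - E) \<le> failure_bound \<delta> n m \<and>
      (\<forall>g\<in>E. \<forall>\<sigma> u w \<sigma>' x z.
        top_pair {0..<n * m} {0..<n * m} (spike_matrix (l * sqrt (real (n * m))) e g) \<sigma> u w \<longrightarrow>
        top_pair {0..<n} {0..<m} (\<lambda>(i, j). w (i + j * n)) \<sigma>' x z \<longrightarrow>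
        1 - (ip {0..<n} v x)\<^sup>2 \<le> (residual \<kappa> c n / (c - residual \<kappa> c n))\<^sup>2))"
  proof -
    have "1 + \<epsilon> > 1" using \<open>\<epsilon> > 0\<close> by simp
    from unfolding_event[OF this] show thesis
      by (elim exE conjE) (rule that; assumption)
  qed
  obtain C where C: "\<And>n m. 1 \<le> n \<Longrightarrow> n \<le> m \<Longrightarrow> failure_bound \<delta> n m \<le> C / (real n)\<^sup>2"
    using failure_bound_le[OF pos(1)] by blast
  have res: "residual \<kappa> c \<longlonglongrightarrow> 0" by (rule residual_tendsto_0[OF pos(2)])
  \<comment> \<open>The side conditions of \<open>unfolding_event\<close>, valid from some
    \<open>n\<close> on; for smaller \<open>n\<close> the exceptional event is taken empty.\<close>
  define large where "large n \<longleftrightarrow> n0 \<le> n \<and> 4 \<le> n \<and> C / (real n)\<^sup>2 \<le> 1 \<and> residual \<kappa> c n < c" for n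
  have ev_large: "\<forall>\<^sub>F n in sequentially. large n"
  proof -
    have "(\<lambda>n. C * inverse ((real n)\<^sup>2)) \<longlonglongrightarrow> C * 0"
      by (intro tendsto_mult tendsto_const tendsto_inverse_0_at_top filterlim_pow_at_top filterlim_real_sequentially) auto
    then have "\<forall>\<^sub>F n in sequentially. C * inverse ((real n)\<^sup>2) < 1" by (rule order_tendstoD) simp
    moreover have "\<forall>\<^sub>F n in sequentially. residual \<kappa> c n < c" using res pos(3) by (rule order_tendstoD)
    ultimately show ?thesis
      using eventually_ge_at_top[of n0] eventually_ge_at_top[of 4]
      by eventually_elim (simp add: large_def divide_inverse)
  qed
  define v where "v n = (\<lambda>i. v0 n $ i)" for n
  define I where "I n = {0..<n * n ^ q}" for n :: nat
  define idx where "idx n = (\<lambda>p. digits n (Suc q) (fst p) @ digits n (Suc q) (snd p))" for n :: nat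
  define \<Gamma> where "\<Gamma> n \<omega> = (\<lambda>p\<in>I n \<times> I n. G n (idx n p) \<omega>)" for n \<omega>
  \<comment> \<open>Spike strength on the scale of the unfolded noise: with N = n^(q+1), \<beta>
    sqrt n = l sqrt N. As n^b = sqrt (n^q), the hypothesis on \<open>\<beta>\<close> says exactly l
    \<ge> 1 + \<epsilon>.\<close>
  define l where "l n = \<beta> n / sqrt (real (n ^ q))" for n
  have v: "L2_set (v n) {0..<n} = 1" if "n \<ge> 1" for n
    using v0[OF that] vec_norm_eq_L2[of "v0 n" n] by (simp add: v_def)
  have l: "1 + \<epsilon> \<le> l n" "l n * sqrt (real (n * n ^ q)) = \<beta> n * sqrt (real n)" if "n \<ge> 1" for n
  proof -
    have b2: "b = real q / 2" using \<open>b = (real k - 2) / 4\<close> k by simp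
    have "real n powr b = sqrt (real (n ^ q))"
      unfolding b2 using that by (simp add: powr_half_sqrt[symmetric] powr_powr powr_realpow[symmetric])
    moreover have "sqrt (real (n ^ q)) > 0" using that by simp
    ultimately show "1 + \<epsilon> \<le> l n" using \<beta>[OF that] by (simp add: l_def pos_le_divide_eq)
    show "l n * sqrt (real (n * n ^ q)) = \<beta> n * sqrt (real n)"
      using that by (simp add: l_def real_sqrt_mult)
  qed
  have \<Gamma>: "\<Gamma> n \<in> measurable M (gauss (I n \<times> I n))" "distr M (gauss (I n \<times> I n)) (\<Gamma> n) = gauss (I n \<times> I n)"
    if n: "n \<ge> 1" for n
  proof -
    let ?K = "multi_indices n k"
    have idx_K: "idx n ` (I n \<times> I n) \<subseteq> ?K"
      using n k by (auto simp: idx_def multi_indices_def digits_def)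
    have "inj_on (idx n) (I n \<times> I n)"
    proof (rule inj_onI)
      fix p p' assume p: "p \<in> I n \<times> I n" "p' \<in> I n \<times> I n" and "idx n p = idx n p'"
      then have eq: "digits n (Suc q) (fst p) = digits n (Suc q) (fst p')" "digits n (Suc q) (snd p) = digits n (Suc q) (snd p')"
        by (auto simp: idx_def)
      have inj: "inj_on (digits n (Suc q)) (I n)"
        using inj_on_digits[of n "Suc q"] by (simp add: I_def)
      show "p = p'"
        using inj_onD[OF inj eq(1)] inj_onD[OF inj eq(2)] p by (simp add: mem_Times_iff prod_eq_iff)
    qed
    note re = gauss_reindex[OF this idx_K] measurable_gauss_reindex[OF idx_K]
    have "?K \<noteq> {}" using digits_in_multi_indices[OF n, of k 0] by blast
    then have law: "(\<lambda>\<omega>. \<lambda>is\<in>?K. G n is \<omega>) \<in> measurable M (gauss ?K)"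
        "distr M (gauss ?K) (\<lambda>\<omega>. \<lambda>is\<in>?K. G n is \<omega>) = gauss ?K"
      using M.std_normal_family_law[OF G_indep[OF n]] G_normal[OF n] by auto
    have eq: "\<Gamma> n = (\<lambda>g. \<lambda>p\<in>I n \<times> I n. g (idx n p)) \<circ> (\<lambda>\<omega>. \<lambda>is\<in>?K. G n is \<omega>)"
      using idx_K by (auto simp: \<Gamma>_def fun_eq_iff)
    show "\<Gamma> n \<in> measurable M (gauss (I n \<times> I n))"
      unfolding eq by (rule measurable_comp[OF law(1) re(2)])
    show "distr M (gauss (I n \<times> I n)) (\<Gamma> n) = gauss (I n \<times> I n)"
      unfolding eq using distr_distr[OF re(2) law(1)] law(2) re(1) by simp
  qed
  have q_le: "n \<le> n ^ q" for n :: nat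
    using q by (cases "n = 0") (auto intro: self_le_power)
  define good where "good n E \<longleftrightarrow> E \<in> sets (gauss (I n \<times> I n)) \<and>
      measure (gauss (I n \<times> I n)) (space (gauss (I n \<times> I n)) - E) \<le> C / (real n)\<^sup>2 \<and>
      (\<forall>g\<in>E. \<forall>\<sigma> u w \<sigma>' x z.
        top_pair (I n) (I n) (spike_matrix (\<beta> n * sqrt (real n)) (tensor_vec n (Suc q) (v n)) g) \<sigma> u w \<longrightarrow>
        top_pair {0..<n} {0..<n ^ q} (\<lambda>(i, j). w (i + j * n)) \<sigma>' x z \<longrightarrow>
        1 - (ip {0..<n} (v n) x)\<^sup>2 \<le> (residual \<kappa> c n / (c - residual \<kappa> c n))\<^sup>2)" for n E
  have "\<exists>E. good n E" if "large n" for n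
  proof -
    have n: "n0 \<le> n" "4 \<le> n" "n \<ge> 1" "C / (real n)\<^sup>2 \<le> 1" "residual \<kappa> c n < c"
      using that by (auto simp: large_def)
    have fb: "failure_bound \<delta> n (n ^ q) \<le> C / (real n)\<^sup>2" by (rule C[OF n(3) q_le])
    have fb1: "failure_bound \<delta> n (n ^ q) \<le> 1" using fb n(4) by linarith
    have tv: "\<forall>i<n. \<forall>j<n ^ q. tensor_vec n (Suc q) (v n) (i + j * n) = v n i * tensor_vec n q (v n) j"
      by (simp add: tensor_vec_Suc)
    from ev[THEN spec, of n, THEN spec, of "n ^ q", THEN spec, of "tensor_vec n (Suc q) (v n)", THEN spec, of "v n",
        THEN spec, of "tensor_vec n q (v n)", THEN spec, of "l n", THEN mp, OF n(1), THEN mp, OF n(2), THEN mp, OF q_le,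
        THEN mp, OF v[OF n(3)], THEN mp, OF L2_set_tensor_vec[OF v[OF n(3)]], THEN mp, OF tv, THEN mp, OF l(1)[OF n(3)],
        THEN mp, OF fb1, THEN mp, OF n(5)]
    show ?thesis
    proof (elim bexE conjE)
      fix E assume E: "E \<in> sets (gauss ({0..<n * n ^ q} \<times> {0..<n * n ^ q}))"
        "measure (gauss ({0..<n * n ^ q} \<times> {0..<n * n ^ q})) (space (gauss ({0..<n * n ^ q} \<times> {0..<n * n ^ q})) - E) \<le> failure_bound \<delta> n (n ^ q)"
        "\<forall>g\<in>E. \<forall>\<sigma> u w \<sigma>' x z.
        top_pair {0..<n * n ^ q} {0..<n * n ^ q} (spike_matrix (l n * sqrt (real (n * n ^ q))) (tensor_vec n (Suc q) (v n)) g) \<sigma> u w \<longrightarrow>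
        top_pair {0..<n} {0..<n ^ q} (\<lambda>(i, j). w (i + j * n)) \<sigma>' x z \<longrightarrow>
        1 - (ip {0..<n} (v n) x)\<^sup>2 \<le> (residual \<kappa> c n / (c - residual \<kappa> c n))\<^sup>2"
      show "\<exists>E. good n E"
        unfolding good_def I_def l(2)[OF n(3), symmetric]
        by (rule exI[of _ E], intro conjI E(1) order_trans[OF E(2) fb] E(3))
    qed
  qed
  then obtain E where E: "\<And>n. large n \<Longrightarrow> good n (E n)" by metis
  \<comment> \<open>Stated through the noise alone, because \<open>vhat\<close> is an arbitrary
    choice of singular vectors and may fail to be measurable.\<close>
  define bad where "bad n = (if large n then \<Gamma> n -` (space (gauss (I n \<times> I n)) - E n) \<inter> space M else {})" for n
  have bad: "bad n \<in> sets M" "measure M (bad n) \<le> C / (real n)\<^sup>2 \<or> bad n = {}" for n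
  proof -
    show "bad n \<in> sets M"
    proof (cases "large n")
      case True
      then have n: "n \<ge> 1" by (simp add: large_def)
      have "space (gauss (I n \<times> I n)) - E n \<in> sets (gauss (I n \<times> I n))" using E[OF True] by (auto simp: good_def)
      then show ?thesis using measurable_sets[OF \<Gamma>(1)[OF n]] True by (simp add: bad_def)
    qed (simp add: bad_def)
    show "measure M (bad n) \<le> C / (real n)\<^sup>2 \<or> bad n = {}"
    proof (cases "large n")
      case True
      then have n: "n \<ge> 1" by (simp add: large_def)
      have s: "space (gauss (I n \<times> I n)) - E n \<in> sets (gauss (I n \<times> I n))" using E[OF True] by (auto simp: good_def)
      have "measure M (bad n) = measure (distr M (gauss (I n \<times> I n)) (\<Gamma> n)) (space (gauss (I n \<times> I n)) - E n)"
        using measure_distr[OF \<Gamma>(1)[OF n] s] True by (simp add: bad_def)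
      then show ?thesis using E[OF True] unfolding \<Gamma>(2)[OF n] by (simp add: good_def)
    qed (simp add: bad_def)
  qed
  have "summable (\<lambda>n. measure M (bad n))"
  proof (rule summable_comparison_test)
    show "summable (\<lambda>n. \<bar>C\<bar> * inverse ((real n)\<^sup>2))"
      by (intro summable_mult inverse_power_summable) simp
    have "C / (real n)\<^sup>2 \<le> \<bar>C\<bar> * inverse ((real n)\<^sup>2)" for n
      by (simp add: divide_inverse mult_right_mono)
    then have "measure M (bad n) \<le> \<bar>C\<bar> * inverse ((real n)\<^sup>2)" for n
      using bad(2)[of n] by (elim disjE) (rule order_trans; assumption | simp)+
    then show "\<exists>N. \<forall>n\<ge>N. norm (measure M (bad n)) \<le> \<bar>C\<bar> * inverse ((real n)\<^sup>2)" by simp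
  qed
  \<comment> \<open>This half of Borel-Cantelli uses summability only; the tensors of different
    sizes may be coupled in any way.\<close>
  then have "AE \<omega> in M. \<forall>\<^sub>F n in sequentially. \<omega> \<in> space M - bad n"
    by (intro borel_cantelli_AE1 bad(1)) (auto simp: M.emeasure_eq_measure)
  then show ?thesis
  proof (rule AE_mp, intro AE_I2 impI)
    fix \<omega> assume \<omega>: "\<omega> \<in> space M" and ev_good: "\<forall>\<^sub>F n in sequentially. \<omega> \<in> space M - bad n"
    from ev_large ev_good have bound: "\<forall>\<^sub>F n in sequentially. 0 \<le> Loss (vhat n \<omega>) (v0 n) \<and>
        Loss (vhat n \<omega>) (v0 n) \<le> 2 * (residual \<kappa> c n / (c - residual \<kappa> c n))\<^sup>2"
    proof eventually_elim
      case (elim n)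
      then have n: "n \<ge> 1" by (simp add: large_def)
      have "\<Gamma> n \<omega> \<in> space (gauss (I n \<times> I n))" using measurable_space[OF \<Gamma>(1)[OF n] \<omega>] .
      then have \<Gamma>E: "\<Gamma> n \<omega> \<in> E n" using elim by (auto simp: bad_def)
      obtain \<sigma> u w \<sigma>' z where x: "vhat n \<omega> \<in> carrier_vec n"
        and t1: "top_pair (I n) (I n) (spike_matrix (\<beta> n * sqrt (real n)) (tensor_vec n (Suc q) (v n)) (\<Gamma> n \<omega>)) \<sigma> u w"
        and t2: "top_pair {0..<n} {0..<n ^ q} (\<lambda>(i, j). w (i + j * n)) \<sigma>' (\<lambda>i. vhat n \<omega> $ i) z"
        using recursive_unfolding_top_pairs[OF n k vhat[OF n \<omega>], of "\<Gamma> n \<omega>"]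
        by (auto simp: \<Gamma>_def I_def idx_def v_def)
      have L: "L2_set (\<lambda>i. vhat n \<omega> $ i) {0..<n} = 1" using t2 by (simp add: top_pair_def)
      have "1 - (ip {0..<n} (v n) (\<lambda>i. vhat n \<omega> $ i))\<^sup>2 \<le> (residual \<kappa> c n / (c - residual \<kappa> c n))\<^sup>2"
        using E[OF elim(1)] \<Gamma>E t1 t2 unfolding good_def by blast
      then show ?case
        using Loss_bounds[OF x conjunct1[OF v0[OF n]] L v[OF n, unfolded v_def]] by (simp add: v_def)
    qed
    have "(\<lambda>n. 2 * (residual \<kappa> c n / (c - residual \<kappa> c n))\<^sup>2) \<longlonglongrightarrow> 2 * (0 / (c - 0))\<^sup>2"
      by (intro tendsto_intros res) (use pos(3) in simp)
    then have "(\<lambda>n. 2 * (residual \<kappa> c n / (c - residual \<kappa> c n))\<^sup>2) \<longlonglongrightarrow> 0" by simp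
    then show "(\<lambda>n. Loss (vhat n \<omega>) (v0 n)) \<longlonglongrightarrow> 0"
      by (rule tendsto_sandwich[OF _ _ tendsto_const, rotated 2])
         (use bound in \<open>auto elim: eventually_mono\<close>)
  qed
qed

end
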